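(* Let $n_1,n_2,n_3\ge0$ be integers and let $a,b,c\in\mathbb C$ be nonzero with $a^2+b^2+c^2=0$. On $V=\mathbb C^{n_1}\oplus\mathbb C^{n_2}\oplus\mathbb C^{n_3}$, with Cartesian coordinates $x_i$, $x_i'$, $x_i''$ on the three summands, consider \begin{align*} L_{\mathcal A}&=\Delta_1+\frac{b^2c^2}{a^4}\sum_{i<j}\frac{2}{(x_i-x_j)^2}+a^2\sum_{i,j}\frac{2}{(bx_i'-cx_j'')^2}\\ &+\Delta_2+\frac{a^2c^2}{b^4}\sum_{i<j}\frac{2}{(x_i'-x_j')^2}+b^2\sum_{i,j}\frac{2}{(ax_i-cx_j'')^2}\\ &+\Delta_3+\frac{a^2b^2}{c^4}\sum_{i<j}\frac{2}{(x_i''-x_j'')^2}+c^2\sum_{i,j}\frac{2}{(ax_i-bx_j')^2}, \end{align*} and for $d=1,2,\dots$ put $L_d=\frac1{2^dd!}\,\mathrm{ad}_{L_{\mathcal A}}^d(p_d)$, where $$p_d=a^{d-2}\sum_{i=1}^{n_1}x_i^d+b^{d-2}\sum_{i=1}^{n_2}(x_i')^d+c^{d-2}\sum_{i=1}^{n_3}(x_i'')^d .$$ Then the operator $L_{\mathcal A}$ is completely integrable, with $[L_{d_1},L_{d_2}]=0$ for all $d_1,d_2\ge1$.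
   Context: $\Delta_1,\Delta_2,\Delta_3$ are the standard Laplacians in the coordinates $x_i$, $x_i'$, $x_i''$ respectively; indices range over $1,\dots,n_1$ for $x_i$, $1,\dots,n_2$ for $x'_i$, $1,\dots,n_3$ for $x''_i$. $\mathrm{ad}_L(m)=Lm-mL$, and $p_d$ is regarded as a multiplication operator. "Completely integrable" means there are $n=n_1+n_2+n_3$ algebraically independent pairwise commuting differential operators including $L_{\mathcal A}$, with coefficients regular off the singular hyperplanes. *)

theory Defs
  imports "HOL-Analysis.Analysis" "HOL-Library.Poly_Mapping"
begin

section \<open>Differential operators on the complement of finitely many hyperplanes\<close>

text \<open>
  A finite index set \<open>I\<close> describes the affine space of families \<open>x\<close> of complex numbers indexed
  by \<open>I\<close>, and a set \<open>H\<close> of linear forms describes the hyperplanes that are removed from it.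
  Differential operators are maps on functions of \<open>x\<close>. They are compared only through
  their action on the regular functions on the complement, evaluated at points of the complement;
  this action is faithful. The complement is open, so derivatives at its points, and hence
  compositions of differential operators, are unaffected by the values of functions elsewhere
  (for instance those produced by \<open>inverse 0 = 0\<close>).
\<close>

type_synonym 'i scalar_fun = "('i \<Rightarrow> complex) \<Rightarrow> complex"
type_synonym 'i oper = "'i scalar_fun \<Rightarrow> 'i scalar_fun"

definition reg_points :: "'i set \<Rightarrow> 'i scalar_fun set \<Rightarrow> ('i \<Rightarrow> complex) set" where
  "reg_points I H = {x \<in> I \<rightarrow>\<^sub>E UNIV. \<forall>h\<in>H. h x \<noteq> 0}"

text \<open>The localization of the polynomial ring in the coordinates \<open>x i\<close>, \<open>i \<in> I\<close>, at the forms in \<open>H\<close>.\<close>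

inductive_set localized_poly :: "'i set \<Rightarrow> 'i scalar_fun set \<Rightarrow> 'i scalar_fun set"
  for I :: "'i set" and H :: "'i scalar_fun set" where
  const: "(\<lambda>_. k) \<in> localized_poly I H"
| coord: "i \<in> I \<Longrightarrow> (\<lambda>x. x i) \<in> localized_poly I H"
| inv: "h \<in> H \<Longrightarrow> (\<lambda>x. inverse (h x)) \<in> localized_poly I H"
| add: "f \<in> localized_poly I H \<Longrightarrow> g \<in> localized_poly I H
    \<Longrightarrow> (\<lambda>x. f x + g x) \<in> localized_poly I H"
| mult: "f \<in> localized_poly I H \<Longrightarrow> g \<in> localized_poly I H
    \<Longrightarrow> (\<lambda>x. f x * g x) \<in> localized_poly I H"

text \<open>
  A regular function may take arbitrary values outside the complement; in this way the set
  of regular functions is mapped into itself by differential operators.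
\<close>

definition regular_funs :: "'i set \<Rightarrow> 'i scalar_fun set \<Rightarrow> 'i scalar_fun set" where
  "regular_funs I H = {f. \<exists>g \<in> localized_poly I H. \<forall>x \<in> reg_points I H. f x = g x}"

definition pderivative :: "'i \<Rightarrow> 'i oper" where
  "pderivative i f = (\<lambda>x. deriv (\<lambda>t. f (x(i := t))) (x i))"

definition mult_oper :: "'i scalar_fun \<Rightarrow> 'i oper" where
  "mult_oper g f = (\<lambda>x. g x * f x)"

definition commutator :: "'i oper \<Rightarrow> 'i oper \<Rightarrow> 'i oper" where
  "commutator P Q = (\<lambda>f x. P (Q f) x - Q (P f) x)"

definition oper_eq :: "'i set \<Rightarrow> 'i scalar_fun set \<Rightarrow> 'i oper \<Rightarrow> 'i oper \<Rightarrow> bool" where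
  "oper_eq I H P Q \<longleftrightarrow> (\<forall>f \<in> regular_funs I H. \<forall>x \<in> reg_points I H. P f x = Q f x)"

definition zero_oper :: "'i oper" where
  "zero_oper = (\<lambda>f x. 0)"

text \<open>
  Iterated partial derivatives are indexed by words \<open>w\<close> in the indices. As partial derivatives
  of regular functions commute, this is the same as indexing by multi-indices.
\<close>

definition diff_oper :: "'i set \<Rightarrow> 'i scalar_fun set \<Rightarrow> 'i oper \<Rightarrow> bool" where
  "diff_oper I H P \<longleftrightarrow>
     (\<exists>S u. finite S \<and> S \<subseteq> lists I \<and> (\<forall>w\<in>S. u w \<in> regular_funs I H) \<and>
        oper_eq I H P (\<lambda>f x. \<Sum>w\<in>S. u w x * foldr pderivative w f x))"

text \<open>
  A polynomial with complex coefficients in the variables \<open>0, \<dots>, n - 1\<close> is a finitely supported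
  function on exponents, which are in turn finitely supported functions of the variables.
  The order of the factors in a monomial is immaterial for commuting operators.
\<close>

definition oper_monom :: "'i oper list \<Rightarrow> (nat \<Rightarrow>\<^sub>0 nat) \<Rightarrow> 'i oper" where
  "oper_monom Qs m = foldr (\<lambda>k T. ((Qs ! k) ^^ Poly_Mapping.lookup m k) \<circ> T) [0..<length Qs] id"

definition oper_poly :: "((nat \<Rightarrow>\<^sub>0 nat) \<Rightarrow>\<^sub>0 complex) \<Rightarrow> 'i oper list \<Rightarrow> 'i oper" where
  "oper_poly p Qs = (\<lambda>f x. \<Sum>m\<in>Poly_Mapping.keys p. Poly_Mapping.lookup p m * oper_monom Qs m f x)"

definition alg_independent :: "'i set \<Rightarrow> 'i scalar_fun set \<Rightarrow> 'i oper list \<Rightarrow> bool" where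
  "alg_independent I H Qs \<longleftrightarrow>
     (\<forall>p. (\<forall>m\<in>Poly_Mapping.keys p. Poly_Mapping.keys m \<subseteq> {..<length Qs}) \<longrightarrow> p \<noteq> 0 \<longrightarrow>
        \<not> oper_eq I H (oper_poly p Qs) zero_oper)"

definition completely_integrable :: "'i set \<Rightarrow> 'i scalar_fun set \<Rightarrow> 'i oper \<Rightarrow> bool" where
  "completely_integrable I H L \<longleftrightarrow>
     (\<exists>Qs. length Qs = card I \<and> L \<in> set Qs \<and>
        (\<forall>Q\<in>set Qs. diff_oper I H Q) \<and>
        (\<forall>P\<in>set Qs. \<forall>Q\<in>set Qs. oper_eq I H (commutator P Q) zero_oper) \<and>
        alg_independent I H Qs)"


section \<open>The three-species deformed Calogero--Moser operator\<close>

text \<open>Names of the coordinates on the three summands.\<close>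

datatype coord = X nat | X' nat | X'' nat

definition coords :: "nat \<Rightarrow> nat \<Rightarrow> nat \<Rightarrow> coord set" where
  "coords n1 n2 n3 = X ` {1..n1} \<union> X' ` {1..n2} \<union> X'' ` {1..n3}"

definition sing_forms ::
    "nat \<Rightarrow> nat \<Rightarrow> nat \<Rightarrow> complex \<Rightarrow> complex \<Rightarrow> complex \<Rightarrow> coord scalar_fun set" where
  "sing_forms n1 n2 n3 a b c =
     {\<lambda>x. x (X i) - x (X j) | i j. 1 \<le> i \<and> i < j \<and> j \<le> n1} \<union>
     {\<lambda>x. x (X' i) - x (X' j) | i j. 1 \<le> i \<and> i < j \<and> j \<le> n2} \<union>
     {\<lambda>x. x (X'' i) - x (X'' j) | i j. 1 \<le> i \<and> i < j \<and> j \<le> n3} \<union>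
     {\<lambda>x. b * x (X' i) - c * x (X'' j) | i j. i \<in> {1..n2} \<and> j \<in> {1..n3}} \<union>
     {\<lambda>x. a * x (X i) - c * x (X'' j) | i j. i \<in> {1..n1} \<and> j \<in> {1..n3}} \<union>
     {\<lambda>x. a * x (X i) - b * x (X' j) | i j. i \<in> {1..n1} \<and> j \<in> {1..n2}}"

definition laplacian :: "(nat \<Rightarrow> coord) \<Rightarrow> nat \<Rightarrow> coord oper" where
  "laplacian Y n f = (\<lambda>x. \<Sum>i=1..n. pderivative (Y i) (pderivative (Y i) f) x)"

definition L_A :: "nat \<Rightarrow> nat \<Rightarrow> nat \<Rightarrow> complex \<Rightarrow> complex \<Rightarrow> complex \<Rightarrow> coord oper" where
  "L_A n1 n2 n3 a b c f = (\<lambda>x.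
      laplacian X n1 f x
    + (b^2 * c^2 / a^4) * (\<Sum>j=1..n1. \<Sum>i=1..<j. 2 / (x (X i) - x (X j))^2) * f x
    + a^2 * (\<Sum>i=1..n2. \<Sum>j=1..n3. 2 / (b * x (X' i) - c * x (X'' j))^2) * f x
    + laplacian X' n2 f x
    + (a^2 * c^2 / b^4) * (\<Sum>j=1..n2. \<Sum>i=1..<j. 2 / (x (X' i) - x (X' j))^2) * f x
    + b^2 * (\<Sum>i=1..n1. \<Sum>j=1..n3. 2 / (a * x (X i) - c * x (X'' j))^2) * f x
    + laplacian X'' n3 f x
    + (a^2 * b^2 / c^4) * (\<Sum>j=1..n3. \<Sum>i=1..<j. 2 / (x (X'' i) - x (X'' j))^2) * f x
    + c^2 * (\<Sum>i=1..n1. \<Sum>j=1..n2. 2 / (a * x (X i) - b * x (X' j))^2) * f x)"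

definition power_sum ::
    "nat \<Rightarrow> nat \<Rightarrow> nat \<Rightarrow> complex \<Rightarrow> complex \<Rightarrow> complex \<Rightarrow> nat \<Rightarrow> coord scalar_fun" where
  "power_sum n1 n2 n3 a b c d = (\<lambda>x.
      a powi (int d - 2) * (\<Sum>i=1..n1. x (X i) ^ d)
    + b powi (int d - 2) * (\<Sum>i=1..n2. x (X' i) ^ d)
    + c powi (int d - 2) * (\<Sum>i=1..n3. x (X'' i) ^ d))"

definition L_int ::
    "nat \<Rightarrow> nat \<Rightarrow> nat \<Rightarrow> complex \<Rightarrow> complex \<Rightarrow> complex \<Rightarrow> nat \<Rightarrow> coord oper" where
  "L_int n1 n2 n3 a b c d = (\<lambda>f x.
     1 / (2 ^ d * fact d) *
       (commutator (L_A n1 n2 n3 a b c) ^^ d) (mult_oper (power_sum n1 n2 n3 a b c d)) f x)"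

end

theory Submission
  imports Defs "HOL-Library.Function_Algebras"
begin

text \<open>
  Let \<open>\<alpha> i\<close> be \<open>a\<close>, \<open>b\<close> or \<open>c\<close> according to the species of the \<open>i\<close>-th particle. In the variables
  \<open>\<alpha> i * x i\<close> all interactions take the same form,
  \<open>U = \<kappa> * (\<Sum>i j. 1 / (\<alpha> i\<^sup>2 * \<alpha> j\<^sup>2 * (\<alpha> i * x i - \<alpha> j * x j)\<^sup>2))\<close> with \<open>\<kappa> = a\<^sup>2 * b\<^sup>2 * c\<^sup>2\<close>,
  and \<open>a\<^sup>2 + b\<^sup>2 + c\<^sup>2 = 0\<close> enters only through the relation
  \<open>\<alpha> i\<^sup>2 * \<alpha> j\<^sup>2 * (\<alpha> i\<^sup>2 + \<alpha> j\<^sup>2) = - \<kappa>\<close> between different species. This relation is exactly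
  what makes an explicit cubic operator \<open>Q\<close> commute with \<open>L\<close>.

  Under \<open>ad\<close>, the operator \<open>L\<close> and multiplication by \<open>p\<^sub>2\<close> generate a copy of \<open>sl\<^sub>2\<close>. Since \<open>Q\<close> is a
  lowest weight vector and \<open>ad (p\<^sub>2)\<^sup>3 Q\<close> is a multiple of \<open>p\<^sub>3\<close>, we get \<open>ad L\<^sup>4 p\<^sub>3 = 0\<close>.
  As \<open>p\<^bsub>d+1\<^esub>\<close> is a multiple of \<open>[ad L p\<^sub>3, p\<^sub>d]\<close>, it inductively generates a finite-dimensional
  \<open>sl\<^sub>2\<close>-module, and its weight then forces \<open>ad L\<^bsup>d+2\<^esup> p\<^bsub>d+1\<^esub> = 0\<close>. By the Leibniz rule
  \<open>ad L\<^bsup>d+e\<^esup> (p\<^sub>d * p\<^sub>e)\<close> is a multiple of \<open>L\<^sub>d * L\<^sub>e\<close>, so the \<open>L\<^sub>d\<close> commute because the \<open>p\<^sub>d\<close> do.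

  The principal symbol of \<open>L\<^sub>d\<close> is \<open>p\<^sub>d\<close>. The functions \<open>p\<^sub>2, \<dots>, p\<^bsub>n+1\<^esub>\<close> are algebraically
  independent, as their Jacobian is a Vandermonde determinant up to nonzero factors; and \<open>L\<^sub>2 = L\<close>.
\<close>

section \<open>Commutators in associative algebras\<close>

definition ad :: "'a::ring \<Rightarrow> 'a \<Rightarrow> 'a" where
  "ad x y = x * y - y * x"

lemma ad_add_right: "ad x (y + z) = ad x y + ad x z"
  and ad_diff_right: "ad x (y - z) = ad x y - ad x z"
  and ad_add_left: "ad (x + w) y = ad x y + ad w y"
  and ad_zero_right [simp]: "ad x 0 = 0"
  and ad_zero_left [simp]: "ad 0 x = 0"
  and ad_self [simp]: "ad x x = 0"
  and ad_swap: "ad x y = - ad y x"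
  by (simp_all add: ad_def algebra_simps)

lemma ad_mult: "ad x (y * z) = ad x y * z + y * ad x z"
  by (simp add: ad_def algebra_simps)

lemma ad_mult_left: "ad (x * w) y = x * ad w y + ad x y * w"
  by (simp add: ad_def algebra_simps)

lemma ad_jacobi: "ad x (ad y z) = ad (ad x y) z + ad y (ad x z)"
  by (simp add: ad_def algebra_simps)

lemma ad_sum_right: "ad x (sum f A) = (\<Sum>a\<in>A. ad x (f a))"
  by (simp add: ad_def sum_distrib_left sum_distrib_right sum_subtractf)

lemma ad_sum_left: "ad (sum f A) y = (\<Sum>a\<in>A. ad (f a) y)"
  by (simp add: ad_def sum_distrib_left sum_distrib_right sum_subtractf)

lemma ad_scaleR_right: "ad x (c *\<^sub>R y) = c *\<^sub>R ad x (y :: 'a::real_algebra)"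
  and ad_scaleR_left: "ad (c *\<^sub>R x) y = c *\<^sub>R ad x (y :: 'a::real_algebra)"
  by (simp_all add: ad_def scaleR_diff_right)

lemma ad_eq_0_iff: "ad x y = 0 \<longleftrightarrow> x * y = y * x"
  by (simp add: ad_def)

section \<open>Leibniz rule for iterated commutators\<close>

lemma ad_pow_zero [simp]: "(ad x ^^ n) 0 = 0"
  by (induction n) auto

lemma ad_pow_add: "(ad x ^^ n) (y + z) = (ad x ^^ n) y + (ad x ^^ n) z"
  by (induction n) (auto simp: ad_add_right)

lemma ad_pow_diff: "(ad x ^^ n) (y - z) = (ad x ^^ n) y - (ad x ^^ n) z"
  by (induction n) (auto simp: ad_diff_right)

lemma ad_pow_sum: "(ad x ^^ n) (sum f A) = (\<Sum>a\<in>A. (ad x ^^ n) (f a))"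
  by (induction n) (auto simp: ad_sum_right)

lemma ad_pow_scaleR: "(ad x ^^ n) (c *\<^sub>R y) = c *\<^sub>R (ad x ^^ n) (y :: 'a::real_algebra)"
  by (induction n) (auto simp: ad_scaleR_right)

lemma ad_pow_vanish_mono:
  assumes "(ad x ^^ m) y = 0" "m \<le> n"
  shows "(ad x ^^ n) y = 0"
proof -
  obtain k where "n = k + m" using assms(2) by (metis add.commute le_Suc_ex)
  then show ?thesis by (simp add: funpow_add assms(1))
qed

lemma ad_pow_mult:
  fixes x :: "'a::real_algebra"
  shows "(ad x ^^ n) (y * z) =
    (\<Sum>k\<le>n. real (n choose k) *\<^sub>R ((ad x ^^ k) y * (ad x ^^ (n - k)) z))"
proof (induction n)
  case (Suc n)
  let ?t = "\<lambda>k l. (ad x ^^ k) y * (ad x ^^ l) z"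
  have "(ad x ^^ Suc n) (y * z) =
      (\<Sum>k\<le>n. real (n choose k) *\<^sub>R ?t (Suc k) (n - k)) + (\<Sum>k\<le>n. real (n choose k) *\<^sub>R ?t k (Suc (n - k)))"
    by (simp add: Suc.IH ad_sum_right ad_scaleR_right ad_mult scaleR_add_right sum.distrib)
  also have "(\<Sum>k\<le>n. real (n choose k) *\<^sub>R ?t (Suc k) (n - k)) =
      (\<Sum>k\<le>Suc n. (if k = 0 then 0 else real (n choose (k - 1))) *\<^sub>R ?t k (Suc n - k))"
    by (subst sum.atMost_Suc_shift) simp
  also have "(\<Sum>k\<le>n. real (n choose k) *\<^sub>R ?t k (Suc (n - k))) =
      (\<Sum>k\<le>Suc n. real (n choose k) *\<^sub>R ?t k (Suc n - k))"
    by (simp add: Suc_diff_le)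
  also have "(\<Sum>k\<le>Suc n. (if k = 0 then 0 else real (n choose (k - 1))) *\<^sub>R ?t k (Suc n - k)) + \<dots> =
      (\<Sum>k\<le>Suc n. real (Suc n choose k) *\<^sub>R ?t k (Suc n - k))"
    unfolding sum.distrib [symmetric]
  proof (rule sum.cong [OF refl])
    fix k
    show "(if k = 0 then 0 else real (n choose (k - 1))) *\<^sub>R ?t k (Suc n - k)
        + real (n choose k) *\<^sub>R ?t k (Suc n - k) = real (Suc n choose k) *\<^sub>R ?t k (Suc n - k)"
      by (cases k) (simp_all add: scaleR_add_left)
  qed
  finally show ?case .
qed simp

text \<open>In the Leibniz sum, \<open>k > i\<close> kills the first factor and \<open>k < i\<close>
  puts more than \<open>j\<close> commutators on the second; only \<open>k = i\<close>
  survives.\<close>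

lemma ad_pow_mult_top:
  fixes x :: "'a::real_algebra"
  assumes "(ad x ^^ Suc i) y = 0" "(ad x ^^ Suc j) z = 0"
  shows "(ad x ^^ (i + j)) (y * z) = real ((i + j) choose i) *\<^sub>R ((ad x ^^ i) y * (ad x ^^ j) z)"
proof -
  have "(ad x ^^ (i + j)) (y * z) =
      (\<Sum>k\<le>i+j. if k = i then real ((i + j) choose i) *\<^sub>R ((ad x ^^ i) y * (ad x ^^ j) z) else 0)"
    unfolding ad_pow_mult
  proof (rule sum.cong [OF refl])
    fix k assume "k \<in> {..i+j}"
    consider "k = i" | "Suc i \<le> k" | "Suc j \<le> i + j - k" using \<open>k \<in> {..i+j}\<close> by force
    then show "real ((i + j) choose k) *\<^sub>R ((ad x ^^ k) y * (ad x ^^ (i + j - k)) z) =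
        (if k = i then real ((i + j) choose i) *\<^sub>R ((ad x ^^ i) y * (ad x ^^ j) z) else 0)"
    proof cases
      case 2
      then show ?thesis using ad_pow_vanish_mono [OF assms(1)] by auto
    next
      case 3
      then show ?thesis using ad_pow_vanish_mono [OF assms(2)] by auto
    qed simp
  qed
  also have "\<dots> = real ((i + j) choose i) *\<^sub>R ((ad x ^^ i) y * (ad x ^^ j) z)" by (subst sum.delta) auto
  finally show ?thesis .
qed

text \<open>If \<open>k < i\<close> and \<open>n - k < j\<close>, then
  \<open>n + 2 \<le> i + j\<close>; so under the bound on \<open>i + j\<close> every Leibniz term
  has a vanishing factor.\<close>

lemma ad_pow_mult_vanish:
  fixes x :: "'a::real_algebra"
  assumes "(ad x ^^ i) y = 0" "(ad x ^^ j) z = 0" "i + j \<le> Suc n"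
  shows "(ad x ^^ n) (y * z) = 0"
  unfolding ad_pow_mult
proof (rule sum.neutral, rule ballI)
  fix k assume "k \<in> {..n}"
  then consider "i \<le> k" | "j \<le> n - k" using assms(3) by force
  then show "real (n choose k) *\<^sub>R ((ad x ^^ k) y * (ad x ^^ (n - k)) z) = 0"
    by cases (auto simp: ad_pow_vanish_mono [OF assms(1)] ad_pow_vanish_mono [OF assms(2)])
qed

text \<open>\<open>ad_pow_mult_top\<close> evaluates the same element once as \<open>y * z\<close>
  and once as \<open>z * y\<close>; the two binomial coefficients agree and are nonzero.\<close>

lemma ad_pow_top_commute:
  fixes x :: "'a::real_algebra"
  assumes "(ad x ^^ Suc i) y = 0" "(ad x ^^ Suc j) z = 0" "y * z = z * y"
  shows "(ad x ^^ i) y * (ad x ^^ j) z = (ad x ^^ j) z * (ad x ^^ i) y"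
proof -
  have *: "(i + j) choose i = (j + i) choose j"
    using binomial_symmetric [of i "i + j"] by (simp add: add.commute)
  have "real ((i + j) choose i) *\<^sub>R ((ad x ^^ i) y * (ad x ^^ j) z)
      = real ((i + j) choose i) *\<^sub>R ((ad x ^^ j) z * (ad x ^^ i) y)"
    using ad_pow_mult_top [OF assms(1,2)] ad_pow_mult_top [OF assms(2,1)] assms(3) *
    by (simp add: add.commute)
  then show ?thesis by (simp add: scaleR_cancel_left)
qed

text \<open>A second commutator kills a factor \<open>y\<close>, so the \<open>n\<close> commutators
  must hit \<open>n\<close> different factors, which happens in \<open>fact n\<close>
  orders.\<close>

lemma ad_pow_power:
  fixes x y :: "'a::real_algebra_1"
  assumes "ad x (ad x y) = 0"
  shows "(ad x ^^ n) (y ^ n) = fact n *\<^sub>R ad x y ^ n \<and> (ad x ^^ Suc n) (y ^ n) = 0"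
proof (induction n)
  case (Suc n)
  have y: "(ad x ^^ Suc 1) y = 0" using assms by simp
  have "(ad x ^^ (1 + n)) (y * y ^ n) = real ((1 + n) choose 1) *\<^sub>R ((ad x ^^ 1) y * (ad x ^^ n) (y ^ n))"
    by (rule ad_pow_mult_top [OF y]) (use Suc in blast)
  moreover have "(ad x ^^ Suc (Suc n)) (y * y ^ n) = 0"
    by (rule ad_pow_mult_vanish [OF y, of "Suc n"]) (use Suc in auto)
  moreover have "(ad x ^^ Suc 0) y = ad x y" by simp
  ultimately show ?case using Suc.IH by (simp add: fact_Suc ac_simps del: funpow.simps)
qed (simp add: ad_def)

text \<open>If \<open>l\<close>, \<open>L\<close> and \<open>[l, L]\<close> generate a Heisenberg algebra acting on \<open>p\<close>, only the terms in
  which every \<open>l\<close> hits a different \<open>L\<close> survive.\<close>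

lemma ad_pow_ad_pow:
  fixes l L p :: "'a::real_algebra"
  defines "K \<equiv> ad l L"
  assumes lp: "ad l p = 0"
    and c: "ad (ad l K) l = 0" "ad (ad l K) L = 0" "ad (ad l K) p = 0"
  shows "(ad l ^^ n) ((ad L ^^ n) p) = fact n *\<^sub>R (ad K ^^ n) p"
proof -
  \<comment> \<open>\<open>C\<close> is the central element of the Heisenberg algebra; all arguments
    \<open>v\<close> below commute with it.\<close>
  define C where "C = ad l K"
  have C: "ad C (ad x y) = 0" if "ad C x = 0" "ad C y = 0" for x y
    using that by (simp add: ad_jacobi [of C])
  have lK: "ad l (ad K v) = ad K (ad l v)" if "ad C v = 0" for v
    using that by (simp add: ad_jacobi [of l] C_def)
  have Cpow: "ad C ((ad l ^^ i) v) = 0" if "ad C v = 0" for i v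
    by (induction i) (use c C that in \<open>auto simp: C_def\<close>)
  \<comment> \<open>Moving one \<open>ad l\<close> past \<open>ad L\<close> leaves an
    \<open>ad K\<close>, which commutes with the remaining \<open>ad l\<close>; there are
    \<open>Suc i\<close> of them to move.\<close>
  have step: "(ad l ^^ Suc i) (ad L v) = ad L ((ad l ^^ Suc i) v) + real (Suc i) *\<^sub>R ad K ((ad l ^^ i) v)"
    if "ad C v = 0" for i v
  proof (induction i)
    case 0
    show ?case by (simp add: ad_jacobi [of l L] K_def)
  next
    case (Suc i)
    have "(ad l ^^ Suc (Suc i)) (ad L v) = ad l (ad L ((ad l ^^ Suc i) v)) + real (Suc i) *\<^sub>R ad l (ad K ((ad l ^^ i) v))"
      using Suc by (simp add: ad_add_right ad_scaleR_right)
    also have "ad l (ad K ((ad l ^^ i) v)) = ad K ((ad l ^^ Suc i) v)"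
      using lK Cpow that by simp
    also have "ad l (ad L ((ad l ^^ Suc i) v)) = ad K ((ad l ^^ Suc i) v) + ad L ((ad l ^^ Suc (Suc i)) v)"
      by (simp add: ad_jacobi [of l L] K_def)
    finally show ?case by (simp add: algebra_simps scaleR_2)
  qed
  have CL: "ad C ((ad L ^^ n) p) = 0" for n by (induction n) (use c C in \<open>auto simp: C_def\<close>)
  \<comment> \<open>The vanishing under one further \<open>ad l\<close> is carried along, since it
    removes the first summand of \<open>step\<close>.\<close>
  have "(ad l ^^ n) ((ad L ^^ n) p) = fact n *\<^sub>R (ad K ^^ n) p \<and> (ad l ^^ Suc n) ((ad L ^^ n) p) = 0"
  proof (induction n)
    case 0
    show ?case using lp by simp
  next
    case (Suc n)
    have 1: "(ad l ^^ Suc n) ((ad L ^^ Suc n) p) = real (Suc n) *\<^sub>R ad K ((ad l ^^ n) ((ad L ^^ n) p))"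
      using step [OF CL, of n n] Suc by (simp del: funpow.simps add: funpow_simps_right(1) funpow.simps(2)[of n "ad L"])
    have z: "(ad l ^^ Suc n) ((ad L ^^ n) p) = 0" using Suc by blast
    have 2: "(ad l ^^ Suc (Suc n)) ((ad L ^^ Suc n) p) = 0"
      using step [OF CL, of "Suc n" n] ad_pow_vanish_mono [OF z, of "Suc (Suc n)"] unfolding z by simp
    show ?case using 1 2 Suc by (simp add: ad_scaleR_right fact_Suc mult.commute del: of_nat_Suc)
  qed
  then show ?thesis by blast
qed

section \<open>Highest and lowest weight vectors for sl2\<close>

lemma ad_sl2_lower:
  fixes E L H f :: "'a::real_algebra"
  assumes "ad L E = H" "ad H L = - 8 *\<^sub>R L" "ad E f = 0" "ad H f = (4 * w) *\<^sub>R f"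
  shows "ad E ((ad L ^^ Suc k) f) = (- 4 * real (Suc k) * (w - real k)) *\<^sub>R (ad L ^^ k) f"
proof -
  \<comment> \<open>Each \<open>ad L\<close> lowers the eigenvalue of \<open>ad H\<close> by
    8.\<close>
  have H: "ad H ((ad L ^^ k) f) = (4 * w - 8 * real k) *\<^sub>R (ad L ^^ k) f" for k
  proof (induction k)
    case (Suc k)
    have "ad H ((ad L ^^ Suc k) f) = ad (ad H L) ((ad L ^^ k) f) + ad L (ad H ((ad L ^^ k) f))"
      by (simp add: ad_jacobi [of H])
    also have "\<dots> = - 8 *\<^sub>R (ad L ^^ Suc k) f + (4 * w - 8 * real k) *\<^sub>R (ad L ^^ Suc k) f"
      unfolding Suc assms(2) ad_scaleR_left ad_scaleR_right by simp
    also have "\<dots> = (4 * w - 8 * real (Suc k)) *\<^sub>R (ad L ^^ Suc k) f"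
      unfolding scaleR_add_left [symmetric] by (rule arg_cong [of _ _ "\<lambda>c. c *\<^sub>R _"]) simp
    finally show ?case .
  qed (simp add: assms)
  have EL: "ad E (ad L v) = ad L (ad E v) - ad H v" for v
    using ad_jacobi [of L E v] assms(1) by (simp add: algebra_simps)
  \<comment> \<open>Moving \<open>ad E\<close> to the right past \<open>k + 1\<close> factors
    \<open>ad L\<close> collects \<open>- (4 * w - 8 * j)\<close> for \<open>j \<le> k\<close>;
    these add up to the stated coefficient.\<close>
  show ?thesis
  proof (induction k)
    case 0
    show ?case using EL [of f] assms by simp
  next
    case (Suc k)
    have "ad E ((ad L ^^ Suc (Suc k)) f) = ad L (ad E ((ad L ^^ Suc k) f)) - ad H ((ad L ^^ Suc k) f)"
      by (simp add: EL)
    also have "\<dots> = (- 4 * real (Suc k) * (w - real k)) *\<^sub>R (ad L ^^ Suc k) f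
        - (4 * w - 8 * real (Suc k)) *\<^sub>R (ad L ^^ Suc k) f"
      unfolding Suc H by (simp add: ad_scaleR_right)
    also have "\<dots> = (- 4 * real (Suc (Suc k)) * (w - real (Suc k))) *\<^sub>R (ad L ^^ Suc k) f"
      unfolding scaleR_diff_left [symmetric] by (rule arg_cong [of _ _ "\<lambda>c. c *\<^sub>R _"]) (simp add: algebra_simps)
    finally show ?case .
  qed
qed

text \<open>A highest weight vector of weight \<open>d\<close> in a finite-dimensional \<open>sl\<^sub>2\<close>-module generates a
  submodule of dimension \<open>d + 1\<close>.\<close>

lemma ad_sl2_nilpotent:
  fixes E L H f :: "'a::real_algebra"
  assumes "ad L E = H" "ad H L = - 8 *\<^sub>R L" "ad E f = 0" "ad H f = (4 * real d) *\<^sub>R f"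
    and "(ad L ^^ Suc (Suc d)) f = 0"
  shows "(ad L ^^ Suc d) f = 0"
proof -
  \<comment> \<open>For \<open>w = d\<close> and \<open>k = d + 1\<close> the coefficient is
    \<open>4 * (d + 2)\<close>, which is nonzero.\<close>
  have "(- 4 * real (Suc (Suc d)) * (real d - real (Suc d))) *\<^sub>R (ad L ^^ Suc d) f = 0"
    using ad_sl2_lower [OF assms(1-4), of "Suc d"] unfolding assms(5) by simp
  then show ?thesis unfolding scaleR_eq_0_iff by simp
qed

text \<open>Mirror image of \<open>ad_sl2_lower\<close> with \<open>E\<close> and \<open>L\<close>
  exchanged: \<open>f\<close> is now a lowest weight vector, and each \<open>ad E\<close> raises the
  eigenvalue by 8.\<close>

lemma ad_sl2_raise:
  fixes E L H f :: "'a::real_algebra"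
  assumes "ad L E = H" "ad H E = 8 *\<^sub>R E" "ad L f = 0" "ad H f = (- 4 * w) *\<^sub>R f"
  shows "ad L ((ad E ^^ Suc k) f) = (- 4 * real (Suc k) * (w - real k)) *\<^sub>R (ad E ^^ k) f"
proof -
  have H: "ad H ((ad E ^^ k) f) = (- 4 * w + 8 * real k) *\<^sub>R (ad E ^^ k) f" for k
  proof (induction k)
    case (Suc k)
    have "ad H ((ad E ^^ Suc k) f) = ad (ad H E) ((ad E ^^ k) f) + ad E (ad H ((ad E ^^ k) f))"
      by (simp add: ad_jacobi [of H])
    also have "\<dots> = 8 *\<^sub>R (ad E ^^ Suc k) f + (- 4 * w + 8 * real k) *\<^sub>R (ad E ^^ Suc k) f"
      unfolding Suc assms(2) ad_scaleR_left ad_scaleR_right by simp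
    also have "\<dots> = (- 4 * w + 8 * real (Suc k)) *\<^sub>R (ad E ^^ Suc k) f"
      unfolding scaleR_add_left [symmetric] by (rule arg_cong [of _ _ "\<lambda>c. c *\<^sub>R _"]) simp
    finally show ?case .
  qed (simp add: assms)
  have LE: "ad L (ad E v) = ad E (ad L v) + ad H v" for v
    using ad_jacobi [of L E v] assms(1) by (simp add: algebra_simps)
  show ?thesis
  proof (induction k)
    case 0
    show ?case using LE [of f] assms by simp
  next
    case (Suc k)
    have "ad L ((ad E ^^ Suc (Suc k)) f) = ad E (ad L ((ad E ^^ Suc k) f)) + ad H ((ad E ^^ Suc k) f)"
      by (simp add: LE)
    also have "\<dots> = (- 4 * real (Suc k) * (w - real k)) *\<^sub>R (ad E ^^ Suc k) f
        + (- 4 * w + 8 * real (Suc k)) *\<^sub>R (ad E ^^ Suc k) f"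
      unfolding Suc H by (simp add: ad_scaleR_right)
    also have "\<dots> = (- 4 * real (Suc (Suc k)) * (w - real (Suc k))) *\<^sub>R (ad E ^^ Suc k) f"
      unfolding scaleR_add_left [symmetric] by (rule arg_cong [of _ _ "\<lambda>c. c *\<^sub>R _"]) (simp add: algebra_simps)
    finally show ?case .
  qed
qed

text \<open>By \<open>ad_sl2_raise\<close> each \<open>ad L\<close> undoes one \<open>ad E\<close>
  up to a scalar, and the last \<open>ad L\<close> kills \<open>f\<close>.\<close>

lemma ad_pow_lowest:
  fixes E L H f :: "'a::real_algebra"
  assumes "ad L E = H" "ad H E = 8 *\<^sub>R E" "ad L f = 0" "ad H f = (- 4 * w) *\<^sub>R f"
  shows "(ad L ^^ Suc k) ((ad E ^^ k) f) = 0"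
proof (induction k)
  case (Suc k)
  then show ?case
    by (simp only: funpow_Suc_right [of "Suc k" "ad L"] comp_apply ad_sl2_raise [OF assms]
        ad_pow_scaleR scaleR_zero_right)
qed (simp add: assms)

section \<open>Linear operators on functions\<close>

text \<open>These maps form an associative unital algebra, to which the commutator calculus above
  applies. Its scalars are real; complex constants act as multiplication operators
  \<open>mop (\<lambda>_. c)\<close>.\<close>

typedef 'i lop = "{T :: 'i oper. (\<forall>f g. T (f + g) = T f + T g) \<and> (\<forall>c f. T (\<lambda>x. c * f x) = (\<lambda>x. c * T f x))}"
  morphisms lop_apply Lop
  by (rule exI [of _ id]) auto

setup_lifting type_definition_lop

instantiation lop :: (type) real_algebra_1
begin

lift_definition zero_lop :: "'a lop" is "\<lambda>f. 0" by (auto simp: fun_eq_iff)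
lift_definition one_lop :: "'a lop" is "\<lambda>f. f" by auto
lift_definition plus_lop :: "'a lop \<Rightarrow> 'a lop \<Rightarrow> 'a lop" is "\<lambda>S T f. S f + T f"
  by (auto simp: fun_eq_iff algebra_simps)
lift_definition minus_lop :: "'a lop \<Rightarrow> 'a lop \<Rightarrow> 'a lop" is "\<lambda>S T f. S f - T f"
  by (auto simp: fun_eq_iff algebra_simps)
lift_definition uminus_lop :: "'a lop \<Rightarrow> 'a lop" is "\<lambda>S f. - S f"
  by (auto simp: fun_eq_iff algebra_simps)
lift_definition times_lop :: "'a lop \<Rightarrow> 'a lop \<Rightarrow> 'a lop" is "\<lambda>S T f. S (T f)" by auto
lift_definition scaleR_lop :: "real \<Rightarrow> 'a lop \<Rightarrow> 'a lop" is "\<lambda>r T f x. of_real r * T f x"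
  by (auto simp: fun_eq_iff algebra_simps)

instance
proof
  show "(0::'a lop) \<noteq> 1" by transfer (auto simp: fun_eq_iff intro!: exI [of _ "\<lambda>_. 1"])
qed (transfer; auto simp: fun_eq_iff algebra_simps)+

end

lemma lop_eqI: "(\<And>f x. lop_apply S f x = lop_apply T f x) \<Longrightarrow> S = T"
  by (simp add: fun_eq_iff lop_apply_inject [symmetric])

section \<open>Operators on regular functions\<close>

lemma vector_space_pair_fun:
  "vector_space_pair (\<lambda>(c::complex) (f::'a \<Rightarrow> complex) x. c * f x) (\<lambda>c (f::'a \<Rightarrow> complex) x. c * f x)"
  by unfold_locales (auto simp: fun_eq_iff algebra_simps)

locale arrangement =
  fixes I :: "'i set" and H :: "'i scalar_fun set"
  assumes finite_I: "finite I" and finite_H: "finite H"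
    and linear_form: "h \<in> H \<Longrightarrow> \<exists>l. h = (\<lambda>x. \<Sum>i\<in>I. l i * x i)"
begin

abbreviation "reg \<equiv> reg_points I H"
abbreviation "R \<equiv> regular_funs I H"

section \<open>Openness of the complement and partial derivatives on it\<close>

lemma form_upd:
  assumes "h \<in> H" "k \<in> I"
  obtains c where "\<And>x t. h (x(k := t)) = h x + c * (t - x k)"
proof -
  obtain l where l: "h = (\<lambda>x. \<Sum>i\<in>I. l i * x i)" using linear_form [OF assms(1)] by blast
  have "(\<Sum>i\<in>I - {k}. l i * (x(k := t)) i) = (\<Sum>i\<in>I - {k}. l i * x i)" for x t
    by (rule sum.cong) auto
  then have "h (x(k := t)) = h x + l k * (t - x k)" for x t
    by (simp add: l sum.remove [OF finite_I assms(2)] algebra_simps)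
  then show ?thesis by (rule that)
qed

text \<open>Along a coordinate line each of the finitely many forms is affine, hence nonzero near
  \<open>x k\<close>. This makes partial derivatives on the complement independent of values
  elsewhere.\<close>

lemma reg_line:
  assumes "x \<in> reg" "k \<in> I"
  shows "eventually (\<lambda>t. x(k := t) \<in> reg) (nhds (x k))"
proof -
  have "eventually (\<lambda>t. h (x(k := t)) \<noteq> 0) (nhds (x k))" if h: "h \<in> H" for h
  proof -
    obtain c where c: "\<And>x t. h (x(k := t)) = h x + c * (t - x k)" using form_upd [OF h assms(2)] by blast
    have "open {t. h x + c * (t - x k) \<noteq> 0}" by (intro open_Collect_neq continuous_intros)
    moreover have "h x \<noteq> 0" using assms h by (auto simp: reg_points_def)
    ultimately have "eventually (\<lambda>t. t \<in> {t. h x + c * (t - x k) \<noteq> 0}) (nhds (x k))"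
      by (intro eventually_nhds_in_open) auto
    then show ?thesis by (simp add: c)
  qed
  then have "eventually (\<lambda>t. \<forall>h\<in>H. h (x(k := t)) \<noteq> 0) (nhds (x k))"
    using finite_H by (simp add: eventually_ball_finite)
  moreover have "x(k := t) \<in> I \<rightarrow>\<^sub>E UNIV" for t using assms by (auto simp: reg_points_def PiE_def extensional_def)
  ultimately show ?thesis by (auto simp: reg_points_def elim: eventually_mono)
qed

text \<open>A relation rather than a function: unlike \<open>deriv\<close>, it records
  differentiability and can be established by structural rules.\<close>

definition has_pd :: "'i \<Rightarrow> 'i scalar_fun \<Rightarrow> 'i scalar_fun \<Rightarrow> bool" where
  "has_pd k f f' \<longleftrightarrow> (\<forall>x\<in>reg. ((\<lambda>t. f (x(k := t))) has_field_derivative f' x) (at (x k)))"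

lemma has_pd_pderivative: "has_pd k f f' \<Longrightarrow> x \<in> reg \<Longrightarrow> pderivative k f x = f' x"
  by (auto simp: has_pd_def pderivative_def intro: DERIV_imp_deriv)

lemma has_pd_cong:
  assumes "k \<in> I" "\<And>x. x \<in> reg \<Longrightarrow> f x = g x" "\<And>x. x \<in> reg \<Longrightarrow> f' x = g' x"
  shows "has_pd k f f' \<longleftrightarrow> has_pd k g g'"
  unfolding has_pd_def
proof (rule ball_cong [OF refl])
  fix x assume x: "x \<in> reg"
  have "eventually (\<lambda>t. f (x(k := t)) = g (x(k := t))) (nhds (x k))"
    using reg_line [OF x assms(1)] by (rule eventually_mono) (rule assms(2))
  from DERIV_cong_ev [OF refl this] assms(3) [OF x]
  show "((\<lambda>t. f (x(k := t))) has_field_derivative f' x) (at (x k)) \<longleftrightarrow>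
      ((\<lambda>t. g (x(k := t))) has_field_derivative g' x) (at (x k))" by simp
qed

lemma has_pd_transform:
  assumes "has_pd k f f'" "k \<in> I" "\<And>x. x \<in> reg \<Longrightarrow> f x = g x" "\<And>x. x \<in> reg \<Longrightarrow> f' x = g' x"
  shows "has_pd k g g'"
  using has_pd_cong [of k f g f' g'] assms by simp

lemma pd_eqI:
  assumes "has_pd k f f'" "k \<in> I" "\<And>x. x \<in> reg \<Longrightarrow> f' x = g' x"
  shows "has_pd k f g'"
  using has_pd_cong [of k f f f' g'] assms by simp

lemma has_pd_const: "has_pd k (\<lambda>_. c) (\<lambda>_. 0)"
  by (simp add: has_pd_def)

lemma has_pd_coord: "has_pd k (\<lambda>x. x i) (\<lambda>_. if i = k then 1 else 0)"
  by (simp add: has_pd_def)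

lemma has_pd_add: "has_pd k f f' \<Longrightarrow> has_pd k g g' \<Longrightarrow> has_pd k (\<lambda>x. f x + g x) (\<lambda>x. f' x + g' x)"
  unfolding has_pd_def by (intro ballI DERIV_add) auto

lemma has_pd_sum: "(\<And>a. a \<in> A \<Longrightarrow> has_pd k (f a) (f' a)) \<Longrightarrow> has_pd k (\<lambda>x. \<Sum>a\<in>A. f a x) (\<lambda>x. \<Sum>a\<in>A. f' a x)"
  unfolding has_pd_def by (intro ballI DERIV_sum) auto

lemma has_pd_mult:
  "has_pd k f f' \<Longrightarrow> has_pd k g g' \<Longrightarrow> has_pd k (\<lambda>x. f x * g x) (\<lambda>x. f' x * g x + f x * g' x)"
  unfolding has_pd_def
  by (rule ballI, rule derivative_eq_intros, (erule (1) bspec)+) (simp add: mult.commute)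

lemma has_pd_cmult: "has_pd k f f' \<Longrightarrow> has_pd k (\<lambda>x. c * f x) (\<lambda>x. c * f' x)"
  using has_pd_mult [OF has_pd_const] by fastforce

lemma has_pd_power: "has_pd k f f' \<Longrightarrow> has_pd k (\<lambda>x. f x ^ n) (\<lambda>x. of_nat n * f' x * f x ^ (n - 1))"
  unfolding has_pd_def
  by (rule ballI, rule derivative_eq_intros, (erule (1) bspec)+) (simp add: mult.commute)

lemma has_pd_prod:
  assumes "\<And>a. a \<in> A \<Longrightarrow> has_pd k (f a) (f' a)"
  shows "has_pd k (\<lambda>x. \<Prod>a\<in>A. f a x) (\<lambda>x. \<Sum>a\<in>A. f' a x * (\<Prod>b\<in>A - {a}. f b x))"
  unfolding has_pd_def
proof
  fix x assume "x \<in> reg"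
  then have "((\<lambda>t. f a (x(k := t))) has_field_derivative f' a x) (at (x k))" if "a \<in> A" for a
    using assms that by (auto simp: has_pd_def)
  from has_field_derivative_prod [OF this]
  show "((\<lambda>t. \<Prod>a\<in>A. f a (x(k := t))) has_field_derivative (\<Sum>a\<in>A. f' a x * (\<Prod>b\<in>A - {a}. f b x))) (at (x k))"
    by simp
qed

lemma has_pd_inverse:
  "has_pd k f f' \<Longrightarrow> (\<And>x. x \<in> reg \<Longrightarrow> f x \<noteq> 0) \<Longrightarrow>
    has_pd k (\<lambda>x. inverse (f x)) (\<lambda>x. - f' x * inverse (f x) ^ 2)"
  unfolding has_pd_def
  by (rule ballI, rule derivative_eq_intros, (erule (1) bspec)+)
    (auto simp: power2_eq_square inverse_eq_divide)

lemma has_pd_form: "h \<in> H \<Longrightarrow> k \<in> I \<Longrightarrow> \<exists>c. has_pd k h (\<lambda>_. c)"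
proof -
  assume "h \<in> H" "k \<in> I"
  then obtain c where c: "\<And>x t. h (x(k := t)) = h x + c * (t - x k)" using form_upd by blast
  have "has_pd k h (\<lambda>_. c)" unfolding has_pd_def c by (auto intro!: derivative_eq_intros)
  then show ?thesis by blast
qed

text \<open>Structural induction yields the derivatives explicitly. Requiring one common
  \<open>g\<close> for both mixed derivatives builds their symmetry into the induction.\<close>

lemma localized_pd:
  assumes "f \<in> localized_poly I H" "i \<in> I" "k \<in> I"
  shows "\<exists>fi\<in>localized_poly I H. \<exists>fk\<in>localized_poly I H. \<exists>g\<in>localized_poly I H.
    has_pd i f fi \<and> has_pd k f fk \<and> has_pd k fi g \<and> has_pd i fk g"
  using assms(1)
proof induction
  case (const c)
  show ?case
    by (intro bexI [of _ "\<lambda>_. 0"] conjI) (auto intro: has_pd_const localized_poly.const)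
next
  case (coord j)
  show ?case
    by (rule bexI [of _ "\<lambda>_. if j = i then 1 else 0"], rule bexI [of _ "\<lambda>_. if j = k then 1 else 0"],
        rule bexI [of _ "\<lambda>_. 0"]) (intro conjI has_pd_coord has_pd_const localized_poly.const)+
next
  case (inv h)
  obtain c d where c: "has_pd i h (\<lambda>_. c)" and d: "has_pd k h (\<lambda>_. d)"
    using has_pd_form [OF inv] assms by meson
  have nz: "h x \<noteq> 0" if "x \<in> reg" for x using inv that by (auto simp: reg_points_def)
  have pow: "(\<lambda>x. e * inverse (h x) ^ n) \<in> localized_poly I H" for e n
  proof (induction n)
    case 0
    show ?case using localized_poly.const [of e] by simp
  next
    case (Suc n)
    have "(\<lambda>x. inverse (h x) * (e * inverse (h x) ^ n)) \<in> localized_poly I H"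
      by (rule localized_poly.mult [OF localized_poly.inv [OF inv] Suc])
    then show ?case by (simp add: mult.left_commute)
  qed
  have 2: "has_pd m (\<lambda>x. - e * inverse (h x) ^ 2) (\<lambda>x. (2 * e * e') * inverse (h x) ^ 3)"
    if "has_pd m h (\<lambda>_. e')" "m \<in> I" for m e e'
  proof -
    have "has_pd m (\<lambda>x. (- e) * inverse (h x) ^ 2) (\<lambda>x. (- e) * (of_nat 2 * (- e' * inverse (h x) ^ 2) * inverse (h x) ^ (2 - 1)))"
      by (intro has_pd_cmult has_pd_power has_pd_inverse that nz)
    then show ?thesis
      by (rule has_pd_cong [THEN iffD1, rotated -1]) (use that in \<open>auto simp: power2_eq_square power3_eq_cube\<close>)
  qed
  have 3: "has_pd k (\<lambda>x. - c * inverse (h x) ^ 2) (\<lambda>x. (2 * c * d) * inverse (h x) ^ 3)"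
    "has_pd i (\<lambda>x. - d * inverse (h x) ^ 2) (\<lambda>x. (2 * c * d) * inverse (h x) ^ 3)"
    using 2 [OF d, of c] 2 [OF c, of d] assms by (simp_all add: mult.commute mult.left_commute)
  show ?case
    by (rule bexI [of _ "\<lambda>x. - c * inverse (h x) ^ 2"], rule bexI [of _ "\<lambda>x. - d * inverse (h x) ^ 2"],
        rule bexI [of _ "\<lambda>x. (2 * c * d) * inverse (h x) ^ 3"], intro conjI has_pd_inverse c d nz 3) (assumption | rule pow)+
next
  case (add f g)
  obtain fi fk fik where f:
    "fi \<in> localized_poly I H" "fk \<in> localized_poly I H" "fik \<in> localized_poly I H"
    "has_pd i f fi" "has_pd k f fk" "has_pd k fi fik" "has_pd i fk fik" using add.IH(1) by blast
  obtain gi gk gik where g: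
    "gi \<in> localized_poly I H" "gk \<in> localized_poly I H" "gik \<in> localized_poly I H"
    "has_pd i g gi" "has_pd k g gk" "has_pd k gi gik" "has_pd i gk gik" using add.IH(2) by blast
  show ?case
    by (rule bexI [of _ "\<lambda>x. fi x + gi x"], rule bexI [of _ "\<lambda>x. fk x + gk x"],
        rule bexI [of _ "\<lambda>x. fik x + gik x"], (intro conjI has_pd_add localized_poly.add f g)+)
next
  case (mult f g)
  obtain fi fk fik where f:
    "fi \<in> localized_poly I H" "fk \<in> localized_poly I H" "fik \<in> localized_poly I H"
    "has_pd i f fi" "has_pd k f fk" "has_pd k fi fik" "has_pd i fk fik" using mult.IH(1) by blast
  obtain gi gk gik where g:
    "gi \<in> localized_poly I H" "gk \<in> localized_poly I H" "gik \<in> localized_poly I H"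
    "has_pd i g gi" "has_pd k g gk" "has_pd k gi gik" "has_pd i gk gik" using mult.IH(2) by blast
  \<comment> \<open>The product rule lists the four terms of the two mixed derivatives in different
    orders; they are rearranged to a common form.\<close>
  have "has_pd i (\<lambda>x. fk x * g x + f x * gk x)
      (\<lambda>x. (fik x * g x + fk x * gi x) + (fi x * gk x + f x * gik x))"
    by (intro has_pd_add has_pd_mult f g)
  then have *: "has_pd i (\<lambda>x. fk x * g x + f x * gk x)
      (\<lambda>x. (fik x * g x + fi x * gk x) + (fk x * gi x + f x * gik x))"
    by (simp add: algebra_simps)
  show ?case
    by (rule bexI [of _ "\<lambda>x. fi x * g x + f x * gi x"], rule bexI [of _ "\<lambda>x. fk x * g x + f x * gk x"],
        rule bexI [of _ "\<lambda>x. (fik x * g x + fi x * gk x) + (fk x * gi x + f x * gik x)"],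
        (intro conjI has_pd_add has_pd_mult localized_poly.add localized_poly.mult f g mult.hyps *)+)
qed

section \<open>The ring of regular functions and its derivations\<close>

lemma regular_cong: "f \<in> R \<Longrightarrow> (\<And>x. x \<in> reg \<Longrightarrow> f x = g x) \<Longrightarrow> g \<in> R"
  by (auto simp: regular_funs_def)

lemma regular_localized: "f \<in> localized_poly I H \<Longrightarrow> f \<in> R"
  by (auto simp: regular_funs_def)

lemma regular_const [simp, intro]: "(\<lambda>_. c) \<in> R"
  and regular_coord [intro]: "i \<in> I \<Longrightarrow> (\<lambda>x. x i) \<in> R"
  and regular_inverse: "h \<in> H \<Longrightarrow> (\<lambda>x. inverse (h x)) \<in> R"
  by (auto intro: regular_localized localized_poly.intros)

lemma regular_add [intro]: "f \<in> R \<Longrightarrow> g \<in> R \<Longrightarrow> (\<lambda>x. f x + g x) \<in> R"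
  and regular_mult [intro]: "f \<in> R \<Longrightarrow> g \<in> R \<Longrightarrow> (\<lambda>x. f x * g x) \<in> R"
  by (fastforce simp: regular_funs_def intro: localized_poly.add localized_poly.mult)+

lemma regular_diff [intro]: "f \<in> R \<Longrightarrow> g \<in> R \<Longrightarrow> (\<lambda>x. f x - g x) \<in> R"
  using regular_add [OF _ regular_mult [OF regular_const [of "- 1"]], of f g] by simp

lemma regular_power [intro]: "f \<in> R \<Longrightarrow> (\<lambda>x. f x ^ n) \<in> R"
  by (induction n) auto

lemma regular_sum [intro]: "(\<And>a. a \<in> A \<Longrightarrow> f a \<in> R) \<Longrightarrow> (\<lambda>x. \<Sum>a\<in>A. f a x) \<in> R"
  by (induction A rule: infinite_finite_induct) auto

lemma regular_if: "f \<in> R \<Longrightarrow> (\<lambda>x. if P then f x else 0) \<in> R"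
  by (cases P) auto

lemma regular_pd:
  assumes "f \<in> R" "i \<in> I" "k \<in> I"
  shows "pderivative i f \<in> R" "has_pd i f (pderivative i f)"
    "x \<in> reg \<Longrightarrow> pderivative i (pderivative k f) x = pderivative k (pderivative i f) x"
proof -
  obtain f0 where f0: "f0 \<in> localized_poly I H" "\<And>x. x \<in> reg \<Longrightarrow> f x = f0 x"
    using assms by (auto simp: regular_funs_def)
  obtain fi fk g where fi: "fi \<in> localized_poly I H" "has_pd i f0 fi"
    and fk: "has_pd k f0 fk" and g: "has_pd k fi g" "has_pd i fk g"
    using localized_pd [OF f0(1) assms(2,3)] by blast
  have fi': "has_pd i f fi" using has_pd_cong [OF assms(2)] f0(2) fi(2) by blast
  have fk': "has_pd k f fk" using has_pd_cong [OF assms(3)] f0(2) fk by blast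
  have eqi: "pderivative i f x = fi x" and eqk: "pderivative k f x = fk x" if "x \<in> reg" for x
    using fi' fk' that has_pd_pderivative by blast+
  show "pderivative i f \<in> R"
    by (rule regular_cong [OF regular_localized [OF fi(1)]]) (simp add: eqi)
  show "has_pd i f (pderivative i f)"
    using has_pd_cong [OF assms(2), of f f "pderivative i f" fi] fi' eqi by blast
  have "has_pd k (pderivative i f) g" "has_pd i (pderivative k f) g"
    using has_pd_cong [OF assms(3), of "pderivative i f" fi g g] has_pd_cong [OF assms(2), of "pderivative k f" fk g g]
      g eqi eqk by blast+
  then show "x \<in> reg \<Longrightarrow> pderivative i (pderivative k f) x = pderivative k (pderivative i f) x"
    by (simp add: has_pd_pderivative)
qed

lemma has_pd_regular: "f \<in> R \<Longrightarrow> k \<in> I \<Longrightarrow> has_pd k f f' \<Longrightarrow> f' \<in> R"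
  by (rule regular_cong [OF regular_pd(1) [of f k k]]) (auto simp: has_pd_pderivative)

subsection \<open>Representation by linear operators\<close>

text \<open>Operators on regular functions are made total by composing them with a linear projection
  onto the regular functions that vanish off the complement. Their operator calculus then takes
  place in the ring of all linear operators.\<close>

definition cut :: "'i scalar_fun \<Rightarrow> 'i scalar_fun" where
  "cut f = (\<lambda>x. if x \<in> reg then f x else 0)"

definition R0 :: "'i scalar_fun set" where
  "R0 = {f \<in> R. cut f = f}"

lemma cut_reg [simp]: "x \<in> reg \<Longrightarrow> cut f x = f x"
  by (simp add: cut_def)

lemma cut_cong: "(\<And>x. x \<in> reg \<Longrightarrow> f x = g x) \<Longrightarrow> cut f = cut g"
  by (auto simp: cut_def)

lemma cut_eqD: "cut f = cut g \<Longrightarrow> x \<in> reg \<Longrightarrow> f x = g x"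
  by (metis cut_reg)

lemma cut_add: "cut (\<lambda>x. f x + g x) = cut f + cut g"
  and cut_diff: "cut (\<lambda>x. f x - g x) = cut f - cut g"
  and cut_cut [simp]: "cut (cut f) = cut f"
  by (auto simp: cut_def)

lemma R0_iff: "f \<in> R0 \<longleftrightarrow> f \<in> R \<and> (\<forall>x. x \<notin> reg \<longrightarrow> f x = 0)"
  by (auto simp: R0_def cut_def fun_eq_iff)

lemma R0_regular: "f \<in> R0 \<Longrightarrow> f \<in> R"
  and R0_cut: "f \<in> R0 \<Longrightarrow> cut f = f"
  by (auto simp: R0_def)

lemma cut_R0: "f \<in> R \<Longrightarrow> cut f \<in> R0"
  by (auto simp: R0_def intro: regular_cong)

text \<open>A subspace has a linear projection onto it, obtained here as a left inverse of
  \<open>id\<close> on \<open>R0\<close>.\<close>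

lemma ex_projection:
  "\<exists>p. (\<forall>f g. p (f + g) = p f + p g) \<and> (\<forall>c f. p (\<lambda>x. c * f x) = (\<lambda>x. c * p f x)) \<and>
     (\<forall>f. p f \<in> R0) \<and> (\<forall>f\<in>R0. p f = f)"
proof -
  interpret V: vector_space_pair "\<lambda>(c::complex) (f::'i scalar_fun) x. c * f x" "\<lambda>c (f::'i scalar_fun) x. c * f x"
    by (rule vector_space_pair_fun)
  have "V.vs1.subspace R0"
    unfolding V.vs1.subspace_def R0_def
    by (auto simp: cut_def fun_eq_iff plus_fun_def zero_fun_def)
  moreover have "Vector_Spaces.linear (\<lambda>(c::complex) (f::'i scalar_fun) x. c * f x) (\<lambda>c f x. c * f x) id"
    by (rule V.vs1.linear_id)
  ultimately obtain p where p: "range p \<subseteq> R0"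
      "Vector_Spaces.linear (\<lambda>(c::complex) (f::'i scalar_fun) x. c * f x) (\<lambda>c f x. c * f x) p"
      "\<forall>v\<in>R0. p (id v) = v"
    using V.linear_exists_left_inverse_on [of id R0] by auto
  from p show ?thesis
    by (intro exI [of _ p]) (auto simp: Vector_Spaces.linear_iff)
qed

definition proj :: "'i oper" where
  "proj = (SOME p. (\<forall>f g. p (f + g) = p f + p g) \<and> (\<forall>c f. p (\<lambda>x. c * f x) = (\<lambda>x. c * p f x)) \<and>
     (\<forall>f. p f \<in> R0) \<and> (\<forall>f\<in>R0. p f = f))"

lemma proj_add: "proj (f + g) = proj f + proj g"
  and proj_scale: "proj (\<lambda>x. c * f x) = (\<lambda>x. c * proj f x)"
  and proj_R0: "proj f \<in> R0"
  and proj_id: "f \<in> R0 \<Longrightarrow> proj f = f"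
  using someI_ex [OF ex_projection] unfolding proj_def [symmetric] by blast+

lemma proj_regular: "proj f \<in> R"
  and proj_proj [simp]: "proj (proj f) = proj f"
  using proj_R0 R0_regular R0_cut proj_id by blast+

section \<open>Multiplication and derivative operators and their commutation relations\<close>

definition mop :: "'i scalar_fun \<Rightarrow> 'i lop" where
  "mop g = Lop (\<lambda>f. cut (\<lambda>x. g x * proj f x))"

definition dop :: "'i \<Rightarrow> 'i lop" where
  "dop k = Lop (\<lambda>f. cut (pderivative k (proj f)))"

lemma mop_apply: "lop_apply (mop g) f = cut (\<lambda>x. g x * proj f x)"
  unfolding mop_def
  by (subst Lop_inverse) (auto simp: proj_add proj_scale cut_def fun_eq_iff algebra_simps)

lemma dop_apply:
  assumes k: "k \<in> I"
  shows "lop_apply (dop k) f = cut (pderivative k (proj f))"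
proof -
  have pd: "has_pd k (proj f) (pderivative k (proj f))" for f
    using regular_pd(2) [OF proj_regular k k] .
  have "pderivative k (proj f + proj g) x = pderivative k (proj f) x + pderivative k (proj g) x"
    if "x \<in> reg" for f g x
    using has_pd_pderivative [OF has_pd_add [OF pd pd] that] by (simp add: plus_fun_def)
  moreover have "pderivative k (\<lambda>x. c * proj f x) x = c * pderivative k (proj f) x" if "x \<in> reg" for c f x
    using has_pd_pderivative [OF has_pd_cmult [OF pd] that] .
  ultimately show ?thesis
    unfolding dop_def by (subst Lop_inverse) (auto simp: proj_add proj_scale cut_def fun_eq_iff)
qed

text \<open>The operators that live on \<open>R0\<close>: they factor through the projection and are
  determined by their values on \<open>R0\<close>, see \<open>supported_eqI\<close>.\<close>

definition supported :: "'i lop \<Rightarrow> bool" where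
  "supported T \<longleftrightarrow> (\<forall>f. lop_apply T f = lop_apply T (proj f) \<and> lop_apply T f \<in> R0)"

lemma supported_mop: "g \<in> R \<Longrightarrow> supported (mop g)"
  and supported_dop: "k \<in> I \<Longrightarrow> supported (dop k)"
  by (auto simp: supported_def mop_apply dop_apply intro!: cut_R0 regular_pd(1) proj_regular)

lemma supported_mult: "supported S \<Longrightarrow> supported T \<Longrightarrow> supported (S * T)"
  by (auto simp: supported_def times_lop.rep_eq)

lemma supported_eqI:
  assumes "supported S" "supported T" "\<And>f. f \<in> R0 \<Longrightarrow> lop_apply S f = lop_apply T f"
  shows "S = T"
proof (rule lop_eqI)
  fix f x
  have "lop_apply S f = lop_apply T f"
    using assms proj_R0 [of f] unfolding supported_def by metis
  then show "lop_apply S f x = lop_apply T f x" by simp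
qed

lemma R0_add: "f \<in> R0 \<Longrightarrow> g \<in> R0 \<Longrightarrow> f + g \<in> R0"
  and R0_scale: "f \<in> R0 \<Longrightarrow> (\<lambda>x. c * f x) \<in> R0"
  by (auto simp: R0_iff plus_fun_def)

lemma supported_add: "supported S \<Longrightarrow> supported T \<Longrightarrow> supported (S + T)"
  and supported_scaleR: "supported S \<Longrightarrow> supported (r *\<^sub>R S)"
  by (auto simp: supported_def plus_lop.rep_eq scaleR_lop.rep_eq intro!: R0_add R0_scale)

lemma supported_diff: "supported S \<Longrightarrow> supported T \<Longrightarrow> supported (S - T)"
  using supported_add [OF _ supported_scaleR, of S T "- 1"] by simp

lemma supported_zero: "supported 0"
  by (auto simp: supported_def zero_lop.rep_eq R0_def cut_def zero_fun_def)

lemma supported_sum: "(\<And>a. a \<in> A \<Longrightarrow> supported (f a)) \<Longrightarrow> supported (sum f A)"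
  by (induction A rule: infinite_finite_induct) (auto intro: supported_add supported_zero)

lemma mop_cong: "(\<And>x. x \<in> reg \<Longrightarrow> g x = h x) \<Longrightarrow> mop g = mop h"
  by (rule lop_eqI) (auto simp: mop_apply cut_def)

lemma mop_add: "mop (\<lambda>x. g x + h x) = mop g + mop h"
  and mop_diff: "mop (\<lambda>x. g x - h x) = mop g - mop h"
  and mop_zero: "mop (\<lambda>x. 0) = 0"
  and mop_scaleR: "mop (\<lambda>x. of_real r * g x) = r *\<^sub>R mop g"
  by (rule lop_eqI, auto simp: mop_apply cut_def plus_lop.rep_eq minus_lop.rep_eq zero_lop.rep_eq
      scaleR_lop.rep_eq algebra_simps)+

lemma mop_2: "mop (\<lambda>x. 2 * f x) = 2 *\<^sub>R mop f"
  using mop_scaleR [of 2 f] by simp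

lemma mop_sum: "mop (\<lambda>x. \<Sum>a\<in>A. g a x) = (\<Sum>a\<in>A. mop (g a))"
  by (induction A rule: infinite_finite_induct) (auto simp: mop_zero mop_add)

lemma mop_mult:
  assumes "g \<in> R" "h \<in> R"
  shows "mop g * mop h = mop (\<lambda>x. g x * h x)"
proof (rule lop_eqI)
  fix f x
  have "proj (cut (\<lambda>x. h x * proj f x)) = cut (\<lambda>x. h x * proj f x)"
    using assms proj_regular by (intro proj_id cut_R0) auto
  then show "lop_apply (mop g * mop h) f x = lop_apply (mop (\<lambda>x. g x * h x)) f x"
    by (simp add: times_lop.rep_eq mop_apply cut_def)
qed

lemma ad_mop_mop: "g \<in> R \<Longrightarrow> h \<in> R \<Longrightarrow> ad (mop g) (mop h) = 0"
  by (simp add: ad_def mop_mult mult.commute)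

lemma ad_dop_mop:
  assumes "k \<in> I" "g \<in> R" "has_pd k g g'"
  shows "ad (dop k) (mop g) = mop g'"
proof (rule supported_eqI)
  have g': "g' \<in> R" using has_pd_regular assms by blast
  show "supported (ad (dop k) (mop g))" "supported (mop g')"
    unfolding ad_def using assms g' by (auto intro!: supported_diff supported_mult supported_mop supported_dop)
  fix f assume f: "f \<in> R0"
  then have fR: "f \<in> R" and pf: "proj f = f" using R0_regular proj_id by auto
  \<comment> \<open>The intermediate results already lie in \<open>R0\<close>, so the inner
    projections do nothing.\<close>
  have 1: "proj (cut (\<lambda>x. g x * f x)) = cut (\<lambda>x. g x * f x)"
    using assms fR by (intro proj_id cut_R0) auto
  have 2: "proj (cut (pderivative k f)) = cut (pderivative k f)"
    using assms fR by (intro proj_id cut_R0 regular_pd) auto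
  have "has_pd k (\<lambda>x. g x * f x) (\<lambda>x. g' x * f x + g x * pderivative k f x)"
    using assms regular_pd(2) [OF fR] by (intro has_pd_mult) auto
  then have "has_pd k (cut (\<lambda>x. g x * f x)) (\<lambda>x. g' x * f x + g x * pderivative k f x)"
    by (rule has_pd_cong [THEN iffD1, rotated -1]) (use assms in auto)
  then have 3: "pderivative k (cut (\<lambda>x. g x * f x)) x = g' x * f x + g x * pderivative k f x" if "x \<in> reg" for x
    using has_pd_pderivative that by blast
  show "lop_apply (ad (dop k) (mop g)) f = lop_apply (mop g') f"
    using assms(1)
    by (auto simp: ad_def minus_lop.rep_eq times_lop.rep_eq mop_apply dop_apply pf 1 2 fun_eq_iff)
      (auto simp: cut_def 3 [unfolded cut_def])
qed

lemma dop_mop: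
  assumes "k \<in> I" "f \<in> R" "has_pd k f f'"
  shows "dop k * mop f = mop f * dop k + mop f'"
  using ad_dop_mop [OF assms] by (simp add: ad_def algebra_simps)

lemma dop_dop_apply:
  assumes "i \<in> I" "k \<in> I" "f \<in> R0"
  shows "lop_apply (dop i * dop k) f = cut (pderivative i (pderivative k f))"
proof -
  have fR: "f \<in> R" and pf: "proj f = f" using R0_regular proj_id assms by auto
  have R: "pderivative k f \<in> R" using regular_pd fR assms by blast
  have 1: "proj (cut (pderivative k f)) = cut (pderivative k f)" using R by (intro proj_id cut_R0)
  have "has_pd i (cut (pderivative k f)) (pderivative i (pderivative k f))"
    by (rule has_pd_cong [THEN iffD1, OF _ _ _ regular_pd(2) [OF R]]) (use assms in auto)
  then show ?thesis
    by (simp add: times_lop.rep_eq dop_apply assms pf 1 has_pd_pderivative cong: cut_cong)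
qed

lemma ad_dop_dop:
  assumes "i \<in> I" "k \<in> I"
  shows "ad (dop i) (dop k) = 0"
proof -
  have "dop i * dop k = dop k * dop i"
    using assms by (intro supported_eqI supported_mult supported_dop)
      (auto simp: dop_dop_apply R0_regular intro!: cut_cong regular_pd(3))
  then show ?thesis by (simp add: ad_def)
qed

text \<open>Among supported operators the unit is \<open>mop (\<lambda>_. 1)\<close>, which is the
  projection onto \<open>R0\<close>, and not the \<open>1\<close> of the ring.\<close>

lemma mop_one_mult: "supported T \<Longrightarrow> mop (\<lambda>_. 1) * T = T"
  and mult_mop_one: "supported T \<Longrightarrow> T * mop (\<lambda>_. 1) = T"
  by (auto intro!: supported_eqI supported_mult supported_mop
      simp: times_lop.rep_eq mop_apply supported_def proj_id R0_cut)

text \<open>The bridge between concrete operators, which are compared only on regular functions at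
  points of the complement, and elements of the ring: \<open>rep_oper_eq_iff\<close> turns
  \<open>oper_eq\<close> into equality.\<close>

definition rep :: "'i oper \<Rightarrow> 'i lop \<Rightarrow> bool" where
  "rep P T \<longleftrightarrow> supported T \<and> (\<forall>f\<in>R. P f \<in> R \<and> cut (P f) = lop_apply T (cut f))"

lemma rep_supported: "rep P T \<Longrightarrow> supported T"
  and rep_regular: "rep P T \<Longrightarrow> f \<in> R \<Longrightarrow> P f \<in> R"
  and rep_apply: "rep P T \<Longrightarrow> f \<in> R \<Longrightarrow> cut (P f) = lop_apply T (cut f)"
  by (auto simp: rep_def)

lemma rep_oper_eq_iff:
  assumes "rep P S" "rep Q T"
  shows "oper_eq I H P Q \<longleftrightarrow> S = T"
proof
  assume eq: "oper_eq I H P Q"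
  show "S = T"
  proof (rule supported_eqI)
    show "supported S" "supported T" using assms rep_supported by auto
    fix f assume "f \<in> R0"
    then have f: "f \<in> R" "cut f = f" using R0_regular R0_cut by auto
    have "cut (P f) = cut (Q f)" using eq f by (auto simp: oper_eq_def intro: cut_cong)
    then show "lop_apply S f = lop_apply T f" using rep_apply assms f by metis
  qed
next
  assume "S = T"
  then show "oper_eq I H P Q" using assms rep_apply cut_eqD unfolding oper_eq_def by metis
qed

lemma rep_oper_eq:
  assumes "rep Q T" "\<And>f x. f \<in> R \<Longrightarrow> x \<in> reg \<Longrightarrow> P f x = Q f x"
  shows "rep P T"
  unfolding rep_def
proof (intro conjI ballI)
  show "supported T" using assms rep_supported by blast
  fix f assume f: "f \<in> R"
  show "P f \<in> R" using regular_cong [OF rep_regular [OF assms(1) f]] assms(2) [OF f] by metis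
  show "cut (P f) = lop_apply T (cut f)"
    using rep_apply [OF assms(1) f] cut_cong [of "P f" "Q f"] assms(2) [OF f] by metis
qed

lemma rep_comp: "rep P S \<Longrightarrow> rep Q T \<Longrightarrow> rep (\<lambda>f. P (Q f)) (S * T)"
  by (auto simp: rep_def supported_mult times_lop.rep_eq)

lemma rep_add:
  assumes "rep P S" "rep Q T"
  shows "rep (\<lambda>f x. P f x + Q f x) (S + T)"
  using assms by (auto simp: rep_def supported_add plus_lop.rep_eq cut_add)

lemma rep_diff:
  assumes "rep P S" "rep Q T"
  shows "rep (\<lambda>f x. P f x - Q f x) (S - T)"
  using assms by (auto simp: rep_def supported_diff minus_lop.rep_eq cut_diff)

lemma rep_zero: "rep (\<lambda>f x. 0) 0"
  by (auto simp: rep_def supported_zero zero_lop.rep_eq cut_def)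

lemma rep_sum:
  "(\<And>a. a \<in> A \<Longrightarrow> rep (P a) (S a)) \<Longrightarrow> rep (\<lambda>f x. \<Sum>a\<in>A. P a f x) (\<Sum>a\<in>A. S a)"
  by (induction A rule: infinite_finite_induct) (auto simp: rep_zero rep_add)

lemma rep_mult_oper: "g \<in> R \<Longrightarrow> rep (mult_oper g) (mop g)"
  by (auto simp: rep_def supported_mop mult_oper_def mop_apply proj_id [OF cut_R0] intro!: cut_cong)

lemma rep_times: "g \<in> R \<Longrightarrow> rep P T \<Longrightarrow> rep (\<lambda>f x. g x * P f x) (mop g * T)"
  using rep_comp [OF rep_mult_oper] by (simp add: mult_oper_def)

lemma rep_pderivative:
  assumes "k \<in> I"
  shows "rep (pderivative k) (dop k)"
  unfolding rep_def
proof (intro conjI ballI supported_dop regular_pd(1) [OF _ assms assms] assms)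
  fix f assume f: "f \<in> R"
  have "has_pd k (cut f) (pderivative k f)"
    by (rule has_pd_cong [THEN iffD1, OF _ _ _ regular_pd(2) [OF f]]) (use assms in auto)
  then show "cut (pderivative k f) = lop_apply (dop k) (cut f)"
    using f assms by (auto simp: dop_apply proj_id [OF cut_R0] has_pd_pderivative intro!: cut_cong)
qed

lemma rep_commutator:
  assumes "rep P S" "rep Q T"
  shows "rep (commutator P Q) (ad S T)"
  unfolding commutator_def ad_def
  by (rule rep_diff [OF rep_comp [OF assms] rep_comp [OF assms(2,1)]])

lemma rep_commutator_pow: "rep P S \<Longrightarrow> rep Q T \<Longrightarrow> rep ((commutator P ^^ n) Q) ((ad S ^^ n) T)"
  by (induction n) (auto intro: rep_commutator)

lemma rep_scaleR:
  assumes "rep P T"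
  shows "rep (\<lambda>f x. of_real c * P f x) (c *\<^sub>R T)"
  using rep_times [OF regular_const assms, of "of_real c"] mop_scaleR [of c "\<lambda>_. 1"]
  by (simp add: mop_one_mult rep_supported [OF assms])

lemma rep_id: "rep id (mop (\<lambda>_. 1))"
  by (rule rep_oper_eq [OF rep_mult_oper]) (auto simp: mult_oper_def)

lemma rep_pow:
  assumes "rep P S" "rep Q T"
  shows "rep ((P ^^ n) \<circ> Q) (S ^ n * T)"
proof (induction n)
  case (Suc n)
  then show ?case using rep_comp [OF assms(1) Suc] by (simp add: o_def mult.assoc)
qed (simp add: assms)

subsection \<open>Differential operators\<close>

text \<open>Ending in \<open>mop (\<lambda>_. 1)\<close> instead of \<open>1\<close> keeps every
  word supported, including the empty one.\<close>

definition dword :: "'i list \<Rightarrow> 'i lop" where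
  "dword w = foldr (\<lambda>k T. dop k * T) w (mop (\<lambda>_. 1))"

lemma rep_dword: "w \<in> lists I \<Longrightarrow> rep (foldr pderivative w) (dword w)"
proof (induction w)
  case Nil
  show ?case using rep_id by (simp add: dword_def id_def)
next
  case (Cons k w)
  then have "rep (\<lambda>f. pderivative k (foldr pderivative w f)) (dop k * dword w)"
    by (intro rep_comp [OF rep_pderivative]) auto
  then show ?case by (simp add: dword_def)
qed

definition diff_lop :: "'i lop set" where
  "diff_lop = {T. \<exists>S u. finite S \<and> S \<subseteq> lists I \<and> (\<forall>w\<in>S. u w \<in> R) \<and> T = (\<Sum>w\<in>S. mop (u w) * dword w)}"

lemma diff_lop_add:
  assumes "S \<in> diff_lop" "T \<in> diff_lop"
  shows "S + T \<in> diff_lop"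
proof -
  obtain A u where A: "finite A" "A \<subseteq> lists I" "\<forall>w\<in>A. u w \<in> R" "S = (\<Sum>w\<in>A. mop (u w) * dword w)"
    using assms(1) unfolding diff_lop_def by blast
  obtain B v where B: "finite B" "B \<subseteq> lists I" "\<forall>w\<in>B. v w \<in> R" "T = (\<Sum>w\<in>B. mop (v w) * dword w)"
    using assms(2) unfolding diff_lop_def by blast
  define u' v' where "u' w = (if w \<in> A then u w else (\<lambda>_. 0))" and "v' w = (if w \<in> B then v w else (\<lambda>_. 0))" for w
  have "S = (\<Sum>w\<in>A \<union> B. mop (u' w) * dword w)" "T = (\<Sum>w\<in>A \<union> B. mop (v' w) * dword w)"
    unfolding A(4) B(4) using A(1) B(1)
    by (auto intro!: sum.mono_neutral_cong_left simp: u'_def v'_def mop_zero)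
  then have "S + T = (\<Sum>w\<in>A \<union> B. mop (\<lambda>x. u' w x + v' w x) * dword w)"
    by (simp add: mop_add distrib_right sum.distrib)
  moreover have "\<forall>w\<in>A \<union> B. (\<lambda>x. u' w x + v' w x) \<in> R"
    using A B by (auto simp: u'_def v'_def)
  ultimately show ?thesis
    unfolding diff_lop_def using A B
    by (intro CollectI exI [of _ "A \<union> B"] exI [of _ "\<lambda>w x. u' w x + v' w x"]) auto
qed

lemma diff_lop_zero: "0 \<in> diff_lop"
  unfolding diff_lop_def by (intro CollectI exI [of _ "{}"]) auto

lemma diff_lop_sum: "(\<And>a. a \<in> A \<Longrightarrow> f a \<in> diff_lop) \<Longrightarrow> sum f A \<in> diff_lop"
  by (induction A rule: infinite_finite_induct) (auto simp: diff_lop_zero diff_lop_add)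

lemma diff_lop_word: "w \<in> lists I \<Longrightarrow> u \<in> R \<Longrightarrow> mop u * dword w \<in> diff_lop"
  unfolding diff_lop_def by (intro CollectI exI [of _ "{w}"] exI [of _ "\<lambda>_. u"]) auto

lemma diff_lop_supported: "T \<in> diff_lop \<Longrightarrow> supported T"
  unfolding diff_lop_def
  by (auto intro!: supported_sum supported_mult supported_mop dest!: subsetD intro: rep_supported [OF rep_dword])

lemma diff_lop_mop_mult:
  assumes "g \<in> R" "T \<in> diff_lop"
  shows "mop g * T \<in> diff_lop"
proof -
  obtain A u where A: "finite A" "A \<subseteq> lists I" "\<forall>w\<in>A. u w \<in> R" "T = (\<Sum>w\<in>A. mop (u w) * dword w)"
    using assms(2) unfolding diff_lop_def by blast
  have "mop g * T = (\<Sum>w\<in>A. mop (\<lambda>x. g x * u w x) * dword w)"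
    unfolding A(4) sum_distrib_left
    by (rule sum.cong) (use A assms in \<open>auto simp: mult.assoc [symmetric] mop_mult\<close>)
  also have "\<dots> \<in> diff_lop"
    by (rule diff_lop_sum, rule diff_lop_word) (use A assms in auto)
  finally show ?thesis .
qed

text \<open>Moving \<open>dop k\<close> to the right of a coefficient costs a term with the
  differentiated coefficient and restores the normal form; closure under products follows by
  recursion over words.\<close>

lemma diff_lop_dop_mult:
  assumes "k \<in> I" "T \<in> diff_lop"
  shows "dop k * T \<in> diff_lop"
proof -
  obtain A u where A: "finite A" "A \<subseteq> lists I" "\<forall>w\<in>A. u w \<in> R" "T = (\<Sum>w\<in>A. mop (u w) * dword w)"
    using assms(2) unfolding diff_lop_def by blast
  have "dop k * (mop (u w) * dword w) = mop (u w) * dword (k # w) + mop (pderivative k (u w)) * dword w"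
    if "w \<in> A" for w
  proof -
    have "ad (dop k) (mop (u w)) = mop (pderivative k (u w))"
      using A that assms by (intro ad_dop_mop regular_pd) auto
    then have "dop k * mop (u w) = mop (u w) * dop k + mop (pderivative k (u w))"
      by (simp add: ad_def algebra_simps)
    then show ?thesis by (simp add: mult.assoc [symmetric] dword_def distrib_right)
  qed
  then have "dop k * T = (\<Sum>w\<in>A. mop (u w) * dword (k # w) + mop (pderivative k (u w)) * dword w)"
    unfolding A(4) sum_distrib_left by (rule sum.cong [OF refl])
  also have "\<dots> \<in> diff_lop"
    using A assms by (intro diff_lop_sum diff_lop_add diff_lop_word) (auto intro: regular_pd)
  finally show ?thesis .
qed

lemma diff_lop_mult:
  assumes "S \<in> diff_lop" "T \<in> diff_lop"
  shows "S * T \<in> diff_lop"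
proof -
  obtain A u where A: "finite A" "A \<subseteq> lists I" "\<forall>w\<in>A. u w \<in> R" "S = (\<Sum>w\<in>A. mop (u w) * dword w)"
    using assms(1) unfolding diff_lop_def by blast
  have "dword w * T \<in> diff_lop" if "w \<in> lists I" for w
    using that
  proof (induction w)
    case Nil
    then show ?case using assms diff_lop_supported by (simp add: dword_def mop_one_mult)
  next
    case (Cons k w)
    then show ?case using diff_lop_dop_mult [of k "dword w * T"] by (simp add: dword_def mult.assoc)
  qed
  then show ?thesis
    unfolding A(4) sum_distrib_right mult.assoc
    using A by (intro diff_lop_sum diff_lop_mop_mult) auto
qed

lemma diff_lop_mop: "g \<in> R \<Longrightarrow> mop g \<in> diff_lop"
  using diff_lop_word [of "[]" g] by (simp add: dword_def mult_mop_one supported_mop)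

lemma diff_lop_dop: "k \<in> I \<Longrightarrow> dop k \<in> diff_lop"
  using diff_lop_dop_mult [OF _ diff_lop_mop [of "\<lambda>_. 1"], of k] by (simp add: mult_mop_one supported_dop)

lemma diff_lop_scaleR: "T \<in> diff_lop \<Longrightarrow> r *\<^sub>R T \<in> diff_lop"
  using diff_lop_mop_mult [of "\<lambda>_. of_real r" T] mop_scaleR [of r "\<lambda>_. 1"]
  by (simp add: mop_one_mult diff_lop_supported)

lemma diff_lop_diff: "S \<in> diff_lop \<Longrightarrow> T \<in> diff_lop \<Longrightarrow> S - T \<in> diff_lop"
  using diff_lop_add [OF _ diff_lop_scaleR, of S T "- 1"] by simp

lemma diff_lop_ad_pow: "S \<in> diff_lop \<Longrightarrow> T \<in> diff_lop \<Longrightarrow> (ad S ^^ n) T \<in> diff_lop"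
  by (induction n) (auto simp: ad_def intro: diff_lop_diff diff_lop_mult)

lemma diff_oper_rep:
  assumes "rep P T" "T \<in> diff_lop"
  shows "diff_oper I H P"
proof -
  obtain A u where A: "finite A" "A \<subseteq> lists I" "\<forall>w\<in>A. u w \<in> R" "T = (\<Sum>w\<in>A. mop (u w) * dword w)"
    using assms(2) unfolding diff_lop_def by blast
  have "rep (\<lambda>f x. \<Sum>w\<in>A. u w x * foldr pderivative w f x) T"
    unfolding A(4) using A by (intro rep_sum rep_times rep_dword) auto
  then have "oper_eq I H P (\<lambda>f x. \<Sum>w\<in>A. u w x * foldr pderivative w f x)"
    using rep_oper_eq_iff [OF assms(1)] by blast
  then show ?thesis unfolding diff_oper_def using A by blast
qed

end

section \<open>The Calogero--Moser operator\<close>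

lemma sum_antisym:
  fixes f :: "'a \<Rightarrow> 'a \<Rightarrow> 'b::real_vector"
  assumes "\<And>i j. i \<in> A \<Longrightarrow> j \<in> A \<Longrightarrow> f j i = - f i j"
  shows "(\<Sum>i\<in>A. \<Sum>j\<in>A. f i j) = 0"
proof -
  have "(\<Sum>i\<in>A. \<Sum>j\<in>A. f i j) = (\<Sum>i\<in>A. \<Sum>j\<in>A. - f i j)"
    by (subst sum.swap) (intro sum.cong refl assms)
  then have "(\<Sum>i\<in>A. \<Sum>j\<in>A. f i j) = - (\<Sum>i\<in>A. \<Sum>j\<in>A. f i j)" by (simp add: sum_negf)
  then have "2 *\<^sub>R (\<Sum>i\<in>A. \<Sum>j\<in>A. f i j) = 0" by (simp add: scaleR_2 eq_neg_iff_add_eq_0)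
  then show ?thesis by simp
qed

lemma inverse_cyclic:
  fixes a b c :: complex
  assumes "a + b + c = 0" "a \<noteq> 0" "b \<noteq> 0" "c \<noteq> 0"
  shows "inverse a * inverse b + inverse b * inverse c + inverse c * inverse a = 0"
proof -
  have "inverse a * inverse b + inverse b * inverse c + inverse c * inverse a = (a + b + c) / (a * b * c)"
    using assms(2-4) by (simp add: field_simps)
  then show ?thesis using assms(1) by simp
qed

text \<open>Only the scales \<open>\<alpha>\<close> enter, not the species. Up to nonzero factors
  the hyperplanes are those on which two scaled coordinates coincide. The alternative in
  \<open>\<kappa>_rel\<close> separates particles of equal squared scale from those that satisfy the
  two-species relation.\<close>

locale calogero_moser =
  fixes I :: "'i set" and H :: "'i scalar_fun set" and \<alpha> :: "'i \<Rightarrow> complex" and \<kappa> :: complex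
  assumes finite_coords: "finite I" and finite_forms: "finite H"
    and \<alpha>_nz: "i \<in> I \<Longrightarrow> \<alpha> i \<noteq> 0"
    and forms: "h \<in> H \<Longrightarrow> \<exists>i\<in>I. \<exists>j\<in>I. \<exists>c. i \<noteq> j \<and> c \<noteq> 0 \<and> h = (\<lambda>x. c * (\<alpha> i * x i - \<alpha> j * x j))"
    and forms_cover: "i \<in> I \<Longrightarrow> j \<in> I \<Longrightarrow> i \<noteq> j \<Longrightarrow>
      \<exists>c. c \<noteq> 0 \<and> (\<lambda>x. c * (\<alpha> i * x i - \<alpha> j * x j)) \<in> H"
    and \<kappa>_rel: "i \<in> I \<Longrightarrow> j \<in> I \<Longrightarrow>
      \<alpha> i ^ 2 = \<alpha> j ^ 2 \<or> \<alpha> i ^ 2 * \<alpha> j ^ 2 * (\<alpha> i ^ 2 + \<alpha> j ^ 2) = - \<kappa>"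

sublocale calogero_moser \<subseteq> arrangement I H
proof
  fix h assume "h \<in> H"
  then obtain i j c where *: "i \<in> I" "j \<in> I" "i \<noteq> j" "h = (\<lambda>x. c * (\<alpha> i * x i - \<alpha> j * x j))"
    using forms by blast
  have "(\<Sum>k\<in>I. (if k = i then c * \<alpha> i else if k = j then - c * \<alpha> j else 0) * x k) = h x" for x
  proof -
    have "(\<Sum>k\<in>I. (if k = i then c * \<alpha> i else if k = j then - c * \<alpha> j else 0) * x k) =
        (\<Sum>k\<in>I. (if k = i then c * \<alpha> i * x i else 0) - (if k = j then c * \<alpha> j * x j else 0))"
      by (rule sum.cong) (use * in auto)
    also have "\<dots> = h x" using * finite_coords by (simp add: sum_subtractf algebra_simps)
    finally show ?thesis .
  qed
  then have "h = (\<lambda>x. \<Sum>k\<in>I. (if k = i then c * \<alpha> i else if k = j then - c * \<alpha> j else 0) * x k)"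
    by (simp only: fun_eq_iff simp_thms)
  then show "\<exists>l. h = (\<lambda>x. \<Sum>i\<in>I. l i * x i)"
    by (rule exI [of _ "\<lambda>k. if k = i then c * \<alpha> i else if k = j then - c * \<alpha> j else 0"])
qed (rule finite_coords, rule finite_forms)

context calogero_moser
begin

lemma reg_distinct:
  assumes "x \<in> reg" "i \<in> I" "j \<in> I" "i \<noteq> j"
  shows "\<alpha> i * x i \<noteq> \<alpha> j * x j"
proof -
  obtain c where c: "(\<lambda>x. c * (\<alpha> i * x i - \<alpha> j * x j)) \<in> H" using forms_cover [OF assms(2-4)] by blast
  have "\<forall>h\<in>H. h x \<noteq> 0" using assms(1) by (simp add: reg_points_def)
  from bspec [OF this c] show ?thesis by auto
qed

section \<open>Reciprocal differences and their power sums\<close>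

definition r :: "'i \<Rightarrow> 'i \<Rightarrow> 'i scalar_fun" where
  "r i j = (\<lambda>x. inverse (\<alpha> i * x i - \<alpha> j * x j))"

lemma r_self [simp]: "r i i x = 0"
  and r_swap: "r j i x = - r i j x"
  by (simp_all add: r_def flip: inverse_minus_eq)

lemma regular_r [intro]:
  assumes "i \<in> I" "j \<in> I"
  shows "r i j \<in> R"
proof (cases "i = j")
  case True
  then have "r i j = (\<lambda>_. 0)" by (simp add: r_def)
  then show ?thesis by simp
next
  case False
  then obtain c where c: "c \<noteq> 0" "(\<lambda>x. c * (\<alpha> i * x i - \<alpha> j * x j)) \<in> H"
    using forms_cover assms by blast
  \<comment> \<open>The form belongs to \<open>H\<close> only up to the factor \<open>c\<close>,
    which is divided out.\<close>
  have "(\<lambda>x. c * inverse (c * (\<alpha> i * x i - \<alpha> j * x j))) \<in> R"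
    by (intro regular_mult regular_const regular_inverse [OF c(2)])
  moreover have "(\<lambda>x. c * inverse (c * (\<alpha> i * x i - \<alpha> j * x j))) = r i j"
    using c(1) by (simp add: r_def fun_eq_iff)
  ultimately show ?thesis by simp
qed

lemma has_pd_r:
  assumes "i \<in> I" "j \<in> I" "k \<in> I"
  shows "has_pd k (r i j) (\<lambda>x. \<alpha> k * ((if k = j then 1 else 0) - (if k = i then 1 else 0)) * r i j x ^ 2)"
proof (cases "i = j")
  case True
  then have "r i j = (\<lambda>_. 0)" by (simp add: r_def)
  then show ?thesis by (simp add: has_pd_const True)
next
  case False
  have "has_pd k (\<lambda>x. \<alpha> i * x i + (- \<alpha> j) * x j) (\<lambda>_. \<alpha> i * (if i = k then 1 else 0) + (- \<alpha> j) * (if j = k then 1 else 0))"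
    by (intro has_pd_add has_pd_cmult has_pd_coord)
  then have "has_pd k (\<lambda>x. \<alpha> i * x i - \<alpha> j * x j) (\<lambda>_. \<alpha> i * (if i = k then 1 else 0) - \<alpha> j * (if j = k then 1 else 0))"
    by simp
  then have "has_pd k (\<lambda>x. inverse (\<alpha> i * x i - \<alpha> j * x j))
      (\<lambda>x. - (\<alpha> i * (if i = k then 1 else 0) - \<alpha> j * (if j = k then 1 else 0)) * inverse (\<alpha> i * x i - \<alpha> j * x j) ^ 2)"
    by (rule has_pd_inverse) (use reg_distinct False assms in auto)
  then show ?thesis
    unfolding r_def by (rule pd_eqI) (use assms in auto)
qed

lemma has_pd_r_power:
  assumes "i \<in> I" "j \<in> I" "k \<in> I"
  shows "has_pd k (\<lambda>x. r i j x ^ n)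
    (\<lambda>x. of_nat n * \<alpha> k * ((if k = j then 1 else 0) - (if k = i then 1 else 0)) * r i j x ^ Suc n)"
  by (rule pd_eqI [OF has_pd_power [OF has_pd_r [OF assms]]])
    (use assms in \<open>cases n; auto simp: power2_eq_square\<close>)+

text \<open>\<open>s\<close> carries the weight of the particle summed over. The unweighted
  \<open>t\<close> arises when a sum over both particles is differentiated in the weighted one, as
  in \<open>has_pd_\<gamma>\<close>.\<close>

definition s :: "'i \<Rightarrow> nat \<Rightarrow> 'i scalar_fun" where
  "s k n = (\<lambda>x. \<Sum>j\<in>I. 1 / \<alpha> j ^ 2 * r k j x ^ n)"

definition t :: "'i \<Rightarrow> nat \<Rightarrow> 'i scalar_fun" where
  "t k n = (\<lambda>x. \<Sum>j\<in>I. r k j x ^ n)"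

lemma regular_s [intro]: "k \<in> I \<Longrightarrow> s k n \<in> R"
  and regular_t [intro]: "k \<in> I \<Longrightarrow> t k n \<in> R"
  unfolding s_def t_def by (intro regular_sum regular_mult regular_const regular_power regular_r; assumption)+

lemma has_pd_s:
  assumes "k \<in> I" "i \<in> I"
  shows "has_pd i (s k n)
    (\<lambda>x. of_nat n * \<alpha> i * (1 / \<alpha> i ^ 2 * r k i x ^ Suc n - (if i = k then s k (Suc n) x else 0)))"
proof -
  let ?d = "\<lambda>j x. of_nat n * \<alpha> i * ((if i = j then 1 else 0) - (if i = k then 1 else 0)) * r k j x ^ Suc n"
  have "has_pd i (s k n) (\<lambda>x. \<Sum>j\<in>I. 1 / \<alpha> j ^ 2 * ?d j x)"
    unfolding s_def using assms by (intro has_pd_sum has_pd_cmult has_pd_r_power)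
  moreover have "(\<Sum>j\<in>I. 1 / \<alpha> j ^ 2 * ?d j x) =
      of_nat n * \<alpha> i * (1 / \<alpha> i ^ 2 * r k i x ^ Suc n - (if i = k then s k (Suc n) x else 0))" for x
  proof -
    have "(\<Sum>j\<in>I. 1 / \<alpha> j ^ 2 * ?d j x) = (\<Sum>j\<in>I. of_nat n * \<alpha> i * ((if i = j then 1 / \<alpha> i ^ 2 * r k i x ^ Suc n else 0) -
        (if i = k then 1 else 0) * (1 / \<alpha> j ^ 2 * r k j x ^ Suc n)))"
      by (rule sum.cong) (auto simp: algebra_simps)
    also have "\<dots> = of_nat n * \<alpha> i * (1 / \<alpha> i ^ 2 * r k i x ^ Suc n - (if i = k then s k (Suc n) x else 0))"
      using assms finite_I
      by (simp add: sum_distrib_left [symmetric] sum_subtractf s_def del: power_Suc)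
    finally show ?thesis .
  qed
  ultimately show ?thesis by simp
qed

lemma has_pd_s_self: "k \<in> I \<Longrightarrow> has_pd k (s k n) (\<lambda>x. - of_nat n * \<alpha> k * s k (Suc n) x)"
  using has_pd_s [of k k n] by simp

lemma has_pd_t_self:
  assumes "k \<in> I"
  shows "has_pd k (t k n) (\<lambda>x. - of_nat n * \<alpha> k * t k (Suc n) x)"
proof -
  have "has_pd k (t k n) (\<lambda>x. \<Sum>j\<in>I. of_nat n * \<alpha> k * ((if k = j then 1 else 0) - (if k = k then 1 else 0)) * r k j x ^ Suc n)"
    unfolding t_def using assms by (intro has_pd_sum has_pd_r_power)
  moreover have "(\<Sum>j\<in>I. of_nat n * \<alpha> k * ((if k = j then 1 else 0) - (if k = k then 1 else 0)) * r k j x ^ Suc n)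
      = - of_nat n * \<alpha> k * t k (Suc n) x" for x
    unfolding t_def sum_distrib_left by (rule sum.cong) auto
  ultimately show ?thesis by simp
qed

text \<open>The potential \<open>U\<close> and the coefficients \<open>\<beta>\<close>, \<open>\<gamma>\<close> of the cubic integral \<open>Q\<close> below, each with
  its derivatives. The second- and first-order terms of \<open>[L, Q] = 0\<close> leave no other choice for
  \<open>\<beta>\<close> and \<open>\<gamma>\<close> up to constants. As \<open>r k k = 0\<close> (an instance of \<open>inverse 0 = 0\<close>), all sums run over
  all of \<open>I\<close>.\<close>

definition U :: "'i scalar_fun" where "U = (\<lambda>x. \<kappa> * (\<Sum>k\<in>I. 1 / \<alpha> k ^ 2 * s k 2 x))"
definition U1 :: "'i \<Rightarrow> 'i scalar_fun" where "U1 k = (\<lambda>x. - (4 * \<kappa> / \<alpha> k) * s k 3 x)"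
definition U2 :: "'i \<Rightarrow> 'i scalar_fun" where "U2 k = (\<lambda>x. 12 * \<kappa> * s k 4 x)"
definition U3 :: "'i \<Rightarrow> 'i scalar_fun" where "U3 k = (\<lambda>x. - (48 * \<kappa> * \<alpha> k) * s k 5 x)"

definition \<beta> :: "'i \<Rightarrow> 'i scalar_fun" where "\<beta> k = (\<lambda>x. (3 * \<kappa> / \<alpha> k) * s k 2 x)"
definition \<beta>1 :: "'i \<Rightarrow> 'i \<Rightarrow> 'i scalar_fun" where
  "\<beta>1 k i = (\<lambda>x. (6 * \<kappa> * \<alpha> i / \<alpha> k) * (1 / \<alpha> i ^ 2 * r k i x ^ 3 - (if i = k then s k 3 x else 0)))"
definition \<beta>2 :: "'i \<Rightarrow> 'i \<Rightarrow> 'i scalar_fun" where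
  "\<beta>2 k i = (\<lambda>x. (18 * \<kappa> / \<alpha> k) * (r k i x ^ 4 + (if i = k then \<alpha> k ^ 2 * s k 4 x else 0)))"

definition \<gamma> :: "'i scalar_fun" where "\<gamma> = (\<lambda>x. - (3 * \<kappa>) * (\<Sum>k\<in>I. s k 3 x))"
definition \<gamma>1 :: "'i \<Rightarrow> 'i scalar_fun" where "\<gamma>1 k = (\<lambda>x. 9 * \<kappa> * \<alpha> k * (s k 4 x - 1 / \<alpha> k ^ 2 * t k 4 x))"
definition \<gamma>2 :: "'i \<Rightarrow> 'i scalar_fun" where "\<gamma>2 k = (\<lambda>x. 36 * \<kappa> * (t k 5 x - \<alpha> k ^ 2 * s k 5 x))"

lemma regular_coeffs [intro]:
  shows "U \<in> R" and "k \<in> I \<Longrightarrow> U1 k \<in> R" and "k \<in> I \<Longrightarrow> U2 k \<in> R" and "k \<in> I \<Longrightarrow> U3 k \<in> R"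
    and "k \<in> I \<Longrightarrow> \<beta> k \<in> R" and "k \<in> I \<Longrightarrow> i \<in> I \<Longrightarrow> \<beta>1 k i \<in> R" and "k \<in> I \<Longrightarrow> i \<in> I \<Longrightarrow> \<beta>2 k i \<in> R"
    and "\<gamma> \<in> R" and "k \<in> I \<Longrightarrow> \<gamma>1 k \<in> R" and "k \<in> I \<Longrightarrow> \<gamma>2 k \<in> R"
  unfolding U_def U1_def U2_def U3_def \<beta>_def \<beta>1_def \<beta>2_def \<gamma>_def \<gamma>1_def \<gamma>2_def
  by (intro regular_mult regular_sum regular_add regular_diff regular_power regular_if regular_const
      regular_s regular_t regular_r; assumption)+

lemma sum_r_swap: "k \<in> I \<Longrightarrow> odd n \<Longrightarrow> (\<Sum>j\<in>I. 1 / \<alpha> j ^ 2 * r j k x ^ n) = - s k n x"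
  unfolding s_def by (subst r_swap) (simp add: sum_negf)

lemma has_pd_U: "k \<in> I \<Longrightarrow> has_pd k U (U1 k)"
proof -
  assume k: "k \<in> I"
  let ?d = "\<lambda>j x. of_nat 2 * \<alpha> k * (1 / \<alpha> k ^ 2 * r j k x ^ Suc 2 - (if k = j then s j (Suc 2) x else 0))"
  have "has_pd k U (\<lambda>x. \<kappa> * (\<Sum>j\<in>I. 1 / \<alpha> j ^ 2 * ?d j x))"
    unfolding U_def using k by (intro has_pd_cmult has_pd_sum has_pd_s)
  then show ?thesis
  proof (rule pd_eqI [OF _ k])
    fix x
    have swap: "(\<Sum>j\<in>I. 1 / \<alpha> j ^ 2 * r j k x ^ 3) = - s k 3 x" by (rule sum_r_swap [OF k]) simp
    have "(\<Sum>j\<in>I. 1 / \<alpha> j ^ 2 * ?d j x) =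
      (\<Sum>j\<in>I. (2 / \<alpha> k) * (1 / \<alpha> j ^ 2 * r j k x ^ 3) - (if k = j then 2 / \<alpha> k * s k 3 x else 0))"
      by (rule sum.cong) (use \<alpha>_nz in \<open>auto simp: field_simps power2_eq_square eval_nat_numeral\<close>)
    also have "\<dots> = - (4 / \<alpha> k) * s k 3 x"
      using k finite_I by (simp only: sum_subtractf sum_distrib_left [symmetric] swap) simp
    finally show "\<kappa> * (\<Sum>j\<in>I. 1 / \<alpha> j ^ 2 * ?d j x) = U1 k x" by (simp add: U1_def)
  qed
qed

lemma has_pd_U1: "k \<in> I \<Longrightarrow> has_pd k (U1 k) (U2 k)"
  unfolding U1_def
  by (rule pd_eqI, rule has_pd_cmult, rule has_pd_s_self) (use \<alpha>_nz in \<open>auto simp: U2_def\<close>)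

lemma has_pd_U2: "k \<in> I \<Longrightarrow> has_pd k (U2 k) (U3 k)"
  unfolding U2_def
  by (rule pd_eqI, rule has_pd_cmult, rule has_pd_s_self) (auto simp: U3_def)

lemma has_pd_\<beta>: "k \<in> I \<Longrightarrow> i \<in> I \<Longrightarrow> has_pd i (\<beta> k) (\<beta>1 k i)"
  unfolding \<beta>_def
  by (rule pd_eqI, rule has_pd_cmult, rule has_pd_s) (auto simp: \<beta>1_def eval_nat_numeral)

lemma has_pd_\<beta>1:
  assumes "k \<in> I" "i \<in> I"
  shows "has_pd i (\<beta>1 k i) (\<beta>2 k i)"
proof (cases "i = k")
  case True
  have "has_pd k (\<lambda>x. - (6 * \<kappa>) * s k 3 x) (\<lambda>x. - (6 * \<kappa>) * (- of_nat 3 * \<alpha> k * s k (Suc 3) x))"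
    by (intro has_pd_cmult has_pd_s_self assms)
  then have "has_pd k (\<beta>1 k k) (\<beta>2 k k)"
    by (rule has_pd_transform) (simp_all add: \<beta>1_def \<beta>2_def power2_eq_square assms \<alpha>_nz [OF assms(1)])
  then show ?thesis by (simp add: True)
next
  case False
  have "has_pd i (\<lambda>x. (6 * \<kappa> * \<alpha> i / \<alpha> k) * (1 / \<alpha> i ^ 2 * r k i x ^ 3))
     (\<lambda>x. (6 * \<kappa> * \<alpha> i / \<alpha> k) * (1 / \<alpha> i ^ 2 * (of_nat 3 * \<alpha> i * ((if i = i then 1 else 0) - (if i = k then 1 else 0)) * r k i x ^ Suc 3)))"
    by (intro has_pd_cmult has_pd_r_power assms)
  then show ?thesis
    unfolding \<beta>1_def
    by (rule has_pd_transform)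
      (use False assms \<alpha>_nz in \<open>auto simp: \<beta>2_def power2_eq_square\<close>)
qed

lemma has_pd_\<gamma>:
  assumes "k \<in> I"
  shows "has_pd k \<gamma> (\<gamma>1 k)"
proof -
  let ?d = "\<lambda>j x. of_nat 3 * \<alpha> k * (1 / \<alpha> k ^ 2 * r j k x ^ Suc 3 - (if k = j then s j (Suc 3) x else 0))"
  have "has_pd k \<gamma> (\<lambda>x. - (3 * \<kappa>) * (\<Sum>j\<in>I. ?d j x))"
    unfolding \<gamma>_def using assms by (intro has_pd_cmult has_pd_sum has_pd_s)
  then show ?thesis
  proof (rule pd_eqI [OF _ assms])
    fix x
    have "(\<Sum>j\<in>I. ?d j x) = (\<Sum>j\<in>I. 3 * \<alpha> k * (1 / \<alpha> k ^ 2 * r k j x ^ 4) - (if k = j then 3 * \<alpha> k * s k 4 x else 0))"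
      by (rule sum.cong [OF refl], subst r_swap) (auto simp: algebra_simps)
    also have "\<dots> = 3 * \<alpha> k * (1 / \<alpha> k ^ 2 * t k 4 x - s k 4 x)"
      using assms finite_I by (simp only: sum_subtractf sum_distrib_left [symmetric] t_def) (simp add: algebra_simps)
    finally have sum: "(\<Sum>j\<in>I. ?d j x) = 3 * \<alpha> k * (1 / \<alpha> k ^ 2 * t k 4 x - s k 4 x)" .
    show "- (3 * \<kappa>) * (\<Sum>j\<in>I. ?d j x) = \<gamma>1 k x" unfolding sum by (simp add: \<gamma>1_def algebra_simps)
  qed
qed

lemma has_pd_\<gamma>1:
  assumes "k \<in> I"
  shows "has_pd k (\<gamma>1 k) (\<gamma>2 k)"
proof -
  have "has_pd k (\<lambda>x. 9 * \<kappa> * \<alpha> k * (s k 4 x + - (1 / \<alpha> k ^ 2) * t k 4 x))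
    (\<lambda>x. 9 * \<kappa> * \<alpha> k * (- of_nat 4 * \<alpha> k * s k (Suc 4) x + - (1 / \<alpha> k ^ 2) * (- of_nat 4 * \<alpha> k * t k (Suc 4) x)))"
    by (intro has_pd_cmult has_pd_add has_pd_s_self has_pd_t_self assms)
  then show ?thesis
    unfolding \<gamma>1_def
    by (rule has_pd_transform)
      (use assms \<alpha>_nz in \<open>auto simp: \<gamma>2_def power2_eq_square algebra_simps\<close>)
qed

section \<open>The coefficients of \<open>[L, Q]\<close>, order by order\<close>

lemma second_order_coeff:
  "k \<in> I \<Longrightarrow> i \<in> I \<Longrightarrow> 2 * \<beta>1 k i x =
    12 * \<kappa> / (\<alpha> k * \<alpha> i) * r k i x ^ 3 + (if i = k then 3 * \<alpha> k * U1 k x else 0)"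
  using \<alpha>_nz by (auto simp: \<beta>1_def U1_def field_simps power2_eq_square)

lemma first_order_coeff:
  assumes "k \<in> I"
  shows "(\<Sum>i\<in>I. \<beta>2 k i x) + 2 * \<gamma>1 k x - 3 * \<alpha> k * U2 k x = 0"
proof -
  have "(\<Sum>i\<in>I. \<beta>2 k i x) = 18 * \<kappa> / \<alpha> k * (t k 4 x + \<alpha> k ^ 2 * s k 4 x)"
    using assms finite_I unfolding \<beta>2_def sum_distrib_left [symmetric] by (simp add: sum.distrib t_def)
  then show ?thesis using \<alpha>_nz [OF assms]
    by (simp add: \<gamma>1_def U2_def field_simps power2_eq_square)
qed

text \<open>The reciprocals of \<open>r k j\<close>, \<open>r j l\<close>, \<open>r l k\<close> add up to zero, so the second elementary
  symmetric polynomial of these three functions vanishes; it divides the symmetrized summand.\<close>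

lemma three_body:
  assumes "x \<in> reg"
  shows "(\<Sum>k\<in>I. \<Sum>j\<in>I. \<Sum>l\<in>I. if j = l then 0 else w k * w j * w l * r k j x ^ 2 * r k l x ^ 3) = 0"
    (is "(\<Sum>k\<in>I. \<Sum>j\<in>I. \<Sum>l\<in>I. ?g k j l) = 0")
proof -
  let ?S = "\<lambda>f. (\<Sum>k\<in>I. \<Sum>j\<in>I. \<Sum>l\<in>I. f k j l) :: complex"
  \<comment> \<open>Renaming the summation indices does not change the sum, so six times the sum is
    the sum of the symmetrized summand.\<close>
  have swap1: "?S (\<lambda>k j l. f j k l) = ?S f" for f by (rule sum.swap)
  have swap2: "?S (\<lambda>k j l. f k l j) = ?S f" for f by (rule sum.cong [OF refl], rule sum.swap)
  have p1: "?S (\<lambda>k j l. ?g k l j) = ?S ?g" by (rule swap2)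
  have p2: "?S (\<lambda>k j l. ?g j k l) = ?S ?g" by (rule swap1)
  have p3: "?S (\<lambda>k j l. ?g j l k) = ?S ?g"
    using swap1 [of "\<lambda>k j l. ?g k l j"] p1 by simp
  have p4: "?S (\<lambda>k j l. ?g l k j) = ?S ?g"
    using swap2 [of "\<lambda>k j l. ?g j k l"] p2 by simp
  have p5: "?S (\<lambda>k j l. ?g l j k) = ?S ?g"
    using swap1 [of "\<lambda>k j l. ?g l k j"] p4 by simp
  have "?g k j l + ?g k l j + ?g j k l + ?g j l k + ?g l k j + ?g l j k = 0"
    if I: "k \<in> I" "j \<in> I" "l \<in> I" for k j l
  proof (cases "k = j \<or> j = l \<or> k = l")
    case True
    then show ?thesis by auto
  next
    case False
    define A B C where "A = r k j x" and "B = r j l x" and "C = r l k x"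
    have rs: "r k j x = A" "r j k x = - A" "r j l x = B" "r l j x = - B" "r l k x = C" "r k l x = - C"
      by (simp_all add: A_def B_def C_def r_swap [of j k] r_swap [of l j] r_swap [of k l])
    have "A * B + B * C + C * A = 0"
      unfolding A_def B_def C_def r_def
      by (rule inverse_cyclic) (use reg_distinct [OF assms] I False in auto)
    then have "A ^ 2 * C ^ 2 * (A - C) + A ^ 2 * B ^ 2 * (B - A) + B ^ 2 * C ^ 2 * (C - B) = 0"
      by algebra
    then have "w k * w j * w l * (A ^ 2 * C ^ 2 * (A - C) + A ^ 2 * B ^ 2 * (B - A) + B ^ 2 * C ^ 2 * (C - B)) = 0"
      by simp
    moreover have "k \<noteq> j" "j \<noteq> k" "j \<noteq> l" "l \<noteq> j" "k \<noteq> l" "l \<noteq> k" using False by auto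
    ultimately show ?thesis unfolding rs
      by (simp add: algebra_simps power2_eq_square power3_eq_cube)
  qed
  then have "?S (\<lambda>k j l. ?g k j l + ?g k l j + ?g j k l + ?g j l k + ?g l k j + ?g l j k) = 0"
    by (intro sum.neutral ballI) blast
  moreover have "?S (\<lambda>k j l. ?g k j l + ?g k l j + ?g j k l + ?g j l k + ?g l k j + ?g l j k) =
      ?S ?g + ?S (\<lambda>k j l. ?g k l j) + ?S (\<lambda>k j l. ?g j k l) + ?S (\<lambda>k j l. ?g j l k)
      + ?S (\<lambda>k j l. ?g l k j) + ?S (\<lambda>k j l. ?g l j k)"
    by (simp only: sum.distrib)
  ultimately show ?thesis unfolding p1 p2 p3 p4 p5 by simp
qed

text \<open>For \<open>p = \<alpha> i ^ 2\<close> and \<open>q = \<alpha> j ^ 2\<close> the two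
  sides differ by \<open>(p - q) * (p * q * (p + q) + \<kappa>) / (p ^ 2 * q ^ 2)\<close>. This is
  the one place where \<open>\<kappa>_rel\<close> enters.\<close>

lemma two_body:
  assumes "i \<in> I" "j \<in> I"
  shows "\<alpha> i ^ 2 / \<alpha> j ^ 2 + \<kappa> / (\<alpha> i ^ 2 * \<alpha> j ^ 4) = \<alpha> j ^ 2 / \<alpha> i ^ 2 + \<kappa> / (\<alpha> j ^ 2 * \<alpha> i ^ 4)"
proof -
  define p q where "p = \<alpha> i ^ 2" and "q = \<alpha> j ^ 2"
  have nz: "p \<noteq> 0" "q \<noteq> 0" using \<alpha>_nz assms by (auto simp: p_def q_def)
  have rel: "p = q \<or> p * q * (p + q) = - \<kappa>" using \<kappa>_rel [OF assms] by (simp add: p_def q_def)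
  have "p / q + \<kappa> / (p * q ^ 2) = q / p + \<kappa> / (q * p ^ 2)"
  proof (cases "p = q")
    case False
    then have k: "\<kappa> = - (p * q * (p + q))" using rel by simp
    show ?thesis unfolding k using nz by (simp add: field_simps power2_eq_square)
  qed simp
  then show ?thesis by (simp add: p_def q_def flip: power_mult)
qed

text \<open>The sums \<open>t k 5\<close> cancel by oddness. In the products of \<open>s k 2\<close>
  and \<open>s k 3\<close> the terms with three distinct particles cancel by
  \<open>three_body\<close>; what remains, together with the \<open>s k 5\<close>, is antisymmetric
  by \<open>two_body\<close>.\<close>

lemma zero_order_coeff:
  assumes "x \<in> reg"
  shows "(\<Sum>k\<in>I. \<gamma>2 k x) - (\<Sum>k\<in>I. \<alpha> k * U3 k x) - (\<Sum>k\<in>I. \<beta> k x * U1 k x) = 0"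
proof -
  have t: "(\<Sum>k\<in>I. t k 5 x) = 0"
    unfolding t_def by (rule sum_antisym) (subst r_swap, simp)
  define w where "w = (\<lambda>k. 1 / \<alpha> k ^ 2)"
  have "(\<Sum>k\<in>I. w k * s k 2 x * s k 3 x) = (\<Sum>k\<in>I. \<Sum>j\<in>I. \<Sum>l\<in>I. w k * w j * w l * r k j x ^ 2 * r k l x ^ 3)"
    unfolding s_def mult.assoc sum_product
    unfolding sum_distrib_left by (intro sum.cong refl) (simp add: w_def)
  \<comment> \<open>The diagonal \<open>j = l\<close> gives the two-particle terms of degree
    5.\<close>
  also have "\<dots> = (\<Sum>k\<in>I. \<Sum>j\<in>I. \<Sum>l\<in>I. (if j = l then w k * w j ^ 2 * r k j x ^ 5 else 0) +
      (if j = l then 0 else w k * w j * w l * r k j x ^ 2 * r k l x ^ 3))"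
    by (intro sum.cong refl) (auto simp: power2_eq_square eval_nat_numeral)
  also have "\<dots> = (\<Sum>k\<in>I. \<Sum>j\<in>I. w k * w j ^ 2 * r k j x ^ 5)"
    using finite_I by (simp add: sum.distrib three_body [OF assms])
  finally have 3: "(\<Sum>k\<in>I. w k * s k 2 x * s k 3 x) = (\<Sum>k\<in>I. \<Sum>j\<in>I. w k * w j ^ 2 * r k j x ^ 5)" .
  have "(\<Sum>k\<in>I. \<alpha> k ^ 2 * s k 5 x) + \<kappa> * (\<Sum>k\<in>I. w k * s k 2 x * s k 3 x)
      = (\<Sum>k\<in>I. \<Sum>j\<in>I. (\<alpha> k ^ 2 / \<alpha> j ^ 2 + \<kappa> / (\<alpha> k ^ 2 * \<alpha> j ^ 4)) * r k j x ^ 5)"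
    unfolding 3 unfolding s_def sum_distrib_left sum.distrib [symmetric]
    by (intro sum.cong refl) (auto simp: w_def algebra_simps power_divide simp flip: power_mult)
  also have "\<dots> = 0"
  proof (rule sum_antisym)
    fix i j assume "i \<in> I" "j \<in> I"
    note c = two_body [OF this]
    have "r j i x ^ 5 = - (r i j x ^ 5)" by (subst r_swap) simp
    then show "(\<alpha> j ^ 2 / \<alpha> i ^ 2 + \<kappa> / (\<alpha> j ^ 2 * \<alpha> i ^ 4)) * r j i x ^ 5 =
        - ((\<alpha> i ^ 2 / \<alpha> j ^ 2 + \<kappa> / (\<alpha> i ^ 2 * \<alpha> j ^ 4)) * r i j x ^ 5)"
      unfolding c by simp
  qed
  finally have 2: "(\<Sum>k\<in>I. \<alpha> k ^ 2 * s k 5 x) + \<kappa> * (\<Sum>k\<in>I. w k * s k 2 x * s k 3 x) = 0" .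
  have "(\<Sum>k\<in>I. \<gamma>2 k x) - (\<Sum>k\<in>I. \<alpha> k * U3 k x) - (\<Sum>k\<in>I. \<beta> k x * U1 k x) =
    36 * \<kappa> * (\<Sum>k\<in>I. t k 5 x) + 12 * \<kappa> * ((\<Sum>k\<in>I. \<alpha> k ^ 2 * s k 5 x) + \<kappa> * (\<Sum>k\<in>I. w k * s k 2 x * s k 3 x))"
    unfolding sum_distrib_left sum.distrib [symmetric] sum_subtractf [symmetric]
    by (intro sum.cong refl)
      (use \<alpha>_nz in \<open>auto simp: \<gamma>2_def U3_def \<beta>_def U1_def w_def field_simps power2_eq_square\<close>)
  then show ?thesis using t 2 by simp
qed

section \<open>The operators \<open>L\<close> and \<open>Q\<close> and their commutator\<close>

definition L :: "'i lop" where
  "L = (\<Sum>k\<in>I. dop k * dop k) + mop U"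

text \<open>The leading coefficients \<open>\<alpha> k\<close> make \<open>p 3\<close> the principal
  symbol of \<open>Q\<close>, which is why \<open>p 3\<close> can be recovered from \<open>Q\<close>
  in \<open>ad_p2_pow_Q\<close>.\<close>

definition Q :: "'i lop" where
  "Q = (\<Sum>k\<in>I. mop (\<lambda>_. \<alpha> k) * (dop k * dop k * dop k) + mop (\<beta> k) * dop k) + mop \<gamma>"

lemma ad_dop2_mop:
  assumes "k \<in> I" "f \<in> R" "has_pd k f f1" "has_pd k f1 f2"
  shows "ad (dop k * dop k) (mop f) = mop (\<lambda>x. 2 * f1 x) * dop k + mop f2"
proof -
  have f1: "f1 \<in> R" using has_pd_regular assms by blast
  show ?thesis
    by (simp add: ad_mult_left ad_dop_mop [OF assms(1-3)] dop_mop [OF assms(1) f1 assms(4)] mop_2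
        scaleR_2 distrib_right)
qed

lemma ad_L_mop:
  assumes "f \<in> R" "\<And>i. i \<in> I \<Longrightarrow> has_pd i f (f1 i)" "\<And>i. i \<in> I \<Longrightarrow> has_pd i (f1 i) (f2 i)"
  shows "ad L (mop f) = (\<Sum>i\<in>I. mop (\<lambda>x. 2 * f1 i x) * dop i + mop (f2 i))"
proof -
  have "ad (\<Sum>i\<in>I. dop i * dop i) (mop f) = (\<Sum>i\<in>I. mop (\<lambda>x. 2 * f1 i x) * dop i + mop (f2 i))"
    unfolding ad_sum_left using assms by (intro sum.cong refl ad_dop2_mop) auto
  then show ?thesis by (simp add: L_def ad_add_left ad_mop_mop regular_coeffs(1) assms(1))
qed

lemma ad_L_dop:
  assumes "k \<in> I"
  shows "ad L (dop k) = - mop (U1 k)"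
proof -
  have "ad (mop U) (dop k) = - mop (U1 k)"
    using ad_dop_mop [OF assms regular_coeffs(1) has_pd_U [OF assms]] ad_swap [of "mop U" "dop k"] by simp
  moreover have "ad (\<Sum>i\<in>I. dop i * dop i) (dop k) = 0"
    unfolding ad_sum_left by (rule sum.neutral) (simp add: ad_mult_left ad_dop_dop assms)
  ultimately show ?thesis by (simp add: L_def ad_add_left)
qed

lemma ad_L_const: "ad L (mop (\<lambda>_. c)) = 0"
  by (subst ad_L_mop [where ?f1.0 = "\<lambda>_ _. 0" and ?f2.0 = "\<lambda>_ _. 0"]) (auto simp: has_pd_const mop_zero)

lemma ad_L_dop3:
  assumes k: "k \<in> I"
  shows "ad L (dop k * dop k * dop k) =
    - (3 *\<^sub>R (mop (U1 k) * dop k * dop k) + 3 *\<^sub>R (mop (U2 k) * dop k) + mop (U3 k))"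
proof -
  have 1: "dop k * mop (U1 k) = mop (U1 k) * dop k + mop (U2 k)"
    using k by (intro dop_mop has_pd_U1) auto
  have 2: "dop k * mop (U2 k) = mop (U2 k) * dop k + mop (U3 k)"
    using k by (intro dop_mop has_pd_U2) auto
  have "ad L (dop k * dop k * dop k) =
    - (mop (U1 k) * dop k * dop k + dop k * mop (U1 k) * dop k + dop k * (dop k * mop (U1 k)))"
    by (simp add: ad_mult ad_L_dop k algebra_simps)
  also have "\<dots> = - ((mop (U1 k) * dop k * dop k + mop (U1 k) * dop k * dop k + mop (U1 k) * dop k * dop k)
      + (mop (U2 k) * dop k + mop (U2 k) * dop k + mop (U2 k) * dop k) + mop (U3 k))"
    by (simp add: 1 2 distrib_left distrib_right mult.assoc [symmetric])
  also have "\<dots> = - (3 *\<^sub>R (mop (U1 k) * dop k * dop k) + 3 *\<^sub>R (mop (U2 k) * dop k) + mop (U3 k))"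
    by (simp add: scaleR_left.add [of 1 2, simplified] scaleR_2 add.assoc)
  finally show ?thesis .
qed

text \<open>The second-order coefficients off the diagonal are antisymmetric, whereas the second
  derivatives are symmetric.\<close>

lemma ad_L_Q: "ad L Q = 0"
proof -
  have \<beta>: "ad L (mop (\<beta> k)) = (\<Sum>i\<in>I. mop (\<lambda>x. 2 * \<beta>1 k i x) * dop i + mop (\<beta>2 k i))" if "k \<in> I" for k
    using that by (intro ad_L_mop has_pd_\<beta> has_pd_\<beta>1) auto
  have \<gamma>: "ad L (mop \<gamma>) = (\<Sum>k\<in>I. mop (\<lambda>x. 2 * \<gamma>1 k x) * dop k + mop (\<gamma>2 k))"
    by (intro ad_L_mop has_pd_\<gamma> has_pd_\<gamma>1) auto
  have \<alpha>f: "mop (\<lambda>_. \<alpha> k) * mop f = mop (\<lambda>x. \<alpha> k * f x)" if "f \<in> R" for k f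
    using that by (simp add: mop_mult)
  have 3: "mop (\<lambda>_. \<alpha> k) * (3 *\<^sub>R (mop f * T)) = mop (\<lambda>x. 3 * \<alpha> k * f x) * T" if "f \<in> R" for k f T
    using that mop_scaleR [of 3 "\<lambda>x. \<alpha> k * f x"] by (simp add: mult.assoc [symmetric] \<alpha>f)
  have summand: "ad L (mop (\<lambda>_. \<alpha> k) * (dop k * dop k * dop k) + mop (\<beta> k) * dop k) =
      (\<Sum>i\<in>I. mop (\<lambda>x. 2 * \<beta>1 k i x) * dop i * dop k) + mop (\<lambda>x. \<Sum>i\<in>I. \<beta>2 k i x) * dop k
      - mop (\<lambda>x. 3 * \<alpha> k * U1 k x) * dop k * dop k - mop (\<lambda>x. 3 * \<alpha> k * U2 k x) * dop k
      - mop (\<lambda>x. \<alpha> k * U3 k x) - mop (\<lambda>x. \<beta> k x * U1 k x)" if k: "k \<in> I" for k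
  proof -
    have "ad L (mop (\<lambda>_. \<alpha> k) * (dop k * dop k * dop k)) =
        - (mop (\<lambda>x. 3 * \<alpha> k * U1 k x) * dop k * dop k + mop (\<lambda>x. 3 * \<alpha> k * U2 k x) * dop k + mop (\<lambda>x. \<alpha> k * U3 k x))"
    proof -
      have 3: "mop (\<lambda>_. \<alpha> k) * (3 *\<^sub>R (mop (U1 k) * dop k * dop k)) = mop (\<lambda>x. 3 * \<alpha> k * U1 k x) * dop k * dop k"
        "mop (\<lambda>_. \<alpha> k) * (3 *\<^sub>R (mop (U2 k) * dop k)) = mop (\<lambda>x. 3 * \<alpha> k * U2 k x) * dop k"
        using 3 [OF regular_coeffs(2) [OF k], of k "dop k * dop k"] 3 [OF regular_coeffs(3) [OF k], of k "dop k"]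
        by (simp_all only: mult.assoc)
      have "ad L (mop (\<lambda>_. \<alpha> k) * (dop k * dop k * dop k)) = mop (\<lambda>_. \<alpha> k) * ad L (dop k * dop k * dop k)"
        by (simp add: ad_mult [of _ "mop (\<lambda>_. \<alpha> k)"] ad_L_const)
      then show ?thesis
        by (simp only: ad_L_dop3 [OF k] mult_minus_right distrib_left 3 \<alpha>f [OF regular_coeffs(4) [OF k]])
    qed
    moreover have "ad L (mop (\<beta> k) * dop k) =
        (\<Sum>i\<in>I. mop (\<lambda>x. 2 * \<beta>1 k i x) * dop i * dop k) + mop (\<lambda>x. \<Sum>i\<in>I. \<beta>2 k i x) * dop k
        - mop (\<lambda>x. \<beta> k x * U1 k x)"
      using k by (simp add: ad_mult \<beta> ad_L_dop mop_mult regular_coeffs sum_distrib_right distrib_right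
          sum.distrib mop_sum)
    ultimately show ?thesis by (simp add: ad_add_right algebra_simps)
  qed
  \<comment> \<open>Collected by order: the second-, first- and zeroth-order parts are shown to
    vanish separately.\<close>
  have "ad L Q =
      ((\<Sum>k\<in>I. \<Sum>i\<in>I. mop (\<lambda>x. 2 * \<beta>1 k i x) * dop i * dop k) - (\<Sum>k\<in>I. mop (\<lambda>x. 3 * \<alpha> k * U1 k x) * dop k * dop k))
    + (\<Sum>k\<in>I. mop (\<lambda>x. (\<Sum>i\<in>I. \<beta>2 k i x) + 2 * \<gamma>1 k x - 3 * \<alpha> k * U2 k x) * dop k)
    + mop (\<lambda>x. (\<Sum>k\<in>I. \<gamma>2 k x) - (\<Sum>k\<in>I. \<alpha> k * U3 k x) - (\<Sum>k\<in>I. \<beta> k x * U1 k x))"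
    unfolding Q_def ad_add_right [of _ _ "mop \<gamma>"] ad_sum_right \<gamma> mop_diff mop_add mop_sum
    by (simp add: summand [unfolded mop_sum] sum.distrib sum_subtractf distrib_right left_diff_distrib mop_diff mop_add mop_sum cong: sum.cong)
  also have "(\<Sum>k\<in>I. \<Sum>i\<in>I. mop (\<lambda>x. 2 * \<beta>1 k i x) * dop i * dop k) =
      (\<Sum>k\<in>I. \<Sum>i\<in>I. mop (\<lambda>x. 12 * \<kappa> / (\<alpha> k * \<alpha> i) * r k i x ^ 3) * (dop i * dop k)
        + (if i = k then mop (\<lambda>x. 3 * \<alpha> k * U1 k x) * dop k * dop k else 0))"
  proof (intro sum.cong refl)
    fix k i assume "k \<in> I" "i \<in> I"
    then have "mop (\<lambda>x. 2 * \<beta>1 k i x) = mop (\<lambda>x. 12 * \<kappa> / (\<alpha> k * \<alpha> i) * r k i x ^ 3)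
        + mop (\<lambda>x. if i = k then 3 * \<alpha> k * U1 k x else 0)"
      unfolding mop_add [symmetric] by (intro mop_cong second_order_coeff)
    then show "mop (\<lambda>x. 2 * \<beta>1 k i x) * dop i * dop k = mop (\<lambda>x. 12 * \<kappa> / (\<alpha> k * \<alpha> i) * r k i x ^ 3) * (dop i * dop k)
        + (if i = k then mop (\<lambda>x. 3 * \<alpha> k * U1 k x) * dop k * dop k else 0)"
      by (simp add: distrib_right mult.assoc mop_zero)
  qed
  also have "\<dots> = (\<Sum>k\<in>I. \<Sum>i\<in>I. mop (\<lambda>x. 12 * \<kappa> / (\<alpha> k * \<alpha> i) * r k i x ^ 3) * (dop i * dop k))
      + (\<Sum>k\<in>I. mop (\<lambda>x. 3 * \<alpha> k * U1 k x) * dop k * dop k)"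
    using finite_I by (simp add: sum.distrib)
  also have "(\<Sum>k\<in>I. \<Sum>i\<in>I. mop (\<lambda>x. 12 * \<kappa> / (\<alpha> k * \<alpha> i) * r k i x ^ 3) * (dop i * dop k)) = 0"
  proof (rule sum_antisym)
    fix k i assume ki: "k \<in> I" "i \<in> I"
    have "dop k * dop i = dop i * dop k" using ad_dop_dop [OF ki] by (simp add: ad_eq_0_iff)
    moreover have "(\<lambda>x. 12 * \<kappa> / (\<alpha> i * \<alpha> k) * r i k x ^ 3) = (\<lambda>x. 0 - 12 * \<kappa> / (\<alpha> k * \<alpha> i) * r k i x ^ 3)"
      by (subst r_swap) (simp add: mult.commute)
    ultimately show "mop (\<lambda>x. 12 * \<kappa> / (\<alpha> i * \<alpha> k) * r i k x ^ 3) * (dop k * dop i)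
        = - (mop (\<lambda>x. 12 * \<kappa> / (\<alpha> k * \<alpha> i) * r k i x ^ 3) * (dop i * dop k))"
      by (simp only: mop_diff mop_zero) simp
  qed
  also have "(\<Sum>k\<in>I. mop (\<lambda>x. (\<Sum>i\<in>I. \<beta>2 k i x) + 2 * \<gamma>1 k x - 3 * \<alpha> k * U2 k x) * dop k) = 0"
    by (intro sum.neutral ballI) (simp only: first_order_coeff mop_zero mult_zero_left)
  also have "mop (\<lambda>x. (\<Sum>k\<in>I. \<gamma>2 k x) - (\<Sum>k\<in>I. \<alpha> k * U3 k x) - (\<Sum>k\<in>I. \<beta> k x * U1 k x)) = mop (\<lambda>x. 0)"
    by (rule mop_cong) (rule zero_order_coeff)
  finally show ?thesis by (simp add: mop_zero)
qed

subsection \<open>The action of \<open>sl\<^sub>2\<close>\<close>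

definition p :: "nat \<Rightarrow> 'i scalar_fun" where
  "p d = (\<lambda>x. \<Sum>k\<in>I. \<alpha> k powi (int d - 2) * x k ^ d)"

lemma regular_p [intro]: "p d \<in> R"
  unfolding p_def by (intro regular_sum regular_mult regular_const regular_power regular_coord)

lemma has_pd_p:
  assumes "i \<in> I"
  shows "has_pd i (p d) (\<lambda>x. of_nat d * \<alpha> i powi (int d - 2) * x i ^ (d - 1))"
proof -
  have "has_pd i (p d) (\<lambda>x. \<Sum>k\<in>I. \<alpha> k powi (int d - 2) * (of_nat d * (if k = i then 1 else 0) * x k ^ (d - 1)))"
    unfolding p_def by (intro has_pd_sum has_pd_cmult has_pd_power has_pd_coord)
  moreover have "(\<Sum>k\<in>I. \<alpha> k powi (int d - 2) * (of_nat d * (if k = i then 1 else 0) * x k ^ (d - 1)))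
      = of_nat d * \<alpha> i powi (int d - 2) * x i ^ (d - 1)" for x
  proof -
    have "(\<Sum>k\<in>I. \<alpha> k powi (int d - 2) * (of_nat d * (if k = i then 1 else 0) * x k ^ (d - 1)))
      = (\<Sum>k\<in>I. if k = i then of_nat d * \<alpha> i powi (int d - 2) * x i ^ (d - 1) else 0)"
      by (rule sum.cong) auto
    then show ?thesis using assms finite_I by simp
  qed
  ultimately show ?thesis by simp
qed

lemma has_pd_p_twice:
  assumes "i \<in> I"
  shows "has_pd i (\<lambda>x. of_nat d * \<alpha> i powi (int d - 2) * x i ^ (d - 1))
    (\<lambda>x. of_nat (d * (d - 1)) * \<alpha> i powi (int d - 2) * x i ^ (d - 2))"
proof -
  have "has_pd i (\<lambda>x. of_nat d * \<alpha> i powi (int d - 2) * x i ^ (d - 1))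
    (\<lambda>x. of_nat d * \<alpha> i powi (int d - 2) * (of_nat (d - 1) * (if i = i then 1 else 0) * x i ^ (d - 1 - 1)))"
    by (intro has_pd_cmult has_pd_power has_pd_coord)
  then show ?thesis
    by (rule pd_eqI [OF _ assms]) (cases d, simp_all add: numeral_2_eq_2 algebra_simps)
qed

text \<open>Four times the Euler vector field plus a constant, so \<open>ad h\<close> measures
  degrees of homogeneity.\<close>

definition h :: "'i lop" where
  "h = (\<Sum>i\<in>I. mop (\<lambda>x. 4 * x i) * dop i + mop (\<lambda>_. 2))"

lemma ad_L_p2: "ad L (mop (p 2)) = h"
proof -
  have "ad L (mop (p 2)) = (\<Sum>i\<in>I. mop (\<lambda>x. 2 * (of_nat 2 * \<alpha> i powi (int 2 - 2) * x i ^ (2 - 1))) * dop i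
      + mop (\<lambda>x. of_nat (2 * (2 - 1)) * \<alpha> i powi (int 2 - 2) * x i ^ (2 - 2)))"
    by (rule ad_L_mop [OF _ has_pd_p has_pd_p_twice]) auto
  then show ?thesis by (simp add: h_def)
qed

text \<open>Euler's identity is taken as the definition, since this is exactly what
  \<open>ad h\<close> sees of a function.\<close>

definition homogeneous :: "real \<Rightarrow> 'i scalar_fun \<Rightarrow> bool" where
  "homogeneous n f \<longleftrightarrow> f \<in> R \<and> (\<exists>f'. (\<forall>k\<in>I. has_pd k f (f' k)) \<and>
     (\<forall>x\<in>reg. (\<Sum>k\<in>I. x k * f' k x) = of_real n * f x))"

lemma homogeneous_const: "homogeneous 0 (\<lambda>_. c)"
  unfolding homogeneous_def by (intro conjI exI [of _ "\<lambda>_ _. 0"]) (auto simp: has_pd_const)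

lemma homogeneous_coord: "i \<in> I \<Longrightarrow> homogeneous 1 (\<lambda>x. x i)"
  unfolding homogeneous_def
  by (intro conjI exI [of _ "\<lambda>k _. if i = k then 1 else 0"]) 
    (auto simp: has_pd_coord finite_I if_distrib [of "times _"] cong: if_cong)

lemma homogeneous_add: "homogeneous n f \<Longrightarrow> homogeneous n g \<Longrightarrow> homogeneous n (\<lambda>x. f x + g x)"
proof -
  assume "homogeneous n f" "homogeneous n g"
  then obtain f' g' where *: "f \<in> R" "g \<in> R" "\<forall>k\<in>I. has_pd k f (f' k)" "\<forall>k\<in>I. has_pd k g (g' k)"
    "\<forall>x\<in>reg. (\<Sum>k\<in>I. x k * f' k x) = of_real n * f x" "\<forall>x\<in>reg. (\<Sum>k\<in>I. x k * g' k x) = of_real n * g x"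
    unfolding homogeneous_def by blast
  show ?thesis
    unfolding homogeneous_def using *
    by (intro conjI exI [of _ "\<lambda>k x. f' k x + g' k x"]) (auto simp: has_pd_add distrib_left sum.distrib)
qed

lemma homogeneous_mult: "homogeneous n f \<Longrightarrow> homogeneous m g \<Longrightarrow> homogeneous (n + m) (\<lambda>x. f x * g x)"
proof -
  assume "homogeneous n f" "homogeneous m g"
  then obtain f' g' where *: "f \<in> R" "g \<in> R" "\<forall>k\<in>I. has_pd k f (f' k)" "\<forall>k\<in>I. has_pd k g (g' k)"
    "\<forall>x\<in>reg. (\<Sum>k\<in>I. x k * f' k x) = of_real n * f x" "\<forall>x\<in>reg. (\<Sum>k\<in>I. x k * g' k x) = of_real m * g x"
    unfolding homogeneous_def by blast
  have "(\<Sum>k\<in>I. x k * (f' k x * g x + f x * g' k x)) = of_real (n + m) * (f x * g x)" if "x \<in> reg" for x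
  proof -
    have "(\<Sum>k\<in>I. x k * (f' k x * g x + f x * g' k x)) = (\<Sum>k\<in>I. x k * f' k x) * g x + f x * (\<Sum>k\<in>I. x k * g' k x)"
      unfolding sum_distrib_left sum_distrib_right sum.distrib [symmetric]
      by (rule sum.cong) (auto simp: algebra_simps)
    then show ?thesis using * that by (simp add: algebra_simps)
  qed
  then show ?thesis
    unfolding homogeneous_def using *
    by (intro conjI exI [of _ "\<lambda>k x. f' k x * g x + f x * g' k x"]) (auto simp: has_pd_mult)
qed

lemma homogeneous_cmult: "homogeneous n f \<Longrightarrow> homogeneous n (\<lambda>x. c * f x)"
  using homogeneous_mult [OF homogeneous_const] by simp

lemma homogeneous_power: "homogeneous n f \<Longrightarrow> homogeneous (real m * n) (\<lambda>x. f x ^ m)"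
proof (induction m)
  case 0
  show ?case using homogeneous_const [of 1] by simp
next
  case (Suc m)
  have "homogeneous (n + real m * n) (\<lambda>x. f x * f x ^ m)" by (intro homogeneous_mult Suc)
  moreover have "n + real m * n = real (Suc m) * n" by (simp add: algebra_simps)
  ultimately show ?case by simp
qed

lemma homogeneous_sum:
  "(\<And>a. a \<in> A \<Longrightarrow> homogeneous n (f a)) \<Longrightarrow> homogeneous n (\<lambda>x. \<Sum>a\<in>A. f a x)"
proof (induction A rule: infinite_finite_induct)
  case (insert a A)
  then show ?case using homogeneous_add [of n "f a"] by simp
qed (use homogeneous_cmult [of n _ 0] in \<open>auto simp: homogeneous_def has_pd_const intro!: exI [of _ "\<lambda>_ _. 0"]\<close>)

lemma homogeneous_r:
  assumes "i \<in> I" "j \<in> I"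
  shows "homogeneous (- 1) (r i j)"
  unfolding homogeneous_def
proof (intro conjI exI ballI)
  fix x assume x: "x \<in> reg"
  have "(\<Sum>k\<in>I. x k * (\<alpha> k * ((if k = j then 1 else 0) - (if k = i then 1 else 0)) * r i j x ^ 2)) =
      (\<Sum>k\<in>I. (if k = j then \<alpha> j * x j * r i j x ^ 2 else 0) - (if k = i then \<alpha> i * x i * r i j x ^ 2 else 0))"
    by (rule sum.cong) (auto simp: algebra_simps)
  also have "\<dots> = (\<alpha> j * x j - \<alpha> i * x i) * r i j x ^ 2"
    using assms finite_I by (simp add: sum_subtractf algebra_simps)
  also have "\<dots> = of_real (- 1) * r i j x"
  proof (cases "i = j")
    case False
    then have e: "\<alpha> i * x i - \<alpha> j * x j \<noteq> 0" using reg_distinct [OF x assms] by simp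
    have "- e * inverse e ^ 2 = - inverse e" if "e \<noteq> 0" for e :: complex
      using that by (simp add: power2_eq_square)
    from this [OF e] show ?thesis by (simp add: r_def)
  qed simp
  finally show "(\<Sum>k\<in>I. x k * (\<alpha> k * ((if k = j then 1 else 0) - (if k = i then 1 else 0)) * r i j x ^ 2)) =
      of_real (- 1) * r i j x" .
qed (use assms has_pd_r in auto)

lemma homogeneous_s: "k \<in> I \<Longrightarrow> homogeneous (- real n) (s k n)"
  unfolding s_def using homogeneous_power [OF homogeneous_r, of k _ n]
  by (intro homogeneous_sum homogeneous_cmult) simp

lemma homogeneous_p: "homogeneous (real d) (p d)"
  unfolding p_def using homogeneous_power [OF homogeneous_coord, of _ d]
  by (intro homogeneous_sum homogeneous_cmult) simp

lemma ad_h_mop: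
  assumes "homogeneous n f"
  shows "ad h (mop f) = (4 * n) *\<^sub>R mop f"
proof -
  obtain f' where *: "f \<in> R" "\<And>k. k \<in> I \<Longrightarrow> has_pd k f (f' k)"
    "\<And>x. x \<in> reg \<Longrightarrow> (\<Sum>k\<in>I. x k * f' k x) = of_real n * f x"
    using assms unfolding homogeneous_def by blast
  have f': "f' k \<in> R" if "k \<in> I" for k using has_pd_regular [OF *(1) that *(2)] that by blast
  have "ad h (mop f) = (\<Sum>i\<in>I. mop (\<lambda>x. 4 * x i * f' i x))"
    unfolding h_def ad_sum_left
  proof (rule sum.cong [OF refl])
    fix i assume i: "i \<in> I"
    have x: "(\<lambda>x. 4 * x i) \<in> R" using i by auto
    show "ad (mop (\<lambda>x. 4 * x i) * dop i + mop (\<lambda>_. 2)) (mop f) = mop (\<lambda>x. 4 * x i * f' i x)"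
      by (simp add: ad_add_left ad_mult_left ad_dop_mop [OF i *(1) *(2) [OF i]] ad_mop_mop x *(1)
          mop_mult f' i)
  qed
  also have "\<dots> = mop (\<lambda>x. of_real (4 * n) * f x)"
    unfolding mop_sum [symmetric]
  proof (rule mop_cong)
    fix x assume x: "x \<in> reg"
    have "(\<Sum>i\<in>I. 4 * x i * f' i x) = 4 * (\<Sum>i\<in>I. x i * f' i x)"
      by (simp add: sum_distrib_left mult.assoc)
    then show "(\<Sum>i\<in>I. 4 * x i * f' i x) = of_real (4 * n) * f x" using *(3) [OF x] by simp
  qed
  finally show ?thesis unfolding mop_scaleR .
qed

lemma ad_h_dop:
  assumes "k \<in> I"
  shows "ad h (dop k) = (4 * - 1) *\<^sub>R dop k"
proof -
  have "ad h (dop k) = (\<Sum>i\<in>I. if i = k then (4 * - 1) *\<^sub>R dop k else 0)"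
    unfolding h_def ad_sum_left
  proof (rule sum.cong [OF refl])
    fix i assume i: "i \<in> I"
    have x: "(\<lambda>x. 4 * x i) \<in> R" using i by auto
    have "ad (dop k) (mop (\<lambda>x. 4 * x i)) = mop (\<lambda>_. 4 * (if i = k then 1 else 0))"
      by (intro ad_dop_mop assms x has_pd_cmult has_pd_coord)
    then have 1: "ad (mop (\<lambda>x. 4 * x i)) (dop k) = - mop (\<lambda>_. 4 * (if i = k then 1 else 0))"
      using ad_swap [of "mop (\<lambda>x. 4 * x i)" "dop k"] by simp
    have 2: "ad (mop (\<lambda>_. 2)) (dop k) = 0"
      using ad_dop_mop [OF assms regular_const has_pd_const, of 2] ad_swap [of "mop (\<lambda>_. 2)" "dop k"]
      by (simp add: mop_zero)
    have 4: "mop (\<lambda>_. 4) * dop k = 4 *\<^sub>R dop k"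
      using mop_scaleR [of 4 "\<lambda>_. 1"] mop_one_mult [OF supported_dop [OF assms]] by simp
    show "ad (mop (\<lambda>x. 4 * x i) * dop i + mop (\<lambda>_. 2)) (dop k) = (if i = k then (4 * - 1) *\<^sub>R dop k else 0)"
      by (simp add: ad_add_left ad_mult_left 1 2 4 ad_dop_dop i assms mop_zero)
  qed
  then show ?thesis using assms finite_I by simp
qed

section \<open>Weights of operators under \<open>ad h\<close>\<close>

definition weight :: "real \<Rightarrow> 'i lop \<Rightarrow> bool" where
  "weight n T \<longleftrightarrow> ad h T = (4 * n) *\<^sub>R T"

lemma weight_mult: "weight n S \<Longrightarrow> weight m T \<Longrightarrow> weight (n + m) (S * T)"
  by (simp add: weight_def ad_mult algebra_simps)

lemma weight_add: "weight n S \<Longrightarrow> weight n T \<Longrightarrow> weight n (S + T)"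
  by (simp add: weight_def ad_add_right algebra_simps)

lemma weight_sum: "(\<And>a. a \<in> A \<Longrightarrow> weight n (f a)) \<Longrightarrow> weight n (sum f A)"
  by (simp add: weight_def ad_sum_right scaleR_sum_right)

lemma weight_mop: "homogeneous n f \<Longrightarrow> weight n (mop f)"
  and weight_dop: "k \<in> I \<Longrightarrow> weight (- 1) (dop k)"
  by (simp_all add: weight_def ad_h_mop ad_h_dop del: mult_minus_right)

lemma weight_L: "weight (- 2) L"
proof -
  have "homogeneous (- 2) U"
    unfolding U_def using homogeneous_s [of _ 2] by (intro homogeneous_cmult homogeneous_sum) simp
  moreover have "weight (- 1 + - 1) (dop k * dop k)" if "k \<in> I" for k
    using that by (intro weight_mult weight_dop)
  ultimately show ?thesis unfolding L_def by (intro weight_add weight_sum weight_mop) simp_all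
qed

lemma weight_Q: "weight (- 3) Q"
proof -
  have "homogeneous (- 3) \<gamma>"
    unfolding \<gamma>_def using homogeneous_s [of _ 3] by (intro homogeneous_cmult homogeneous_sum) simp
  moreover have "weight (0 + (- 1 + - 1 + - 1)) (mop (\<lambda>_. \<alpha> k) * (dop k * dop k * dop k))" if "k \<in> I" for k
    using that by (intro weight_mult weight_dop weight_mop homogeneous_const)
  moreover have "weight (- 2 + - 1) (mop (\<beta> k) * dop k)" if "k \<in> I" for k
    using that homogeneous_s [of _ 2] unfolding \<beta>_def
    by (intro weight_mult weight_dop weight_mop homogeneous_cmult) simp_all
  ultimately show ?thesis unfolding Q_def by (intro weight_add weight_sum weight_mop) simp_all
qed

lemma ad_h_L: "ad h L = - 8 *\<^sub>R L"
  using weight_L by (simp add: weight_def)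

lemma ad_h_p2: "ad h (mop (p 2)) = 8 *\<^sub>R mop (p 2)"
  using ad_h_mop [OF homogeneous_p [of 2]] by simp

lemma ad_h_p: "ad h (mop (p d)) = (4 * real d) *\<^sub>R mop (p d)"
  by (rule ad_h_mop [OF homogeneous_p])

lemma ad_p2_p: "ad (mop (p 2)) (mop (p d)) = 0"
  by (intro ad_mop_mop regular_p)

text \<open>\<open>ad (mop (p 2))\<close> is a derivation that kills functions and maps
  \<open>dop k\<close> to \<open>- 2 * x k\<close>. Three applications annihilate all but the cubic
  part of \<open>Q\<close>, which acquires the factor
  \<open>fact 3 * (- 2) ^ 3 = - 48\<close>.\<close>

lemma ad_p2_pow_Q: "(ad (mop (p 2)) ^^ 3) Q = - 48 *\<^sub>R mop (p 3)"
proof -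
  let ?E = "mop (p 2)"
  have D: "ad ?E (dop k) = mop (\<lambda>x. - 2 * x k)" if k: "k \<in> I" for k
  proof -
    have "ad (dop k) ?E = mop (\<lambda>x. 2 * x k)"
      by (rule ad_dop_mop [OF k regular_p]) (use has_pd_p [OF k, of 2] in simp)
    then show ?thesis
      using ad_swap [of ?E "dop k"] mop_scaleR [of "- 1" "\<lambda>x. 2 * x k"] by simp
  qed
  have m: "ad ?E (mop f) = 0" if "f \<in> R" for f using that by (intro ad_mop_mop regular_p)
  have x: "(\<lambda>x. - 2 * x k) \<in> R" if "k \<in> I" for k
    using that by (intro regular_mult regular_const regular_coord)
  have m_pow: "(ad ?E ^^ n) (mop f * T) = mop f * (ad ?E ^^ n) T" if "f \<in> R" for f T n
    by (induction n) (auto simp: ad_mult m that)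
  have 1: "(ad ?E ^^ 3) (mop (\<beta> k) * dop k) = 0" if "k \<in> I" for k
  proof -
    have "(ad ?E ^^ 3) (dop k) = 0" using m [OF x [OF that]] D [OF that] by (simp add: numeral_3_eq_3)
    then show ?thesis by (simp only: m_pow [OF regular_coeffs(5) [OF that]] mult_zero_right)
  qed
  have 2: "(ad ?E ^^ 3) (mop (\<lambda>_. \<alpha> k) * (dop k * dop k * dop k)) = - 48 *\<^sub>R mop (\<lambda>x. \<alpha> k * x k ^ 3)"
    if k: "k \<in> I" for k
  proof -
    have "(ad ?E ^^ 3) (dop k ^ 3) = fact 3 *\<^sub>R ad ?E (dop k) ^ 3"
      using ad_pow_power [of ?E "dop k" 3] m [OF x [OF k]] D [OF k] by simp
    also have "ad ?E (dop k) ^ 3 = mop (\<lambda>x. (- 2 * x k) * (- 2 * x k) * (- 2 * x k))"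
      unfolding D [OF k] power3_eq_cube using x [OF k] by (simp only: mop_mult regular_mult)
    finally have "(ad ?E ^^ 3) (dop k ^ 3) = 6 *\<^sub>R mop (\<lambda>x. of_real (- 8) * x k ^ 3)"
      by (simp add: power3_eq_cube mult.assoc mult.left_commute fact_numeral)
    also have "\<dots> = - 48 *\<^sub>R mop (\<lambda>x. x k ^ 3)" unfolding mop_scaleR by simp
    finally have "(ad ?E ^^ 3) (dop k ^ 3) = - 48 *\<^sub>R mop (\<lambda>x. x k ^ 3)" .
    moreover have "mop (\<lambda>_. \<alpha> k) * mop (\<lambda>x. x k ^ 3) = mop (\<lambda>x. \<alpha> k * x k ^ 3)"
      using k by (intro mop_mult regular_const regular_power regular_coord)
    ultimately show ?thesis by (simp add: m_pow power3_eq_cube [symmetric] del: power_Suc)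
  qed
  have "(ad ?E ^^ 3) (mop \<gamma>) = 0" by (simp add: numeral_3_eq_3 m regular_coeffs)
  then have "(ad ?E ^^ 3) Q = (\<Sum>k\<in>I. - 48 *\<^sub>R mop (\<lambda>x. \<alpha> k * x k ^ 3))"
    unfolding Q_def by (simp add: ad_pow_add ad_pow_sum 1 2)
  also have "\<dots> = - 48 *\<^sub>R mop (p 3)"
    unfolding scaleR_sum_right [symmetric] mop_sum [symmetric] p_def by simp
  finally show ?thesis .
qed

section \<open>Nilpotency of \<open>ad L\<close> on the power sums\<close>

lemma nilpotent_p3: "(ad L ^^ 4) (mop (p 3)) = 0"
proof -
  \<comment> \<open>\<open>Q\<close> commutes with \<open>L\<close> and has weight
    \<open>- 3\<close>: it is a lowest weight vector with \<open>w = 3\<close>.\<close>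
  have "ad h Q = (- 4 * 3) *\<^sub>R Q" using weight_Q by (simp add: weight_def)
  then have "(ad L ^^ Suc 3) ((ad (mop (p 2)) ^^ 3) Q) = 0"
    by (rule ad_pow_lowest [OF ad_L_p2 ad_h_p2 ad_L_Q])
  then have "- 48 *\<^sub>R (ad L ^^ 4) (mop (p 3)) = 0"
    unfolding ad_p2_pow_Q ad_pow_scaleR by (simp add: eval_nat_numeral)
  then show ?thesis unfolding scaleR_eq_0_iff by simp
qed

text \<open>\<open>ad L (mop (p 1))\<close> is the total momentum in the scaled coordinates. It
  commutes with \<open>L\<close> because \<open>U\<close> depends only on differences of the
  \<open>\<alpha> i * x i\<close>; in formulas, the double sum of odd powers of \<open>r i j\<close>
  is antisymmetric.\<close>

lemma nilpotent_p1: "(ad L ^^ 2) (mop (p 1)) = 0"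
proof -
  have "ad L (mop (p 1)) = (\<Sum>i\<in>I. mop (\<lambda>x. 2 * (of_nat 1 * \<alpha> i powi (int 1 - 2) * x i ^ (1 - 1))) * dop i
      + mop (\<lambda>x. of_nat (1 * (1 - 1)) * \<alpha> i powi (int 1 - 2) * x i ^ (1 - 2)))"
    by (rule ad_L_mop [OF _ has_pd_p has_pd_p_twice]) auto
  also have "\<dots> = (\<Sum>i\<in>I. mop (\<lambda>_. 2 / \<alpha> i) * dop i)"
    by (simp add: mop_zero power_int_minus inverse_eq_divide)
  finally have "(ad L ^^ 2) (mop (p 1)) = (\<Sum>i\<in>I. ad L (mop (\<lambda>_. 2 / \<alpha> i) * dop i))"
    by (simp add: numeral_2_eq_2 ad_sum_right)
  also have "\<dots> = (\<Sum>i\<in>I. mop (\<lambda>x. 8 * \<kappa> * (1 / \<alpha> i ^ 2 * s i 3 x)))"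
  proof (rule sum.cong [OF refl])
    fix i assume i: "i \<in> I"
    have "ad L (mop (\<lambda>_. 2 / \<alpha> i) * dop i) = - mop (\<lambda>x. 2 / \<alpha> i * U1 i x)"
      using i by (simp add: ad_mult ad_L_const ad_L_dop mop_mult regular_coeffs)
    also have "\<dots> = mop (\<lambda>x. 8 * \<kappa> * (1 / \<alpha> i ^ 2 * s i 3 x))"
      using mop_scaleR [of "- 1" "\<lambda>x. 2 / \<alpha> i * U1 i x"]
      by (simp add: U1_def power2_eq_square mult.assoc)
    finally show "ad L (mop (\<lambda>_. 2 / \<alpha> i) * dop i) = mop (\<lambda>x. 8 * \<kappa> * (1 / \<alpha> i ^ 2 * s i 3 x))" .
  qed
  also have "\<dots> = mop (\<lambda>x. 8 * \<kappa> * (\<Sum>i\<in>I. \<Sum>j\<in>I. 1 / (\<alpha> i ^ 2 * \<alpha> j ^ 2) * r i j x ^ 3))"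
    unfolding mop_sum [symmetric] by (simp add: sum_distrib_left s_def mult.assoc)
  also have "(\<lambda>x. \<Sum>i\<in>I. \<Sum>j\<in>I. 1 / (\<alpha> i ^ 2 * \<alpha> j ^ 2) * r i j x ^ 3) = (\<lambda>_. 0)"
    by (rule ext, rule sum_antisym, subst r_swap) (simp add: mult.commute)
  then have "mop (\<lambda>x. 8 * \<kappa> * (\<Sum>i\<in>I. \<Sum>j\<in>I. 1 / (\<alpha> i ^ 2 * \<alpha> j ^ 2) * r i j x ^ 3)) = 0"
    by (simp add: fun_eq_iff mop_zero)
  finally show ?thesis .
qed

text \<open>\<open>ad L (mop (p 3))\<close> is the vector field with components
  \<open>6 * \<alpha> i * x i ^ 2\<close> plus a function, and the function commutes with
  \<open>p d\<close>.\<close>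

lemma ad_ad_p3_p: "ad (ad L (mop (p 3))) (mop (p d)) = (6 * real d) *\<^sub>R mop (p (Suc d))"
proof -
  have "ad L (mop (p 3)) = (\<Sum>i\<in>I. mop (\<lambda>x. 2 * (of_nat 3 * \<alpha> i powi (int 3 - 2) * x i ^ (3 - 1))) * dop i
      + mop (\<lambda>x. of_nat (3 * (3 - 1)) * \<alpha> i powi (int 3 - 2) * x i ^ (3 - 2)))"
    by (rule ad_L_mop [OF _ has_pd_p has_pd_p_twice]) auto
  also have "\<dots> = (\<Sum>i\<in>I. mop (\<lambda>x. 6 * \<alpha> i * x i ^ 2) * dop i + mop (\<lambda>x. 6 * \<alpha> i * x i))"
    by (simp add: mult.assoc [symmetric])
  finally have "ad (ad L (mop (p 3))) (mop (p d)) =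
      (\<Sum>i\<in>I. ad (mop (\<lambda>x. 6 * \<alpha> i * x i ^ 2) * dop i + mop (\<lambda>x. 6 * \<alpha> i * x i)) (mop (p d)))"
    by (simp add: ad_sum_left)
  also have "\<dots> = (\<Sum>i\<in>I. mop (\<lambda>x. of_real (6 * real d) * (\<alpha> i powi (int (Suc d) - 2) * x i ^ Suc d)))"
  proof (rule sum.cong [OF refl])
    fix i assume i: "i \<in> I"
    have x: "(\<lambda>x. 6 * \<alpha> i * x i ^ 2) \<in> R" "(\<lambda>x. 6 * \<alpha> i * x i) \<in> R"
      using i by (intro regular_mult regular_const regular_power regular_coord; assumption)+
    have y: "(\<lambda>x. of_nat d * \<alpha> i powi (int d - 2) * x i ^ (d - 1)) \<in> R"
      using has_pd_regular [OF regular_p i has_pd_p [OF i]] .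
    have "ad (mop (\<lambda>x. 6 * \<alpha> i * x i ^ 2) * dop i + mop (\<lambda>x. 6 * \<alpha> i * x i)) (mop (p d)) =
        mop (\<lambda>x. 6 * \<alpha> i * x i ^ 2 * (of_nat d * \<alpha> i powi (int d - 2) * x i ^ (d - 1)))"
      by (simp only: ad_add_left ad_mult_left ad_mop_mop [OF x(1) regular_p] ad_mop_mop [OF x(2) regular_p]
          ad_dop_mop [OF i regular_p has_pd_p [OF i]] mop_mult [OF x(1) y]) simp
    also have "\<dots> = mop (\<lambda>x. of_real (6 * real d) * (\<alpha> i powi (int (Suc d) - 2) * x i ^ Suc d))"
    proof (rule arg_cong [of _ _ mop], rule ext)
      fix x :: "'i \<Rightarrow> complex"
      show "6 * \<alpha> i * x i ^ 2 * (of_nat d * \<alpha> i powi (int d - 2) * x i ^ (d - 1)) =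
          of_real (6 * real d) * (\<alpha> i powi (int (Suc d) - 2) * x i ^ Suc d)"
      \<comment> \<open>For \<open>d = 0\<close> both sides have the factor 0; otherwise
        \<open>d - 1\<close> is a genuine predecessor.\<close>
      proof (cases d)
        case (Suc e)
        have "\<alpha> i powi (int (Suc d) - 2) = \<alpha> i powi (int d - 2) * \<alpha> i"
          using power_int_add_1 [of "\<alpha> i" "int d - 2"] \<alpha>_nz [OF i] by (simp add: algebra_simps)
        then show ?thesis by (simp add: Suc power2_eq_square)
      qed simp
    qed
    finally show "ad (mop (\<lambda>x. 6 * \<alpha> i * x i ^ 2) * dop i + mop (\<lambda>x. 6 * \<alpha> i * x i)) (mop (p d)) =
        mop (\<lambda>x. of_real (6 * real d) * (\<alpha> i powi (int (Suc d) - 2) * x i ^ Suc d))" .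
  qed
  also have "\<dots> = (6 * real d) *\<^sub>R mop (p (Suc d))"
    unfolding mop_sum [symmetric] sum_distrib_left [symmetric] p_def by (rule mop_scaleR)
  finally show ?thesis .
qed

text \<open>Bracketing with \<open>ad L (p 3)\<close>, which lies in a finite-dimensional \<open>sl\<^sub>2\<close>-module, leads from
  \<open>p d\<close> to \<open>p (d + 1)\<close>.\<close>

lemma nilpotent_p: "d \<ge> 1 \<Longrightarrow> (ad L ^^ Suc d) (mop (p d)) = 0"
proof (induction d rule: nat_induct_at_least)
  case base
  show ?case using nilpotent_p1 by (simp add: numeral_2_eq_2)
next
  case (Suc d)
  consider "d = 1" | "d = 2" | "d \<ge> 3" using Suc.hyps by linarith
  then show ?case
  proof cases
    case 1
    have "ad L h = 8 *\<^sub>R L" using ad_h_L ad_swap [of L h] by simp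
    then show ?thesis using ad_L_p2 1 by (simp add: numeral_2_eq_2 ad_scaleR_right)
  next
    case 2
    then show ?thesis using nilpotent_p3 by (simp add: eval_nat_numeral)
  next
    case 3
    let ?A = "ad L (mop (p 3))"
    have A: "(ad L ^^ 3) ?A = 0" using nilpotent_p3 by (simp add: eval_nat_numeral)
    \<comment> \<open>Since \<open>3 + (d + 1) = (d + 3) + 1\<close>, the Leibniz rule gives
      vanishing at order \<open>d + 3\<close>. This is one more than claimed; the weight argument at
      the end removes the excess.\<close>
    have "(ad L ^^ (d + 3)) (?A * mop (p d)) = 0" "(ad L ^^ (d + 3)) (mop (p d) * ?A) = 0"
      by (rule ad_pow_mult_vanish [OF A Suc.IH], simp) (rule ad_pow_mult_vanish [OF Suc.IH A], simp)
    then have "(ad L ^^ (d + 3)) (ad ?A (mop (p d))) = 0"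
      by (simp only: ad_def [of ?A] ad_pow_diff diff_self)
    then have "(6 * real d) *\<^sub>R (ad L ^^ Suc (Suc (Suc d))) (mop (p (Suc d))) = 0"
      unfolding ad_ad_p3_p ad_pow_scaleR by (simp add: eval_nat_numeral del: funpow.simps)
    then have "(ad L ^^ Suc (Suc (Suc d))) (mop (p (Suc d))) = 0"
      unfolding scaleR_eq_0_iff using 3 by simp
    then show ?thesis by (rule ad_sl2_nilpotent [OF ad_L_p2 ad_h_L ad_p2_p ad_h_p])
  qed
qed

section \<open>The commuting integrals\<close>

definition Lint :: "nat \<Rightarrow> 'i lop" where
  "Lint d = (1 / (2 ^ d * fact d)) *\<^sub>R (ad L ^^ d) (mop (p d))"

lemma ad_Lint_Lint:
  assumes "d1 \<ge> 1" "d2 \<ge> 1"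
  shows "ad (Lint d1) (Lint d2) = 0"
proof -
  have "mop (p d1) * mop (p d2) = mop (p d2) * mop (p d1)"
    using ad_mop_mop [OF regular_p regular_p] unfolding ad_eq_0_iff .
  from ad_pow_top_commute [OF nilpotent_p [OF assms(1)] nilpotent_p [OF assms(2)] this]
  show ?thesis by (simp add: Lint_def ad_eq_0_iff)
qed

lemma Lint_2: "Lint 2 = L"
proof -
  have "ad L h = 8 *\<^sub>R L" using ad_h_L ad_swap [of L h] by simp
  then have "(ad L ^^ 2) (mop (p 2)) = 8 *\<^sub>R L" by (simp add: numeral_2_eq_2 ad_L_p2 [unfolded numeral_2_eq_2])
  then show ?thesis by (simp add: Lint_def)
qed

section \<open>Algebraic independence\<close>

text \<open>The row of coordinate \<open>i\<close> in the Jacobian of \<open>p 2, p 3, ...\<close>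
  has the factor \<open>x i\<close>, which must not vanish.\<close>

definition reg_nz :: "('i \<Rightarrow> complex) set" where
  "reg_nz = {x \<in> reg. \<forall>i\<in>I. x i \<noteq> 0}"

lemma reg_nz_nonempty: "reg_nz \<noteq> {}"
proof -
  obtain f :: "'i \<Rightarrow> nat" where f: "inj_on f I"
    using finite_imp_inj_to_nat_seg [OF finite_I] by blast
  \<comment> \<open>The scaled coordinates are distinct positive integers, so the point avoids all
    hyperplanes and has no zero coordinate.\<close>
  define x where "x = (\<lambda>i\<in>I. (of_nat (f i) + 1) / \<alpha> i)"
  have x: "\<alpha> i * x i = of_nat (Suc (f i))" if "i \<in> I" for i
    using \<alpha>_nz that by (simp add: x_def)
  have "h x \<noteq> 0" if h: "h \<in> H" for h
  proof -
    obtain i j c where *: "i \<in> I" "j \<in> I" "i \<noteq> j" "c \<noteq> 0" "h = (\<lambda>x. c * (\<alpha> i * x i - \<alpha> j * x j))"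
      using forms [OF h] by blast
    have "f i \<noteq> f j" using f * by (auto dest: inj_onD)
    then have "of_nat (Suc (f i)) \<noteq> (of_nat (Suc (f j)) :: complex)" unfolding of_nat_eq_iff by simp
    then show ?thesis using * by (simp add: x del: of_nat_Suc)
  qed
  moreover have "x i \<noteq> 0" if "i \<in> I" for i using x [OF that] by (auto simp del: of_nat_Suc)
  moreover have "x \<in> I \<rightarrow>\<^sub>E UNIV" by (simp add: x_def)
  ultimately have "x \<in> reg_nz" by (auto simp: reg_nz_def reg_points_def)
  then show ?thesis by blast
qed

lemma mop_const_eq_0: "mop (\<lambda>_. c) = 0 \<Longrightarrow> c = 0"
proof -
  assume c: "mop (\<lambda>_. c) = 0"
  obtain x where x: "x \<in> reg" using reg_nz_nonempty by (auto simp: reg_nz_def)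
  have "lop_apply (mop (\<lambda>_. c)) (cut (\<lambda>_. 1)) x = c"
    using x by (simp add: mop_apply proj_id [OF cut_R0])
  then show ?thesis using c by (simp add: zero_lop.rep_eq)
qed

text \<open>Variable \<open>k\<close> stands for \<open>p (k + 2)\<close>, so that variable 0
  belongs to \<open>L\<close> itself.\<close>

definition monomial :: "(nat \<Rightarrow> nat) \<Rightarrow> 'i scalar_fun" where
  "monomial m x = (\<Prod>k<card I. p (k + 2) x ^ m k)"

text \<open>The chain rule. Where \<open>m e = 0\<close>, the truncated \<open>m e - 1\<close> is
  harmless because of the factor \<open>of_nat (m e)\<close>.\<close>

lemma has_pd_monomial:
  assumes "i \<in> I"
  shows "has_pd i (monomial m) (\<lambda>x. \<Sum>e<card I.
    of_nat (m e) * monomial (m(e := m e - 1)) x * (of_nat (e + 2) * \<alpha> i ^ e * x i ^ (e + 1)))"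
proof -
  let ?d = "\<lambda>e x. of_nat (e + 2) * \<alpha> i powi (int (e + 2) - 2) * x i ^ (e + 2 - 1)"
  have "has_pd i (\<lambda>x. \<Prod>k<card I. p (k + 2) x ^ m k)
      (\<lambda>x. \<Sum>e<card I. (of_nat (m e) * ?d e x * p (e + 2) x ^ (m e - 1)) * (\<Prod>k\<in>{..<card I} - {e}. p (k + 2) x ^ m k))"
    by (intro has_pd_prod has_pd_power has_pd_p assms)
  moreover have "(\<Sum>e<card I. (of_nat (m e) * ?d e x * p (e + 2) x ^ (m e - 1)) * (\<Prod>k\<in>{..<card I} - {e}. p (k + 2) x ^ m k)) =
      (\<Sum>e<card I. of_nat (m e) * monomial (m(e := m e - 1)) x * (of_nat (e + 2) * \<alpha> i ^ e * x i ^ (e + 1)))" for x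
  proof (rule sum.cong [OF refl])
    fix e assume e: "e \<in> {..<card I}"
    have "(\<Prod>k\<in>{..<card I} - {e}. p (k + 2) x ^ (m(e := m e - 1)) k) = (\<Prod>k\<in>{..<card I} - {e}. p (k + 2) x ^ m k)"
      by (rule prod.cong) auto
    then have "monomial (m(e := m e - 1)) x = p (e + 2) x ^ (m e - 1) * (\<Prod>k\<in>{..<card I} - {e}. p (k + 2) x ^ m k)"
      unfolding monomial_def by (subst prod.remove [OF _ e]) auto
    then show "(of_nat (m e) * ?d e x * p (e + 2) x ^ (m e - 1)) * (\<Prod>k\<in>{..<card I} - {e}. p (k + 2) x ^ m k) =
      of_nat (m e) * monomial (m(e := m e - 1)) x * (of_nat (e + 2) * \<alpha> i ^ e * x i ^ (e + 1))"
      by (simp add: ac_simps)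
  qed
  ultimately show ?thesis unfolding monomial_def [abs_def] by simp
qed

text \<open>Invertibility of the Vandermonde matrix, by counting roots: a polynomial of degree below
  \<open>card I\<close> would have the \<open>card I\<close> distinct roots
  \<open>\<alpha> i * x i\<close>.\<close>

lemma sum_power_eq_0:
  fixes g :: "nat \<Rightarrow> complex"
  assumes x: "x \<in> reg" and g: "\<And>i. i \<in> I \<Longrightarrow> (\<Sum>e<card I. g e * (\<alpha> i * x i) ^ e) = 0" and e: "e < card I"
  shows "g e = 0"
proof (rule ccontr)
  assume ne: "g e \<noteq> 0"
  define n where "n = card I - 1"
  have n: "{..<card I} = {..n}" "e \<le> n" using e by (auto simp: n_def)
  let ?Z = "{z. (\<Sum>e\<le>n. g e * z ^ e) = 0}"
  have Z: "finite ?Z" "card ?Z \<le> n" using polyfun_rootbound [of n g] n ne by auto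
  have "inj_on (\<lambda>i. \<alpha> i * x i) I" using reg_distinct [OF x] by (auto simp: inj_on_def)
  then have "card I = card ((\<lambda>i. \<alpha> i * x i) ` I)" by (simp add: card_image)
  also have "\<dots> \<le> card ?Z" using g Z by (intro card_mono) (auto simp: n)
  finally show False using Z e by (simp add: n_def)
qed

text \<open>Differentiating a relation along all coordinates gives a linear system for its partial
  derivatives whose determinant is a Vandermonde determinant in the \<open>\<alpha> i * x i\<close>; hence the
  partial derivatives are relations, too.\<close>

lemma relation_derivative:
  assumes S: "finite S" and rel: "\<And>x. x \<in> reg_nz \<Longrightarrow> (\<Sum>m\<in>S. c m * monomial m x) = 0"
    and x: "x \<in> reg_nz" and e: "e < card I"
  shows "(\<Sum>m\<in>S. c m * of_nat (m e) * monomial (m(e := m e - 1)) x) = 0"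
proof -
  have xr: "x \<in> reg" using x by (simp add: reg_nz_def)
  define g where "g e = of_nat (e + 2) * (\<Sum>m\<in>S. c m * of_nat (m e) * monomial (m(e := m e - 1)) x)" for e
  have "(\<Sum>e<card I. g e * (\<alpha> i * x i) ^ e) = 0" if i: "i \<in> I" for i
  proof -
    have xi: "x i \<noteq> 0" using x i by (simp add: reg_nz_def)
    let ?F' = "\<lambda>x. \<Sum>m\<in>S. c m * (\<Sum>e<card I.
      of_nat (m e) * monomial (m(e := m e - 1)) x * (of_nat (e + 2) * \<alpha> i ^ e * x i ^ (e + 1)))"
    have "has_pd i (\<lambda>x. \<Sum>m\<in>S. c m * monomial m x) ?F'"
      by (intro has_pd_sum has_pd_cmult has_pd_monomial i)
    then have "((\<lambda>t. \<Sum>m\<in>S. c m * monomial m (x(i := t))) has_field_derivative ?F' x) (at (x i))"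
      using xr unfolding has_pd_def by blast
    \<comment> \<open>Near \<open>x i\<close> the coordinate line stays in \<open>reg_nz\<close>, so
      the relation holds along it and its derivative is zero.\<close>
    moreover have "eventually (\<lambda>t. t \<in> - {0}) (nhds (x i))"
      using xi by (intro eventually_nhds_in_open) auto
    then have "eventually (\<lambda>t. x(i := t) \<in> reg_nz) (nhds (x i))"
      using reg_line [OF xr i] by eventually_elim (use x in \<open>auto simp: reg_nz_def\<close>)
    then have "eventually (\<lambda>t. (\<Sum>m\<in>S. c m * monomial m (x(i := t))) = 0) (nhds (x i))"
      by (rule eventually_mono) (rule rel)
    then have "((\<lambda>t. \<Sum>m\<in>S. c m * monomial m (x(i := t))) has_field_derivative 0) (at (x i))"
      by (subst DERIV_cong_ev [OF refl _ refl]) auto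
    ultimately have "?F' x = 0" by (rule DERIV_unique)
    also have "?F' x = (\<Sum>e<card I. \<Sum>m\<in>S. c m *
      (of_nat (m e) * monomial (m(e := m e - 1)) x * (of_nat (e + 2) * \<alpha> i ^ e * x i ^ (e + 1))))"
      unfolding sum_distrib_left by (rule sum.swap)
    \<comment> \<open>Uses \<open>\<alpha> i ^ e * x i ^ (e + 1) = x i * (\<alpha> i * x i) ^
      e\<close>, which exposes the Vandermonde form.\<close>
    also have "\<dots> = x i * (\<Sum>e<card I. g e * (\<alpha> i * x i) ^ e)"
      unfolding g_def sum_distrib_left sum_distrib_right
      by (intro sum.cong refl) (simp add: power_mult_distrib ac_simps)
    finally show ?thesis using xi by simp
  qed
  from sum_power_eq_0 [OF xr this e] have "g e = 0" .
  moreover have "of_nat (e + 2) \<noteq> (0 :: complex)" unfolding of_nat_eq_0_iff by simp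
  ultimately show ?thesis unfolding g_def by (simp del: of_nat_add)
qed

text \<open>Induction on the degree bound: differentiating a relation with respect to one generator
  lowers its degree, so the coefficients of all nonconstant monomials vanish. The constant term is
  then alone and vanishes as well.\<close>

lemma monomials_independent:
  assumes "finite S" "\<And>m k. m \<in> S \<Longrightarrow> card I \<le> k \<Longrightarrow> m k = 0"
    and "\<And>x. x \<in> reg_nz \<Longrightarrow> (\<Sum>m\<in>S. c m * monomial m x) = 0"
    and "\<And>m. m \<in> S \<Longrightarrow> (\<Sum>k<card I. m k) \<le> D"
  shows "\<forall>m\<in>S. c m = 0"
  using assms
proof (induction D arbitrary: S c)
  case (0 S c)
  have "S \<subseteq> {\<lambda>_. 0}"
  proof
    fix m assume m: "m \<in> S"
    have "m k = 0" for k using 0(2,4) [OF m] by (cases "k < card I") auto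
    then show "m \<in> {\<lambda>_. 0}" by auto
  qed
  then consider "S = {}" | "S = {\<lambda>_. 0}" by blast
  then show ?case
  proof cases
    case 2
    obtain x where "x \<in> reg_nz" using reg_nz_nonempty by blast
    from 0(3) [OF this] show ?thesis by (simp add: 2 monomial_def)
  qed simp
next
  case (Suc D S c)
  have nonconst: "c m = 0" if m: "m \<in> S" and ne: "m \<noteq> (\<lambda>_. 0)" for m
  proof -
    obtain e where "m e \<noteq> 0" using ne by blast
    then have e: "e < card I" using Suc.prems(2) [OF m, of e] by linarith
    define down where "down = (\<lambda>m :: nat \<Rightarrow> nat. m(e := m e - 1))"
    define S' where "S' = {m \<in> S. m e \<noteq> 0}"
    have inj: "inj_on down S'"
    proof (rule inj_onI)
      fix m m' assume *: "m \<in> S'" "m' \<in> S'" "down m = down m'"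
      show "m = m'"
      proof
        fix k show "m k = m' k"
          using fun_cong [OF *(3), of k] *(1,2) by (cases "k = e") (auto simp: down_def S'_def)
      qed
    qed
    \<comment> \<open>Coefficients of the differentiated relation, indexed by the lowered exponents;
      \<open>down\<close> is injective on the exponents with \<open>m e \<noteq> 0\<close>.\<close>
    define c' where "c' m' = c (the_inv_into S' down m') * of_nat ((the_inv_into S' down m') e)" for m'
    have c': "c' (down m) = c m * of_nat (m e)" if "m \<in> S'" for m
      by (simp add: c'_def the_inv_into_f_f [OF inj that])
    have "\<forall>m'\<in>down ` S'. c' m' = 0"
    proof (rule Suc.IH)
      show "finite (down ` S')" using Suc.prems(1) by (simp add: S'_def)
      show "m' k = 0" if "m' \<in> down ` S'" "card I \<le> k" for m' k
        using that Suc.prems(2) e by (auto simp: down_def S'_def)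
      show "(\<Sum>m'\<in>down ` S'. c' m' * monomial m' x) = 0" if "x \<in> reg_nz" for x
      proof -
        have "(\<Sum>m'\<in>down ` S'. c' m' * monomial m' x) = (\<Sum>m\<in>S'. c m * of_nat (m e) * monomial (down m) x)"
          by (simp add: sum.reindex [OF inj] c')
        also have "\<dots> = (\<Sum>m\<in>S. c m * of_nat (m e) * monomial (down m) x)"
          using Suc.prems(1) by (intro sum.mono_neutral_left) (auto simp: S'_def)
        finally show ?thesis
          using relation_derivative [OF Suc.prems(1,3) that e] by (simp add: down_def)
      qed
      show "(\<Sum>k<card I. m' k) \<le> D" if m': "m' \<in> down ` S'" for m'
      proof -
        obtain m where m: "m \<in> S" "m e \<noteq> 0" "m' = down m" using m' by (auto simp: S'_def)
        have "(\<Sum>k\<in>{..<card I} - {e}. m' k) = (\<Sum>k\<in>{..<card I} - {e}. m k)"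
          by (rule sum.cong) (auto simp: m down_def)
        then have "Suc (\<Sum>k<card I. m' k) = (\<Sum>k<card I. m k)"
          using e m(2) by (simp add: sum.remove [of "{..<card I}" e] m(3) down_def)
        then show ?thesis using Suc.prems(4) [OF m(1)] by simp
      qed
    qed
    moreover have "m \<in> S'" using m \<open>m e \<noteq> 0\<close> by (simp add: S'_def)
    ultimately show ?thesis using c' \<open>m e \<noteq> 0\<close> by fastforce
  qed
  show ?case
  proof
    fix m assume m: "m \<in> S"
    show "c m = 0"
    proof (cases "m = (\<lambda>_. 0)")
      case True
      obtain x where "x \<in> reg_nz" using reg_nz_nonempty by blast
      from Suc.prems(3) [OF this] have "(\<Sum>m\<in>S. c m * monomial m x) = 0" .
      moreover have "(\<Sum>m\<in>S. c m * monomial m x) = c m * monomial m x"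
        using sum.mono_neutral_right [of S "{m}" "\<lambda>m. c m * monomial m x"] Suc.prems(1) m True nonconst by auto
      ultimately show ?thesis by (simp add: True monomial_def)
    qed (use nonconst m in blast)
  qed
qed

subsection \<open>Principal symbols\<close>

text \<open>The principal symbol of an operator of order \<open>n\<close> is obtained by taking \<open>n\<close> commutators with
  a linear form; the sign in \<open>lin\<close> makes up for \<open>[x, d/dx] = - 1\<close>.\<close>

definition lin :: "('i \<Rightarrow> complex) \<Rightarrow> 'i scalar_fun" where
  "lin \<xi> = (\<lambda>x. \<Sum>i\<in>I. - \<xi> i * x i)"

definition has_symbol :: "('i \<Rightarrow> complex) \<Rightarrow> nat \<Rightarrow> complex \<Rightarrow> 'i lop \<Rightarrow> bool" where
  "has_symbol \<xi> n \<sigma> T \<longleftrightarrow> (ad (mop (lin \<xi>)) ^^ n) T = mop (\<lambda>_. fact n * \<sigma>)"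

lemma regular_lin [intro]: "lin \<xi> \<in> R"
  unfolding lin_def by (intro regular_sum regular_mult regular_const regular_coord)

lemma has_symbol_vanish:
  assumes "has_symbol \<xi> n \<sigma> T" "n < m"
  shows "(ad (mop (lin \<xi>)) ^^ m) T = 0"
proof -
  have "(ad (mop (lin \<xi>)) ^^ Suc n) T = 0"
    using assms(1) by (simp add: has_symbol_def ad_mop_mop regular_lin)
  then show ?thesis by (rule ad_pow_vanish_mono) (use assms in simp)
qed

text \<open>Only the top Leibniz term survives, and its binomial coefficient turns
  \<open>fact n * fact m\<close> into \<open>fact (n + m)\<close>.\<close>

lemma has_symbol_mult:
  assumes "has_symbol \<xi> n \<sigma> S" "has_symbol \<xi> m \<tau> T"
  shows "has_symbol \<xi> (n + m) (\<sigma> * \<tau>) (S * T)"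
proof -
  have "(ad (mop (lin \<xi>)) ^^ (n + m)) (S * T) =
      real ((n + m) choose n) *\<^sub>R (mop (\<lambda>_. fact n * \<sigma>) * mop (\<lambda>_. fact m * \<tau>))"
    using ad_pow_mult_top [OF has_symbol_vanish [OF assms(1) lessI] has_symbol_vanish [OF assms(2) lessI]] assms
    by (simp add: has_symbol_def)
  also have "\<dots> = mop (\<lambda>_. of_real (real ((n + m) choose n)) * ((fact n * \<sigma>) * (fact m * \<tau>)))"
    by (simp only: mop_mult regular_const mop_scaleR)
  also have "of_real (real ((n + m) choose n)) * ((fact n * \<sigma>) * (fact m * \<tau>)) = fact (n + m) * (\<sigma> * \<tau>)"
  proof -
    have "fact n * fact m * of_nat ((n + m) choose n) = (fact (n + m) :: complex)"
      using binomial_fact_lemma [of n "n + m"] by (metis add_diff_cancel_left' le_add1 of_nat_fact of_nat_mult)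
    then show ?thesis by (simp add: algebra_simps)
  qed
  finally show ?thesis by (simp add: has_symbol_def)
qed

lemma has_symbol_one: "has_symbol \<xi> 0 1 (mop (\<lambda>_. 1))"
  by (simp add: has_symbol_def)

lemma has_symbol_power_mult:
  assumes "has_symbol \<xi> n \<sigma> S" "has_symbol \<xi> m \<tau> T"
  shows "has_symbol \<xi> (k * n + m) (\<sigma> ^ k * \<tau>) (S ^ k * T)"
proof (induction k)
  case (Suc k)
  then show ?case using has_symbol_mult [OF assms(1) Suc] by (simp add: mult.assoc add.assoc)
qed (use assms in simp)

lemma has_pd_lin: "i \<in> I \<Longrightarrow> has_pd i (lin \<xi>) (\<lambda>_. - \<xi> i)"
proof -
  assume i: "i \<in> I"
  have "has_pd i (lin \<xi>) (\<lambda>x. \<Sum>k\<in>I. - \<xi> k * (if k = i then 1 else 0))"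
    unfolding lin_def by (intro has_pd_sum has_pd_cmult has_pd_coord)
  moreover have "(\<Sum>k\<in>I. - \<xi> k * (if k = i then 1 else 0)) = - \<xi> i"
    using i finite_I by (simp add: if_distrib [of "times _"] cong: if_cong)
  ultimately show ?thesis by simp
qed

lemma ad_lin_L: "ad (mop (lin \<xi>)) L = (\<Sum>i\<in>I. mop (\<lambda>_. 2 * \<xi> i) * dop i)"
proof -
  have "ad L (mop (lin \<xi>)) = (\<Sum>i\<in>I. mop (\<lambda>x. 2 * - \<xi> i) * dop i + mop (\<lambda>_. 0))"
    by (rule ad_L_mop [OF _ has_pd_lin has_pd_const]) auto
  also have "\<dots> = (\<Sum>i\<in>I. - (mop (\<lambda>x. 2 * \<xi> i) * dop i))"
    using mop_diff [of "\<lambda>_. 0"] by (simp add: mop_zero)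
  finally show ?thesis
    by (subst ad_swap) (simp add: sum_negf)
qed

text \<open>The coefficients \<open>c\<close> are arbitrary for the sake of the induction: one
  derivative replaces \<open>c i\<close> by
  \<open>c i * (2 * \<xi> i) * of_nat (Suc m)\<close>.\<close>

lemma ad_vector_field_pow:
  "(ad (\<Sum>i\<in>I. mop (\<lambda>_. 2 * \<xi> i) * dop i) ^^ m) (mop (\<lambda>x. \<Sum>i\<in>I. c i * x i ^ m)) =
    mop (\<lambda>_. fact m * (\<Sum>i\<in>I. c i * (2 * \<xi> i) ^ m))"
proof (induction m arbitrary: c)
  case (Suc m)
  let ?V = "\<Sum>i\<in>I. mop (\<lambda>_. 2 * \<xi> i) * dop i" and ?f = "\<lambda>x. \<Sum>i\<in>I. c i * x i ^ Suc m"
  have f: "?f \<in> R" by (intro regular_sum regular_mult regular_const regular_power regular_coord)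
  have pd: "has_pd i ?f (\<lambda>x. c i * of_nat (Suc m) * x i ^ m)" if i: "i \<in> I" for i
  proof -
    have "has_pd i ?f (\<lambda>x. \<Sum>k\<in>I. c k * (of_nat (Suc m) * (if k = i then 1 else 0) * x k ^ (Suc m - 1)))"
      by (intro has_pd_sum has_pd_cmult has_pd_power has_pd_coord)
    moreover have "(\<Sum>k\<in>I. c k * (of_nat (Suc m) * (if k = i then 1 else 0) * x k ^ (Suc m - 1)))
        = c i * of_nat (Suc m) * x i ^ m" for x :: "'i \<Rightarrow> complex"
    proof -
      have "(\<Sum>k\<in>I. c k * (of_nat (Suc m) * (if k = i then 1 else 0) * x k ^ (Suc m - 1))) =
          (\<Sum>k\<in>I. if k = i then c i * of_nat (Suc m) * x i ^ m else 0)"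
        by (rule sum.cong) auto
      then show ?thesis using i finite_I by simp
    qed
    ultimately show ?thesis by simp
  qed
  have "ad ?V (mop ?f) = (\<Sum>i\<in>I. mop (\<lambda>x. (c i * (2 * \<xi> i) * of_nat (Suc m)) * x i ^ m))"
    unfolding ad_sum_left
  proof (rule sum.cong [OF refl])
    fix i assume i: "i \<in> I"
    have "(\<lambda>x. c i * of_nat (Suc m) * x i ^ m) \<in> R" using has_pd_regular [OF f i pd [OF i]] .
    then show "ad (mop (\<lambda>_. 2 * \<xi> i) * dop i) (mop ?f) = mop (\<lambda>x. (c i * (2 * \<xi> i) * of_nat (Suc m)) * x i ^ m)"
      by (simp only: ad_mult_left ad_dop_mop [OF i f pd [OF i]] ad_mop_mop regular_const f mop_mult)
        (simp add: algebra_simps)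
  qed
  also have "\<dots> = mop (\<lambda>x. \<Sum>i\<in>I. (c i * (2 * \<xi> i) * of_nat (Suc m)) * x i ^ m)"
    by (simp only: mop_sum)
  finally have "(ad ?V ^^ Suc m) (mop ?f) = mop (\<lambda>_. fact m * (\<Sum>i\<in>I. c i * (2 * \<xi> i) * of_nat (Suc m) * (2 * \<xi> i) ^ m))"
    by (simp only: funpow_Suc_right comp_apply Suc.IH)
  also have "fact m * (\<Sum>i\<in>I. c i * (2 * \<xi> i) * of_nat (Suc m) * (2 * \<xi> i) ^ m) =
      fact (Suc m) * (\<Sum>i\<in>I. c i * (2 * \<xi> i) ^ Suc m)"
    unfolding sum_distrib_left by (rule sum.cong) (auto simp: algebra_simps)
  finally show ?case .
qed simp

text \<open>With \<open>l\<close> the linear form, \<open>[l, L]\<close> is a constant vector field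
  and \<open>[l, [l, L]]\<close> a constant, so \<open>ad_pow_ad_pow\<close> applies. It gives one
  \<open>fact d\<close>, and the vector field acting on \<open>p d\<close> gives
  \<open>fact d * 2 ^ d * p d \<xi>\<close>; the normalization of \<open>Lint\<close> cancels one
  \<open>fact d\<close> and \<open>2 ^ d\<close>.\<close>

lemma has_symbol_Lint: "has_symbol \<xi> d (p d \<xi>) (Lint d)"
proof -
  let ?l = "mop (lin \<xi>)" and ?K = "ad (mop (lin \<xi>)) L"
  have lD: "ad ?l (dop i) = mop (\<lambda>_. \<xi> i)" if "i \<in> I" for i
  proof -
    have "ad (dop i) ?l = mop (\<lambda>_. - \<xi> i)" by (intro ad_dop_mop that regular_lin has_pd_lin)
    then show ?thesis using ad_swap [of ?l "dop i"] mop_diff [of "\<lambda>_. 0" "\<lambda>_. \<xi> i"] by (simp add: mop_zero)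
  qed
  have "ad ?l ?K = mop (\<lambda>_. \<Sum>i\<in>I. 2 * \<xi> i * \<xi> i)"
    unfolding ad_lin_L ad_sum_right mop_sum
    by (rule sum.cong) (simp_all add: ad_mult lD ad_mop_mop regular_lin mop_mult)
  then have C: "ad (ad ?l ?K) ?l = 0" "ad (ad ?l ?K) L = 0" "ad (ad ?l ?K) (mop (p d)) = 0"
    using ad_L_const ad_swap [of _ L] by (simp_all add: ad_mop_mop regular_lin regular_p)
  have "(ad ?l ^^ d) ((ad L ^^ d) (mop (p d))) = fact d *\<^sub>R (ad ?K ^^ d) (mop (p d))"
    by (rule ad_pow_ad_pow [OF ad_mop_mop [OF regular_lin regular_p] C])
  also have "(ad ?K ^^ d) (mop (p d)) = mop (\<lambda>_. fact d * (\<Sum>i\<in>I. \<alpha> i powi (int d - 2) * (2 * \<xi> i) ^ d))"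
    unfolding ad_lin_L p_def by (rule ad_vector_field_pow)
  also have "(\<Sum>i\<in>I. \<alpha> i powi (int d - 2) * (2 * \<xi> i) ^ d) = 2 ^ d * p d \<xi>"
    unfolding p_def sum_distrib_left by (rule sum.cong) (simp_all add: power_mult_distrib)
  finally have "(ad ?l ^^ d) (Lint d) = (1 / (2 ^ d * fact d) * fact d) *\<^sub>R mop (\<lambda>_. fact d * (2 ^ d * p d \<xi>))"
    by (simp add: Lint_def ad_pow_scaleR)
  also have "\<dots> = mop (\<lambda>_. of_real (1 / (2 ^ d * fact d) * fact d) * (fact d * (2 ^ d * p d \<xi>)))"
    by (rule mop_scaleR [symmetric])
  also have "of_real (1 / (2 ^ d * fact d) * fact d) * (fact d * (2 ^ d * p d \<xi>)) = fact d * p d \<xi>"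
    by simp
  finally show ?thesis by (simp add: has_symbol_def)
qed

lemma rep_monom:
  assumes "\<And>k. k < length Qs \<Longrightarrow> rep (Qs ! k) (Lint (k + 2))"
  shows "\<exists>T. rep (oper_monom Qs m) T \<and>
    (\<forall>\<xi>. has_symbol \<xi> (\<Sum>k<length Qs. Poly_Mapping.lookup m k * (k + 2))
      (\<Prod>k<length Qs. p (k + 2) \<xi> ^ Poly_Mapping.lookup m k) T)"
proof -
  \<comment> \<open>The statement is generalized from \<open>[0..<length Qs]\<close> to distinct
    lists \<open>ks\<close>, to allow induction along \<open>foldr\<close>.\<close>
  have *: "set ks \<subseteq> {..<length Qs} \<Longrightarrow> distinct ks \<Longrightarrow>
    \<exists>T. rep (foldr (\<lambda>k T. ((Qs ! k) ^^ Poly_Mapping.lookup m k) \<circ> T) ks id) T \<and>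
    (\<forall>\<xi>. has_symbol \<xi> (\<Sum>k\<in>set ks. Poly_Mapping.lookup m k * (k + 2))
      (\<Prod>k\<in>set ks. p (k + 2) \<xi> ^ Poly_Mapping.lookup m k) T)" for ks
  proof (induction ks)
    case Nil
    show ?case
      by (intro exI [of _ "mop (\<lambda>_. 1)"] conjI allI)
        (simp_all only: foldr.simps id_apply list.set sum.empty prod.empty rep_id [unfolded id_def] has_symbol_one)
  next
    case (Cons k ks)
    then have ks: "set ks \<subseteq> {..<length Qs}" "distinct ks" "k \<notin> set ks" by auto
    obtain T where T: "rep (foldr (\<lambda>k T. ((Qs ! k) ^^ Poly_Mapping.lookup m k) \<circ> T) ks id) T"
      "\<And>\<xi>. has_symbol \<xi> (\<Sum>k\<in>set ks. Poly_Mapping.lookup m k * (k + 2))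
        (\<Prod>k\<in>set ks. p (k + 2) \<xi> ^ Poly_Mapping.lookup m k) T" using Cons.IH [OF ks(1,2)] by blast
    have "rep (Qs ! k) (Lint (k + 2))" using assms Cons.prems by simp
    from rep_pow [OF this T(1), of "Poly_Mapping.lookup m k"]
      has_symbol_power_mult [OF has_symbol_Lint T(2), of _ "Poly_Mapping.lookup m k" "k + 2"]
    moreover have "foldr (\<lambda>k T. ((Qs ! k) ^^ Poly_Mapping.lookup m k) \<circ> T) (k # ks) id =
      ((Qs ! k) ^^ Poly_Mapping.lookup m k) \<circ> foldr (\<lambda>k T. ((Qs ! k) ^^ Poly_Mapping.lookup m k) \<circ> T) ks id"
      by simp
    ultimately show ?case
      by (intro exI [of _ "Lint (k + 2) ^ Poly_Mapping.lookup m k * T"])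
        (simp only: list.set sum.insert [OF finite_set ks(3)] prod.insert [OF finite_set ks(3)] simp_thms)
  qed
  from * [of "[0..<length Qs]"] show ?thesis
    by (simp add: oper_monom_def atLeast0LessThan)
qed

text \<open>Give variable \<open>k\<close> the weight \<open>k + 2\<close>, the order of
  \<open>Lint (k + 2)\<close>. For the top weight \<open>N\<close> in a relation, the
  \<open>N\<close>-fold commutator with a linear form kills all lower terms and leaves a relation
  between monomials in the \<open>p (k + 2) \<xi>\<close>.\<close>

lemma alg_independent_rep:
  assumes len: "length Qs = card I" and rep: "\<And>k. k < length Qs \<Longrightarrow> rep (Qs ! k) (Lint (k + 2))"
  shows "alg_independent I H Qs"
  unfolding alg_independent_def
proof (intro allI impI notI)
  fix P :: "(nat \<Rightarrow>\<^sub>0 nat) \<Rightarrow>\<^sub>0 complex"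
  assume vars: "\<forall>m\<in>Poly_Mapping.keys P. Poly_Mapping.keys m \<subseteq> {..<length Qs}" and "P \<noteq> 0"
    and zero: "oper_eq I H (oper_poly P Qs) zero_oper"
  let ?K = "Poly_Mapping.keys P" and ?c = "Poly_Mapping.lookup P"
  define wt where "wt m = (\<Sum>k<length Qs. Poly_Mapping.lookup m k * (k + 2))" for m :: "nat \<Rightarrow>\<^sub>0 nat"
  have "\<forall>m. \<exists>T. rep (oper_monom Qs m) T \<and>
      (\<forall>\<xi>. has_symbol \<xi> (wt m) (\<Prod>k<length Qs. p (k + 2) \<xi> ^ Poly_Mapping.lookup m k) T)"
    unfolding wt_def using rep_monom [OF rep] by blast
  then obtain T where T: "\<And>m. rep (oper_monom Qs m) (T m)"
    "\<And>m \<xi>. has_symbol \<xi> (wt m) (monomial (Poly_Mapping.lookup m) \<xi>) (T m)"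
    unfolding monomial_def len by metis
  have K: "finite ?K" "?K \<noteq> {}" using \<open>P \<noteq> 0\<close> by auto
  have "rep (oper_poly P Qs) (\<Sum>m\<in>?K. mop (\<lambda>_. ?c m) * T m)"
    unfolding oper_poly_def by (intro rep_sum rep_times regular_const T(1))
  then have T0: "(\<Sum>m\<in>?K. mop (\<lambda>_. ?c m) * T m) = 0"
    using rep_oper_eq_iff [OF _ rep_zero] zero by (simp add: zero_oper_def)
  define N where "N = Max (wt ` ?K)"
  have N: "wt m \<le> N" if "m \<in> ?K" for m using that K by (simp add: N_def)
  define S where "S = Poly_Mapping.lookup ` {m \<in> ?K. wt m = N}"
  \<comment> \<open>\<open>monomials_independent\<close> takes exponents as plain functions, so
    coefficients are transported along the injective \<open>Poly_Mapping.lookup\<close>.\<close>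
  define c where "c e = ?c (Abs_poly_mapping e)" for e
  have c: "c (Poly_Mapping.lookup m) = ?c m" for m by (simp add: c_def lookup_inverse)
  have inj: "inj_on Poly_Mapping.lookup A" for A :: "(nat \<Rightarrow>\<^sub>0 nat) set"
    by (simp add: inj_on_def poly_mapping_eqI)
  have "\<forall>e\<in>S. c e = 0"
  proof (rule monomials_independent)
    show "finite S" using K by (simp add: S_def)
    show "e k = 0" if "e \<in> S" "card I \<le> k" for e k
      using that vars len by (fastforce simp: S_def in_keys_iff)
    show "(\<Sum>k<card I. e k) \<le> N" if e: "e \<in> S" for e
    proof -
      obtain m where m: "e = Poly_Mapping.lookup m" "wt m = N" using e by (auto simp: S_def)
      \<comment> \<open>All weights are at least 1, so \<open>N\<close> also bounds the ordinary
        degree.\<close>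
      have "(\<Sum>k<card I. e k) \<le> (\<Sum>k<card I. e k * (k + 2))" by (rule sum_mono) simp
      then show ?thesis using m by (simp add: wt_def len)
    qed
    fix \<xi>
    let ?l = "mop (lin \<xi>)"
    have c_pow: "(ad ?l ^^ n) (mop (\<lambda>_. d) * S) = mop (\<lambda>_. d) * (ad ?l ^^ n) S" for n d S
      by (induction n) (auto simp: ad_mult ad_mop_mop regular_lin)
    have "0 = (ad ?l ^^ N) (\<Sum>m\<in>?K. mop (\<lambda>_. ?c m) * T m)" unfolding T0 by simp
    also have "\<dots> = (\<Sum>m\<in>?K. mop (\<lambda>_. ?c m) * (ad ?l ^^ N) (T m))"
      by (simp only: ad_pow_sum c_pow)
    also have "\<dots> = (\<Sum>m | m \<in> ?K \<and> wt m = N. mop (\<lambda>_. ?c m) * (ad ?l ^^ N) (T m))"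
    proof (rule sum.mono_neutral_right [OF K(1)])
      show "\<forall>m\<in>?K - {m. m \<in> ?K \<and> wt m = N}. mop (\<lambda>_. ?c m) * (ad ?l ^^ N) (T m) = 0"
      proof
        fix m assume "m \<in> ?K - {m. m \<in> ?K \<and> wt m = N}"
        then have "wt m < N" using N [of m] by force
        then show "mop (\<lambda>_. ?c m) * (ad ?l ^^ N) (T m) = 0" using has_symbol_vanish [OF T(2)] by simp
      qed
    qed auto
    also have "\<dots> = (\<Sum>m | m \<in> ?K \<and> wt m = N. mop (\<lambda>_. ?c m * (fact N * monomial (Poly_Mapping.lookup m) \<xi>)))"
    proof (rule sum.cong [OF refl])
      fix m assume "m \<in> {m. m \<in> ?K \<and> wt m = N}"
      then have "(ad ?l ^^ N) (T m) = mop (\<lambda>_. fact N * monomial (Poly_Mapping.lookup m) \<xi>)"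
        using T(2) [of \<xi> m] by (simp add: has_symbol_def)
      then show "mop (\<lambda>_. ?c m) * (ad ?l ^^ N) (T m) = mop (\<lambda>_. ?c m * (fact N * monomial (Poly_Mapping.lookup m) \<xi>))"
        by (simp only: mop_mult regular_const)
    qed
    also have "\<dots> = mop (\<lambda>_. \<Sum>m | m \<in> ?K \<and> wt m = N. ?c m * (fact N * monomial (Poly_Mapping.lookup m) \<xi>))"
      by (simp only: mop_sum)
    finally have "(\<Sum>m | m \<in> ?K \<and> wt m = N. ?c m * (fact N * monomial (Poly_Mapping.lookup m) \<xi>)) = 0"
      by (intro mop_const_eq_0) simp
    also have "(\<Sum>m | m \<in> ?K \<and> wt m = N. ?c m * (fact N * monomial (Poly_Mapping.lookup m) \<xi>))
        = fact N * (\<Sum>e\<in>S. c e * monomial e \<xi>)"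
      unfolding S_def by (simp add: sum.reindex [OF inj] c sum_distrib_left ac_simps)
    finally show "(\<Sum>e\<in>S. c e * monomial e \<xi>) = 0" by simp
  qed
  moreover have "N \<in> wt ` ?K" unfolding N_def using K by (intro Max_in) auto
  then obtain m where "m \<in> ?K" "wt m = N" by auto
  ultimately have "?c m = 0" using c by (auto simp: S_def)
  then show False using \<open>m \<in> ?K\<close> by (simp add: in_keys_iff)
qed

section \<open>Complete integrability of the abstract operator\<close>

lemma L_diff_lop: "L \<in> diff_lop"
  unfolding L_def by (intro diff_lop_add diff_lop_sum diff_lop_mult diff_lop_dop diff_lop_mop regular_coeffs)

lemma Lint_diff_lop: "Lint d \<in> diff_lop"
  unfolding Lint_def by (intro diff_lop_scaleR diff_lop_ad_pow L_diff_lop diff_lop_mop regular_p)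

lemma completely_integrable_rep:
  assumes "0 < card I" and P: "rep P L" and J: "\<And>d. rep (J d) (Lint d)"
  shows "completely_integrable I H P"
proof -
  \<comment> \<open>Position 0, which exists as \<open>0 < card I\<close>, holds \<open>P\<close>
    literally because the definition asks for membership of \<open>P\<close>; it fits the pattern
    since \<open>Lint 2 = L\<close>.\<close>
  define Qs where "Qs = map (\<lambda>k. if k = 0 then P else J (k + 2)) [0..<card I]"
  have rep: "rep (Qs ! k) (Lint (k + 2))" if "k < length Qs" for k
    using that P J [of "k + 2"] Lint_2 by (cases "k = 0") (simp_all add: Qs_def numeral_2_eq_2)
  have set: "\<exists>d\<ge>1. rep X (Lint d)" if X: "X \<in> set Qs" for X
  proof -
    obtain k where "k < length Qs" "X = Qs ! k" using X by (auto simp: in_set_conv_nth)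
    then show ?thesis using rep [of k] by (intro exI [of _ "k + 2"]) auto
  qed
  show ?thesis
    unfolding completely_integrable_def
  proof (intro exI [of _ Qs] conjI ballI)
    show "length Qs = card I" by (simp add: Qs_def)
    show "P \<in> set Qs" using assms(1) by (force simp: Qs_def)
    show "diff_oper I H X" if "X \<in> set Qs" for X
      using set [OF that] diff_oper_rep Lint_diff_lop by blast
    show "oper_eq I H (commutator X Y) zero_oper" if XY: "X \<in> set Qs" "Y \<in> set Qs" for X Y
    proof -
      obtain d e where "1 \<le> d" "rep X (Lint d)" "1 \<le> e" "rep Y (Lint e)" using set XY by meson
      then have "rep (commutator X Y) 0" using rep_commutator [of X _ Y] ad_Lint_Lint by fastforce
      then show ?thesis using rep_oper_eq_iff [OF _ rep_zero] by (simp add: zero_oper_def)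
    qed
    show "alg_independent I H Qs" by (rule alg_independent_rep [OF _ rep]) (auto simp: Qs_def)
  qed
qed

end

section \<open>Three species of particles\<close>

fun coord_scale :: "complex \<Rightarrow> complex \<Rightarrow> complex \<Rightarrow> coord \<Rightarrow> complex" where
  "coord_scale a b c (X _) = a"
| "coord_scale a b c (X' _) = b"
| "coord_scale a b c (X'' _) = c"

lemma sum_coords:
  "(\<Sum>k\<in>coords n1 n2 n3. f k) = (\<Sum>i=1..n1. f (X i)) + (\<Sum>i=1..n2. f (X' i)) + (\<Sum>i=1..n3. f (X'' i))"
proof -
  have "inj_on X A" "inj_on X' A" "inj_on X'' A" for A by (auto simp: inj_on_def)
  then show ?thesis
    unfolding coords_def
    by (subst sum.union_disjoint; (subst sum.union_disjoint)?) (auto simp: sum.reindex)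
qed

lemma card_coords: "card (coords n1 n2 n3) = n1 + n2 + n3"
  using sum_coords [where f = "\<lambda>_. 1 :: nat" and ?n1.0 = n1 and ?n2.0 = n2 and ?n3.0 = n3] by simp

text \<open>Each unordered pair is counted twice on the left, and the diagonal contributes nothing
  as \<open>inverse 0 = 0\<close>.\<close>

lemma sum_pairs_ordered:
  fixes f :: "nat \<Rightarrow> complex"
  shows "(\<Sum>i=1..n. \<Sum>j=1..n. inverse (f i - f j) ^ 2) = (\<Sum>j=1..n. \<Sum>i=1..<j. 2 / (f i - f j) ^ 2)"
proof (induction n)
  case (Suc n)
  have *: "(f (Suc n) - f i) ^ 2 = (f i - f (Suc n)) ^ 2" for i
    by (rule power2_commute)
  have "(\<Sum>i=1..Suc n. \<Sum>j=1..Suc n. inverse (f i - f j) ^ 2) =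
      (\<Sum>i=1..n. \<Sum>j=1..n. inverse (f i - f j) ^ 2) + (\<Sum>i=1..n. 2 / (f i - f (Suc n)) ^ 2)"
    by (simp add: sum.distrib * sum_distrib_left [symmetric] divide_inverse power_inverse)
  also have "\<dots> = (\<Sum>j=1..Suc n. \<Sum>i=1..<j. 2 / (f i - f j) ^ 2)"
    by (simp add: Suc atLeastLessThanSuc_atLeastAtMost del: One_nat_def)
  finally show ?case .
qed simp

lemma inverse_scale_sq: "inverse (a * u - a * v) ^ 2 = inverse a ^ 2 * inverse (u - v :: complex) ^ 2"
  by (simp add: right_diff_distrib [symmetric] power_mult_distrib)

lemma inverse_diff_sq_swap: "inverse (u - v :: complex) ^ 2 = inverse (v - u) ^ 2"
  by (metis minus_diff_eq inverse_minus_eq power2_minus)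

lemma finite_sing_forms: "finite (sing_forms n1 n2 n3 a b c)"
proof -
  have "finite {g i j | i j. 1 \<le> i \<and> i < j \<and> j \<le> n}" for g :: "nat \<Rightarrow> nat \<Rightarrow> coord scalar_fun" and n
    by (rule finite_subset [of _ "(\<lambda>(i, j). g i j) ` ({1..n} \<times> {1..n})"]) auto
  moreover have "finite {g i j | i j. i \<in> {1..n} \<and> j \<in> {1..m}}" for g :: "nat \<Rightarrow> nat \<Rightarrow> coord scalar_fun" and n m
    by (rule finite_subset [of _ "(\<lambda>(i, j). g i j) ` ({1..n} \<times> {1..m})"]) auto
  ultimately show ?thesis unfolding sing_forms_def by (intro finite_UnI)
qed

section \<open>Verification of the abstract assumptions for three species\<close>

locale three_species =
  fixes n1 n2 n3 :: nat and a b c :: complex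
  assumes nz: "a \<noteq> 0" "b \<noteq> 0" "c \<noteq> 0" and abc: "a ^ 2 + b ^ 2 + c ^ 2 = 0"
begin

abbreviation "\<alpha> \<equiv> coord_scale a b c"
abbreviation "C \<equiv> coords n1 n2 n3"
abbreviation "F \<equiv> sing_forms n1 n2 n3 a b c"

lemma \<alpha>_nonzero: "\<alpha> i \<noteq> 0"
  using nz by (cases i) auto

text \<open>\<open>F\<close> contains only unscaled differences with \<open>i < j\<close>; the
  factor \<open>1 / s\<close> removes the scale, and \<open>- 1 / s\<close> also reverses the
  order.\<close>

lemma same_species_form:
  fixes Y :: "nat \<Rightarrow> coord"
  assumes "\<And>i. \<alpha> (Y i) = s" "\<And>i j. 1 \<le> i \<Longrightarrow> i < j \<Longrightarrow> j \<le> n \<Longrightarrow> (\<lambda>x. x (Y i) - x (Y j)) \<in> F"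
    and "i \<in> {1..n}" "j \<in> {1..n}" "i \<noteq> j"
  shows "\<exists>e. e \<noteq> 0 \<and> (\<lambda>x. e * (\<alpha> (Y i) * x (Y i) - \<alpha> (Y j) * x (Y j))) \<in> F"
proof (cases "i < j")
  case True
  have s: "s \<noteq> 0" using \<alpha>_nonzero assms(1) by metis
  have "(\<lambda>x. 1 / s * (\<alpha> (Y i) * x (Y i) - \<alpha> (Y j) * x (Y j))) = (\<lambda>x. x (Y i) - x (Y j))"
    using s by (simp add: assms(1) fun_eq_iff field_simps)
  then show ?thesis using assms True s by (intro exI [of _ "1 / s"]) auto
next
  case False
  have s: "s \<noteq> 0" using \<alpha>_nonzero assms(1) by metis
  have "(\<lambda>x. - 1 / s * (\<alpha> (Y i) * x (Y i) - \<alpha> (Y j) * x (Y j))) = (\<lambda>x. x (Y j) - x (Y i))"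
    using s by (simp add: assms(1) fun_eq_iff field_simps)
  moreover have "j < i" using False assms(5) by simp
  ultimately show ?thesis using assms(2) [of j i] assms(3,4) s by (intro exI [of _ "- 1 / s"]) auto
qed

lemma mixed_form:
  assumes "(\<lambda>x. \<alpha> i * x i - \<alpha> j * x j) \<in> F"
  shows "\<exists>e. e \<noteq> 0 \<and> (\<lambda>x. e * (\<alpha> i * x i - \<alpha> j * x j)) \<in> F"
    and "\<exists>e. e \<noteq> 0 \<and> (\<lambda>x. e * (\<alpha> j * x j - \<alpha> i * x i)) \<in> F"
proof -
  show "\<exists>e. e \<noteq> 0 \<and> (\<lambda>x. e * (\<alpha> i * x i - \<alpha> j * x j)) \<in> F"
    using assms by (intro exI [of _ 1]) simp
  show "\<exists>e. e \<noteq> 0 \<and> (\<lambda>x. e * (\<alpha> j * x j - \<alpha> i * x i)) \<in> F"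
    using assms by (intro exI [of _ "- 1"]) simp
qed

lemma cover:
  assumes "i \<in> C" "j \<in> C" "i \<noteq> j"
  shows "\<exists>e. e \<noteq> 0 \<and> (\<lambda>x. e * (\<alpha> i * x i - \<alpha> j * x j)) \<in> F"
proof -
  have 1: "(\<lambda>x. x (X k) - x (X l)) \<in> F" if "1 \<le> k" "k < l" "l \<le> n1" for k l
    using that unfolding sing_forms_def by blast
  have 2: "(\<lambda>x. x (X' k) - x (X' l)) \<in> F" if "1 \<le> k" "k < l" "l \<le> n2" for k l
    using that unfolding sing_forms_def by blast
  have 3: "(\<lambda>x. x (X'' k) - x (X'' l)) \<in> F" if "1 \<le> k" "k < l" "l \<le> n3" for k l
    using that unfolding sing_forms_def by blast
  have 4: "(\<lambda>x. \<alpha> (X' k) * x (X' k) - \<alpha> (X'' l) * x (X'' l)) \<in> F" if "k \<in> {1..n2}" "l \<in> {1..n3}" for k l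
    using that unfolding sing_forms_def coord_scale.simps by blast
  have 5: "(\<lambda>x. \<alpha> (X k) * x (X k) - \<alpha> (X'' l) * x (X'' l)) \<in> F" if "k \<in> {1..n1}" "l \<in> {1..n3}" for k l
    using that unfolding sing_forms_def coord_scale.simps by blast
  have 6: "(\<lambda>x. \<alpha> (X k) * x (X k) - \<alpha> (X' l) * x (X' l)) \<in> F" if "k \<in> {1..n1}" "l \<in> {1..n2}" for k l
    using that unfolding sing_forms_def coord_scale.simps by blast
  show ?thesis
  proof (cases i; cases j)
    fix k l assume "i = X k" "j = X l"
    then show ?thesis using assms same_species_form [of X a, OF _ 1] by (auto simp: coords_def)
  next
    fix k l assume "i = X' k" "j = X' l"
    then show ?thesis using assms same_species_form [of X' b, OF _ 2] by (auto simp: coords_def)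
  next
    fix k l assume "i = X'' k" "j = X'' l"
    then show ?thesis using assms same_species_form [of X'' c, OF _ 3] by (auto simp: coords_def)
  next
    fix k l assume ij: "i = X k" "j = X' l"
    show ?thesis unfolding ij by (rule mixed_form(1) [OF 6]) (use ij assms in \<open>auto simp: coords_def\<close>)
  next
    fix k l assume ij: "i = X k" "j = X'' l"
    show ?thesis unfolding ij by (rule mixed_form(1) [OF 5]) (use ij assms in \<open>auto simp: coords_def\<close>)
  next
    fix k l assume ij: "i = X' k" "j = X'' l"
    show ?thesis unfolding ij by (rule mixed_form(1) [OF 4]) (use ij assms in \<open>auto simp: coords_def\<close>)
  next
    fix k l assume ij: "i = X' k" "j = X l"
    show ?thesis unfolding ij by (rule mixed_form(2) [OF 6]) (use ij assms in \<open>auto simp: coords_def\<close>)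
  next
    fix k l assume ij: "i = X'' k" "j = X l"
    show ?thesis unfolding ij by (rule mixed_form(2) [OF 5]) (use ij assms in \<open>auto simp: coords_def\<close>)
  next
    fix k l assume ij: "i = X'' k" "j = X' l"
    show ?thesis unfolding ij by (rule mixed_form(2) [OF 4]) (use ij assms in \<open>auto simp: coords_def\<close>)
  qed
qed

lemma form_shape:
  assumes "h \<in> F"
  shows "\<exists>i\<in>C. \<exists>j\<in>C. \<exists>e. i \<noteq> j \<and> e \<noteq> 0 \<and> h = (\<lambda>x. e * (\<alpha> i * x i - \<alpha> j * x j))"
proof -
  have same: ?thesis
    if "h = (\<lambda>x. x (Y i) - x (Y j))" "Y i \<in> C" "Y j \<in> C" "Y i \<noteq> Y j" "\<And>i. \<alpha> (Y i) = s" "s \<noteq> 0" for Y i j s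
    using that by (intro bexI [of _ "Y i"] bexI [of _ "Y j"] exI [of _ "1 / s"]) (auto simp: field_simps)
  have mixed: ?thesis
    if "h = (\<lambda>x. \<alpha> i * x i - \<alpha> j * x j)" "i \<in> C" "j \<in> C" "i \<noteq> j" for i j
    using that by (intro bexI [of _ i] bexI [of _ j] exI [of _ 1]) auto
  from assms consider
      i j where "h = (\<lambda>x. x (X i) - x (X j))" "1 \<le> i" "i < j" "j \<le> n1"
    | i j where "h = (\<lambda>x. x (X' i) - x (X' j))" "1 \<le> i" "i < j" "j \<le> n2"
    | i j where "h = (\<lambda>x. x (X'' i) - x (X'' j))" "1 \<le> i" "i < j" "j \<le> n3"
    | i j where "h = (\<lambda>x. b * x (X' i) - c * x (X'' j))" "i \<in> {1..n2}" "j \<in> {1..n3}"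
    | i j where "h = (\<lambda>x. a * x (X i) - c * x (X'' j))" "i \<in> {1..n1}" "j \<in> {1..n3}"
    | i j where "h = (\<lambda>x. a * x (X i) - b * x (X' j))" "i \<in> {1..n1}" "j \<in> {1..n2}"
    unfolding sing_forms_def by blast
  then show ?thesis
  proof cases
    case (1 i j) then show ?thesis using nz by (intro same [of X i j a]) (auto simp: coords_def)
  next
    case (2 i j) then show ?thesis using nz by (intro same [of X' i j b]) (auto simp: coords_def)
  next
    case (3 i j) then show ?thesis using nz by (intro same [of X'' i j c]) (auto simp: coords_def)
  next
    case (4 i j) then show ?thesis by (intro mixed [of "X' i" "X'' j"]) (auto simp: coords_def)
  next
    case (5 i j) then show ?thesis by (intro mixed [of "X i" "X'' j"]) (auto simp: coords_def)
  next
    case (6 i j) then show ?thesis by (intro mixed [of "X i" "X' j"]) (auto simp: coords_def)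
  qed
qed

text \<open>For two different species, the sum of the two squared scales is minus the third squared
  scale, by \<open>abc\<close>.\<close>

lemma scale_rel:
  "\<alpha> i ^ 2 = \<alpha> j ^ 2 \<or> \<alpha> i ^ 2 * \<alpha> j ^ 2 * (\<alpha> i ^ 2 + \<alpha> j ^ 2) = - (a ^ 2 * b ^ 2 * c ^ 2)"
proof -
  have "a ^ 2 + b ^ 2 = - (c ^ 2)" "b ^ 2 + a ^ 2 = - (c ^ 2)" "a ^ 2 + c ^ 2 = - (b ^ 2)"
    "c ^ 2 + a ^ 2 = - (b ^ 2)" "b ^ 2 + c ^ 2 = - (a ^ 2)" "c ^ 2 + b ^ 2 = - (a ^ 2)"
    using abc by algebra+
  then show ?thesis by (cases i; cases j) (simp_all add: mult_ac)
qed

end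

sublocale three_species \<subseteq> calogero_moser C F \<alpha> "a ^ 2 * b ^ 2 * c ^ 2"
proof
  show "finite C" by (simp add: coords_def)
  show "finite F" by (rule finite_sing_forms)
qed (rule \<alpha>_nonzero, erule form_shape, erule (2) cover, rule scale_rel)

section \<open>Identification with the concrete operators\<close>

context three_species
begin

text \<open>For species \<open>a\<close> and \<open>b\<close>,
  \<open>\<kappa> / (a ^ 2 * b ^ 2)\<close> is \<open>c ^ 2\<close>, and the two orders of a pair
  give the 2. Within species \<open>a\<close>, \<open>\<kappa> / a ^ 4\<close> is
  \<open>b ^ 2 * c ^ 2 / a ^ 2\<close>, and pulling the scale out of the squared difference gives a
  further \<open>1 / a ^ 2\<close>.\<close>

lemma U_eq:
  "U x = (b^2 * c^2 / a^4) * (\<Sum>j=1..n1. \<Sum>i=1..<j. 2 / (x (X i) - x (X j))^2)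
    + a^2 * (\<Sum>i=1..n2. \<Sum>j=1..n3. 2 / (b * x (X' i) - c * x (X'' j))^2)
    + (a^2 * c^2 / b^4) * (\<Sum>j=1..n2. \<Sum>i=1..<j. 2 / (x (X' i) - x (X' j))^2)
    + b^2 * (\<Sum>i=1..n1. \<Sum>j=1..n3. 2 / (a * x (X i) - c * x (X'' j))^2)
    + (a^2 * b^2 / c^4) * (\<Sum>j=1..n3. \<Sum>i=1..<j. 2 / (x (X'' i) - x (X'' j))^2)
    + c^2 * (\<Sum>i=1..n1. \<Sum>j=1..n2. 2 / (a * x (X i) - b * x (X' j))^2)"
proof -
  let ?\<kappa> = "a ^ 2 * b ^ 2 * c ^ 2"
  define S where "S Y Z n m = (\<Sum>i=1..n. \<Sum>j=1..m. inverse (\<alpha> (Y i) * x (Y i) - \<alpha> (Z j) * x (Z j)) ^ 2)"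
    for Y Z :: "nat \<Rightarrow> coord" and n m
  have swap: "S Z Y m n = S Y Z n m" for Y Z n m
    unfolding S_def by (subst sum.swap) (intro sum.cong refl inverse_diff_sq_swap)
  have same: "s ^ 2 * S Y Y n n = (\<Sum>j=1..n. \<Sum>i=1..<j. 2 / (x (Y i) - x (Y j)) ^ 2)"
    if Y: "\<And>i. \<alpha> (Y i) = s" and s: "s \<noteq> 0" for Y n s
  proof -
    have "S Y Y n n = inverse s ^ 2 * (\<Sum>j=1..n. \<Sum>i=1..<j. 2 / (x (Y i) - x (Y j)) ^ 2)"
      unfolding S_def Y inverse_scale_sq sum_distrib_left [symmetric] sum_pairs_ordered [of "\<lambda>i. x (Y i)"] ..
    then show ?thesis using s by (simp add: mult.assoc [symmetric] power_mult_distrib [symmetric])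
  qed
  have mixed: "2 * S Y Z n m = (\<Sum>i=1..n. \<Sum>j=1..m. 2 / (\<alpha> (Y i) * x (Y i) - \<alpha> (Z j) * x (Z j)) ^ 2)" for Y Z n m
    unfolding S_def sum_distrib_left by (simp add: divide_inverse power_inverse)
  have "U x = ?\<kappa> * (S X X n1 n1 / a ^ 4 + S X' X' n2 n2 / b ^ 4 + S X'' X'' n3 n3 / c ^ 4
      + 2 * S X X' n1 n2 / (a ^ 2 * b ^ 2) + 2 * S X X'' n1 n3 / (a ^ 2 * c ^ 2) + 2 * S X' X'' n2 n3 / (b ^ 2 * c ^ 2))"
  proof -
    \<comment> \<open>The double sum over all coordinates splits into nine blocks, one for each
      ordered pair of species.\<close>
    have block: "(\<Sum>i=1..n. 1 / u ^ 2 * (\<Sum>j=1..m. 1 / v ^ 2 * r (Y i) (Z j) x ^ 2)) = S Y Z n m / (u ^ 2 * v ^ 2)"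
      for Y Z n m u v
      by (simp add: S_def r_def sum_distrib_left sum_divide_distrib mult.commute)
    have "U x = ?\<kappa> * (S X X n1 n1 / (a ^ 2 * a ^ 2) + S X X' n1 n2 / (a ^ 2 * b ^ 2) + S X X'' n1 n3 / (a ^ 2 * c ^ 2)
      + (S X' X n2 n1 / (b ^ 2 * a ^ 2) + S X' X' n2 n2 / (b ^ 2 * b ^ 2) + S X' X'' n2 n3 / (b ^ 2 * c ^ 2))
      + (S X'' X n3 n1 / (c ^ 2 * a ^ 2) + S X'' X' n3 n2 / (c ^ 2 * b ^ 2) + S X'' X'' n3 n3 / (c ^ 2 * c ^ 2)))"
      unfolding U_def s_def sum_coords coord_scale.simps distrib_left sum.distrib block
      by (simp only: add_ac)
    then show ?thesis
      unfolding swap [of X' X] swap [of X'' X] swap [of X'' X']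
      by (simp add: mult.commute power_add [symmetric])
  qed
  also have "\<dots> = b ^ 2 * c ^ 2 / a ^ 4 * (a ^ 2 * S X X n1 n1) + a ^ 2 * (2 * S X' X'' n2 n3)
      + a ^ 2 * c ^ 2 / b ^ 4 * (b ^ 2 * S X' X' n2 n2) + b ^ 2 * (2 * S X X'' n1 n3)
      + a ^ 2 * b ^ 2 / c ^ 4 * (c ^ 2 * S X'' X'' n3 n3) + c ^ 2 * (2 * S X X' n1 n2)"
  proof -
    \<comment> \<open>An identity of rational functions in the squared scales, with the block sums
      as free variables.\<close>
    have "p * q * r * (s1 / p ^ 2 + s2 / q ^ 2 + s3 / r ^ 2 + 2 * t1 / (p * q) + 2 * t2 / (p * r) + 2 * t3 / (q * r)) =
      q * r / p ^ 2 * (p * s1) + p * (2 * t3) + p * r / q ^ 2 * (q * s2) + q * (2 * t2) + p * q / r ^ 2 * (r * s3) + r * (2 * t1)"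
      if "p \<noteq> 0" "q \<noteq> 0" "r \<noteq> 0" for p q r s1 s2 s3 t1 t2 t3 :: complex
      using that by (simp add: field_simps power2_eq_square)
    from this [of "a ^ 2" "b ^ 2" "c ^ 2"] show ?thesis using nz by (simp flip: power_mult)
  qed
  finally show ?thesis
    using nz by (simp add: mixed same [of X a] same [of X' b] same [of X'' c])
qed

lemma rep_laplacian:
  assumes "\<And>i. i \<in> {1..n} \<Longrightarrow> Y i \<in> C"
  shows "rep (laplacian Y n) (\<Sum>i=1..n. dop (Y i) * dop (Y i))"
proof -
  have "rep (\<lambda>f. pderivative (Y i) (pderivative (Y i) f)) (dop (Y i) * dop (Y i))" if "i \<in> {1..n}" for i
    using rep_comp [OF rep_pderivative rep_pderivative] assms [OF that] by blast
  then show ?thesis unfolding laplacian_def [abs_def] by (rule rep_sum)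
qed

lemma rep_L_A: "rep (L_A n1 n2 n3 a b c) L"
proof -
  have l: "rep (laplacian X n1) (\<Sum>i=1..n1. dop (X i) * dop (X i))"
    "rep (laplacian X' n2) (\<Sum>i=1..n2. dop (X' i) * dop (X' i))"
    "rep (laplacian X'' n3) (\<Sum>i=1..n3. dop (X'' i) * dop (X'' i))"
    by (rule rep_laplacian, simp add: coords_def)+
  have "rep (\<lambda>f x. laplacian X n1 f x + laplacian X' n2 f x + laplacian X'' n3 f x + mult_oper U f x)
     ((\<Sum>i=1..n1. dop (X i) * dop (X i)) + (\<Sum>i=1..n2. dop (X' i) * dop (X' i)) + (\<Sum>i=1..n3. dop (X'' i) * dop (X'' i)) + mop U)"
    by (rule rep_add [OF rep_add [OF rep_add [OF l(1,2)] l(3)] rep_mult_oper [OF regular_coeffs(1)]])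
  then have "rep (\<lambda>f x. laplacian X n1 f x + laplacian X' n2 f x + laplacian X'' n3 f x + U x * f x) L"
    by (simp only: L_def sum_coords mult_oper_def)
  then show ?thesis
    by (rule rep_oper_eq) (simp only: L_A_def U_eq, simp add: algebra_simps)
qed

lemma power_sum_eq: "power_sum n1 n2 n3 a b c d = p d"
  by (simp add: fun_eq_iff power_sum_def p_def sum_coords sum_distrib_left)

lemma rep_L_int: "rep (L_int n1 n2 n3 a b c d) (Lint d)"
proof -
  have "rep ((commutator (L_A n1 n2 n3 a b c) ^^ d) (mult_oper (p d))) ((ad L ^^ d) (mop (p d)))"
    by (rule rep_commutator_pow [OF rep_L_A rep_mult_oper [OF regular_p]])
  from rep_scaleR [OF this, of "1 / (2 ^ d * fact d)"] show ?thesis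
    by (simp add: L_int_def [abs_def] power_sum_eq Lint_def)
qed

end

theorem proposition6p8:
  fixes n1 n2 n3 :: nat and a b c :: complex
  assumes "a \<noteq> 0" "b \<noteq> 0" "c \<noteq> 0"
    and "a^2 + b^2 + c^2 = 0"
  shows "(n1 + n2 + n3 > 0 \<longrightarrow>
            completely_integrable (coords n1 n2 n3) (sing_forms n1 n2 n3 a b c)
              (L_A n1 n2 n3 a b c)) \<and>
         (\<forall>d1\<ge>1. \<forall>d2\<ge>1.
            oper_eq (coords n1 n2 n3) (sing_forms n1 n2 n3 a b c)
              (commutator (L_int n1 n2 n3 a b c d1) (L_int n1 n2 n3 a b c d2)) zero_oper)"
proof -
  interpret three_species n1 n2 n3 a b c using assms by unfold_locales
  have "oper_eq C F (commutator (L_int n1 n2 n3 a b c d1) (L_int n1 n2 n3 a b c d2)) zero_oper"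
    if "d1 \<ge> 1" "d2 \<ge> 1" for d1 d2
    using rep_commutator [OF rep_L_int rep_L_int, of d1 d2] rep_oper_eq_iff [OF _ rep_zero]
    unfolding ad_Lint_Lint [OF that] zero_oper_def by blast
  moreover have "completely_integrable C F (L_A n1 n2 n3 a b c)" if "n1 + n2 + n3 > 0"
    using that by (intro completely_integrable_rep [OF _ rep_L_A rep_L_int]) (simp add: card_coords)
  ultimately show ?thesis by blast
qed

end
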